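(* Let $g_0$ be a bi-invariant Riemannian metric on a compact simple Lie group $G$, with Laplacian $\Delta_0$, and let $g\ne g_0$ be a left-invariant Riemannian metric on $G$, with Laplacian $\Delta_g$, which satisfies $\operatorname{vol}(g) \leq \operatorname{vol}(g_0)$. Then there exists a constant $C = C(g) >1$ such that $$\operatorname{Tr}(\Delta_g\restriction V)=C\,\operatorname{Tr}(\Delta_0 \restriction V)$$ for every finite dimensional subspace $V\leq L^2(G)$ which is invariant under the right-regular representation $\rho$ of $G$ and on which $G$ acts nontrivially.
   Context: A bi-invariant metric is one that is both left- and right-invariant. A Lie group is simple if its Lie algebra is simple (in particular non-abelian). $\operatorname{vol}(g)$ is the total Riemannian volume of $(G,g)$. $\rho: G\to U(L^2(G))$ is the right-regular representation of $G$ on complex-valued functions, $(\rho(x)f)(y)=f(yx)$, and $\rho_*$ is its differential. For a left-invariant metric $g$ and any $g$-orthonormal basis $\{Y_1,\dots,Y_n\}$ of the Lie algebra of $G$, the Laplace operator on smooth functions on $G$ is $\Delta_g=-\sum_{j=1}^n(\rho_*Y_j)^2$ (the Laplacian with non-negative eigenvalues). Any finite dimensional $\rho$-invariant subspace $V\leq L^2(G)$ consists of smooth functions and is invariant under $\Delta_g$ for every left-invariant metric $g$; $\Delta_g\restriction V$ denotes the restriction $V\to V$. *)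

theory Defs
  imports
    "HOL-Analysis.Analysis"
    "HOL-Algebra.Group"
    "HOL-Library.Function_Algebras"
begin

section \<open>Vector spaces of functions\<close>

interpretation cfun: vector_space "\<lambda>(c::complex) (f::'a \<Rightarrow> complex) x. c * f x"
  by unfold_locales (auto simp: fun_eq_iff algebra_simps)

interpretation rfun: vector_space "\<lambda>(r::real) (f::'a \<Rightarrow> complex) x. of_real r * f x"
  by unfold_locales (auto simp: fun_eq_iff algebra_simps)

text \<open>Trace of an operator \<open>T\<close> mapping a finite dimensional complex space \<open>W\<close> of functions into
  itself; the choice of the basis does not matter.\<close>

definition trace_on :: "('a \<Rightarrow> complex) set \<Rightarrow> (('a \<Rightarrow> complex) \<Rightarrow> 'a \<Rightarrow> complex) \<Rightarrow> complex" where
  "trace_on W T =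
     (let B = SOME B. finite B \<and> cfun.independent B \<and> cfun.span B = W
      in \<Sum>b\<in>B. cfun.representation B (T b) b)"

section \<open>Smooth manifolds and Lie groups\<close>

text \<open>Only used for open \<open>S\<close>.\<close>

primrec Ck_on :: "nat \<Rightarrow> 'a::euclidean_space set \<Rightarrow> ('a \<Rightarrow> 'b::real_normed_vector) \<Rightarrow> bool" where
  "Ck_on 0 S f \<longleftrightarrow> continuous_on S f"
| "Ck_on (Suc k) S f \<longleftrightarrow> (\<forall>x\<in>S. f differentiable (at x)) \<and>
     (\<forall>v. Ck_on k S (\<lambda>x. frechet_derivative f (at x) v))"

definition smooth_on :: "'a::euclidean_space set \<Rightarrow> ('a \<Rightarrow> 'b::real_normed_vector) \<Rightarrow> bool" where
  "smooth_on S f \<longleftrightarrow> (\<forall>k. Ck_on k S f)"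

text \<open>A chart is a pair of its domain and its coordinate map; the values of the coordinate map
  outside the domain are irrelevant.\<close>

type_synonym ('m, 'e) chart = "'m set \<times> ('m \<Rightarrow> 'e)"

text \<open>The underlying space is Hausdorff and second countable by its type class. Atlases are not
  required to be maximal.\<close>

definition smooth_atlas ::
  "('m::{t2_space,second_countable_topology}, 'e::euclidean_space) chart set \<Rightarrow> bool" where
  "smooth_atlas A \<longleftrightarrow>
     (\<forall>(U,\<phi>)\<in>A. open U \<and> open (\<phi> ` U) \<and> homeomorphism U (\<phi> ` U) \<phi> (inv_into U \<phi>)) \<and>
     (\<Union>(U,\<phi>)\<in>A. U) = UNIV \<and>
     (\<forall>(U,\<phi>)\<in>A. \<forall>(V,\<psi>)\<in>A. smooth_on (\<phi> ` (U \<inter> V)) (\<psi> \<circ> inv_into U \<phi>))"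

definition smooth_map ::
  "('m::topological_space, 'e::euclidean_space) chart set \<Rightarrow>
   ('k::topological_space, 'f::euclidean_space) chart set \<Rightarrow> ('m \<Rightarrow> 'k) \<Rightarrow> bool" where
  "smooth_map A B F \<longleftrightarrow> continuous_on UNIV F \<and>
     (\<forall>(U,\<phi>)\<in>A. \<forall>(V,\<psi>)\<in>B. smooth_on (\<phi> ` (U \<inter> F -` V)) (\<psi> \<circ> F \<circ> inv_into U \<phi>))"

definition prod_atlas ::
  "('m, 'e) chart set \<Rightarrow> ('k, 'f) chart set \<Rightarrow> ('m \<times> 'k, 'e \<times> 'f) chart set" where
  "prod_atlas A B = {(U \<times> V, map_prod \<phi> \<psi>) |U \<phi> V \<psi>. (U,\<phi>) \<in> A \<and> (V,\<psi>) \<in> B}"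

definition smooth_fun ::
  "('m::topological_space, 'e::euclidean_space) chart set \<Rightarrow> ('m \<Rightarrow> complex) \<Rightarrow> bool" where
  "smooth_fun A f \<longleftrightarrow> smooth_map A {(UNIV, id)} f"

definition lie_group ::
  "'g monoid \<Rightarrow> ('g::{t2_space,second_countable_topology}, 'e::euclidean_space) chart set \<Rightarrow> bool"
  where
  "lie_group G A \<longleftrightarrow> group G \<and> carrier G = UNIV \<and> smooth_atlas A \<and>
     smooth_map (prod_atlas A A) A (\<lambda>(x, y). x \<otimes>\<^bsub>G\<^esub> y) \<and>
     smooth_map A A (\<lambda>x. inv\<^bsub>G\<^esub> x)"

section \<open>Tangent vectors and Riemannian metrics\<close>

text \<open>A tangent vector is represented by the directional derivative it induces on smooth
  complex-valued functions. It is set to zero on functions that are not smooth, so that it is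
  determined by its values on smooth functions. The tangent spaces are real vector spaces
  (\<open>rfun\<close>).\<close>

type_synonym 'm tvec = "('m \<Rightarrow> complex) \<Rightarrow> complex"

definition coord_vec ::
  "('m::topological_space, 'e::euclidean_space) chart set \<Rightarrow> ('m, 'e) chart \<Rightarrow> 'm \<Rightarrow> 'e \<Rightarrow> 'm tvec"
  where
  "coord_vec A c p v = (case c of (U, \<phi>) \<Rightarrow> (\<lambda>f.
     if smooth_fun A f then frechet_derivative (f \<circ> inv_into U \<phi>) (at (\<phi> p)) v else 0))"

definition tangent_space ::
  "('m::topological_space, 'e::euclidean_space) chart set \<Rightarrow> 'm \<Rightarrow> 'm tvec set" where
  "tangent_space A p = {coord_vec A c p v |c v. c \<in> A \<and> p \<in> fst c}"

definition push_forward :: "('m \<Rightarrow> 'k) \<Rightarrow> 'm tvec \<Rightarrow> 'k tvec" where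
  "push_forward F X = (\<lambda>f. X (f \<circ> F))"

type_synonym 'm metric = "'m \<Rightarrow> 'm tvec \<Rightarrow> 'm tvec \<Rightarrow> real"

text \<open>The first conjunct makes equality of metrics as functions the same as equality of metrics
  on all tangent spaces.\<close>

definition riemannian_metric ::
  "('m::topological_space, 'e::euclidean_space) chart set \<Rightarrow> 'm metric \<Rightarrow> bool" where
  "riemannian_metric A g \<longleftrightarrow>
     (\<forall>p X Y. X \<notin> tangent_space A p \<or> Y \<notin> tangent_space A p \<longrightarrow> g p X Y = 0) \<and>
     (\<forall>p. \<forall>X\<in>tangent_space A p. \<forall>Y\<in>tangent_space A p. \<forall>Z\<in>tangent_space A p. \<forall>r::real.
        g p (X + Y) Z = g p X Z + g p Y Z \<and>
        g p (\<lambda>f. of_real r * X f) Z = r * g p X Z) \<and>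
     (\<forall>p. \<forall>X\<in>tangent_space A p. \<forall>Y\<in>tangent_space A p. g p X Y = g p Y X) \<and>
     (\<forall>p. \<forall>X\<in>tangent_space A p. X \<noteq> 0 \<longrightarrow> g p X X > 0) \<and>
     (\<forall>(U,\<phi>)\<in>A. \<forall>v w. smooth_on (\<phi> ` U) (\<lambda>a. let p = inv_into U \<phi> a in
        g p (coord_vec A (U,\<phi>) p v) (coord_vec A (U,\<phi>) p w)))"

definition left_invariant ::
  "'g monoid \<Rightarrow> ('g::topological_space, 'e::euclidean_space) chart set \<Rightarrow> 'g metric \<Rightarrow> bool" where
  "left_invariant G A g \<longleftrightarrow>
     (\<forall>x p. \<forall>X\<in>tangent_space A p. \<forall>Y\<in>tangent_space A p.
        g (x \<otimes>\<^bsub>G\<^esub> p) (push_forward (\<lambda>q. x \<otimes>\<^bsub>G\<^esub> q) X) (push_forward (\<lambda>q. x \<otimes>\<^bsub>G\<^esub> q) Y) = g p X Y)"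

definition right_invariant ::
  "'g monoid \<Rightarrow> ('g::topological_space, 'e::euclidean_space) chart set \<Rightarrow> 'g metric \<Rightarrow> bool" where
  "right_invariant G A g \<longleftrightarrow>
     (\<forall>x p. \<forall>X\<in>tangent_space A p. \<forall>Y\<in>tangent_space A p.
        g (p \<otimes>\<^bsub>G\<^esub> x) (push_forward (\<lambda>q. q \<otimes>\<^bsub>G\<^esub> x) X) (push_forward (\<lambda>q. q \<otimes>\<^bsub>G\<^esub> x) Y) = g p X Y)"

definition bi_invariant ::
  "'g monoid \<Rightarrow> ('g::topological_space, 'e::euclidean_space) chart set \<Rightarrow> 'g metric \<Rightarrow> bool" where
  "bi_invariant G A g \<longleftrightarrow> left_invariant G A g \<and> right_invariant G A g"

text \<open>Riemannian volume of a compact manifold: the sum of the integrals of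
  \<open>sqrt (det (g\<^sub>i\<^sub>j))\<close> over the pieces of a finite Borel partition, each computed in a chart whose
  domain contains the closure of the piece. Such a partition exists by compactness, and the sum
  does not depend on it by the change of variables formula.\<close>

definition chart_partition ::
  "('m::topological_space, 'e) chart set \<Rightarrow> (('m, 'e) chart \<times> 'm set) set \<Rightarrow> bool" where
  "chart_partition A P \<longleftrightarrow> finite P \<and>
     (\<forall>(c,S)\<in>P. c \<in> A \<and> S \<in> sets borel \<and> closure S \<subseteq> fst c) \<and>
     (\<forall>q\<in>P. \<forall>q'\<in>P. q \<noteq> q' \<longrightarrow> snd q \<inter> snd q' = {}) \<and>
     (\<Union>q\<in>P. snd q) = UNIV"

definition volume_density ::
  "('m::topological_space, real^'n) chart set \<Rightarrow> 'm metric \<Rightarrow> ('m, real^'n) chart \<Rightarrow> 'm \<Rightarrow> real" where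
  "volume_density A g c p =
     sqrt (det (\<chi> i j. g p (coord_vec A c p (axis i 1)) (coord_vec A c p (axis j 1))))"

definition riemannian_volume ::
  "('m::topological_space, real^'n) chart set \<Rightarrow> 'm metric \<Rightarrow> ennreal" where
  "riemannian_volume A g =
     (\<Sum>((U,\<phi>),S)\<in>(SOME P. chart_partition A P).
        \<integral>\<^sup>+a\<in>\<phi> ` S. ennreal (volume_density A g (U,\<phi>) (inv_into U \<phi> a)) \<partial>lborel)"

section \<open>The right-regular representation, the Lie algebra and the Laplacian\<close>

definition right_regular :: "'g monoid \<Rightarrow> 'g \<Rightarrow> ('g \<Rightarrow> complex) \<Rightarrow> 'g \<Rightarrow> complex" where
  "right_regular G x f = (\<lambda>y. f (y \<otimes>\<^bsub>G\<^esub> x))"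

text \<open>The differential of \<open>x \<mapsto> right_regular G x f\<close> at the identity in direction \<open>X\<close>. For smooth
  \<open>f\<close> this is also the derivative of \<open>f\<close> along the left-invariant vector field with value \<open>X\<close> at
  the identity.\<close>

definition rho_diff :: "'g monoid \<Rightarrow> 'g tvec \<Rightarrow> ('g \<Rightarrow> complex) \<Rightarrow> 'g \<Rightarrow> complex" where
  "rho_diff G X f = (\<lambda>y. X (\<lambda>x. right_regular G x f y))"

definition lie_algebra ::
  "'g monoid \<Rightarrow> ('g::topological_space, 'e::euclidean_space) chart set \<Rightarrow> 'g tvec set" where
  "lie_algebra G A = tangent_space A \<one>\<^bsub>G\<^esub>"

text \<open>The value at the identity of the commutator of left-invariant vector fields.\<close>

definition lie_bracket :: "'g monoid \<Rightarrow> 'g tvec \<Rightarrow> 'g tvec \<Rightarrow> 'g tvec" where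
  "lie_bracket G X Y = (\<lambda>f. X (rho_diff G Y f) - Y (rho_diff G X f))"

definition lie_ideal ::
  "'g monoid \<Rightarrow> ('g::topological_space, 'e::euclidean_space) chart set \<Rightarrow> 'g tvec set \<Rightarrow> bool" where
  "lie_ideal G A I \<longleftrightarrow> I \<subseteq> lie_algebra G A \<and> rfun.subspace I \<and>
     (\<forall>X\<in>lie_algebra G A. \<forall>Y\<in>I. lie_bracket G X Y \<in> I)"

definition simple_lie_group ::
  "'g monoid \<Rightarrow> ('g::{t2_space,second_countable_topology}, 'e::euclidean_space) chart set \<Rightarrow> bool"
  where
  "simple_lie_group G A \<longleftrightarrow> lie_group G A \<and>
     (\<exists>X\<in>lie_algebra G A. \<exists>Y\<in>lie_algebra G A. lie_bracket G X Y \<noteq> 0) \<and>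
     (\<forall>I. lie_ideal G A I \<longrightarrow> I = {0} \<or> I = lie_algebra G A)"

definition orthonormal_basis ::
  "'g monoid \<Rightarrow> ('g::topological_space, 'e::euclidean_space) chart set \<Rightarrow> 'g metric \<Rightarrow>
   'g tvec set \<Rightarrow> bool" where
  "orthonormal_basis G A g B \<longleftrightarrow> finite B \<and> B \<subseteq> lie_algebra G A \<and> rfun.span B = lie_algebra G A \<and>
     (\<forall>X\<in>B. \<forall>Y\<in>B. g \<one>\<^bsub>G\<^esub> X Y = (if X = Y then 1 else 0))"

text \<open>The choice of the orthonormal basis does not matter.\<close>

definition laplacian ::
  "'g monoid \<Rightarrow> ('g::topological_space, 'e::euclidean_space) chart set \<Rightarrow> 'g metric \<Rightarrow>
   ('g \<Rightarrow> complex) \<Rightarrow> 'g \<Rightarrow> complex" where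
  "laplacian G A g f =
     - (\<Sum>Y\<in>(SOME B. orthonormal_basis G A g B). rho_diff G Y (rho_diff G Y f))"

section \<open>Finite dimensional invariant subspaces of the space of square-integrable functions\<close>

text \<open>The Haar probability measure, which on a compact group is invariant on both sides.\<close>

definition haar_measure :: "'g monoid \<Rightarrow> 'g::topological_space measure \<Rightarrow> bool" where
  "haar_measure G \<mu> \<longleftrightarrow> sets \<mu> = sets borel \<and> emeasure \<mu> UNIV = 1 \<and>
     (\<forall>x. distr \<mu> borel (\<lambda>y. x \<otimes>\<^bsub>G\<^esub> y) = \<mu>) \<and> (\<forall>x. distr \<mu> borel (\<lambda>y. y \<otimes>\<^bsub>G\<^esub> x) = \<mu>)"

text \<open>A subspace of \<open>L\<^sup>2\<close> is represented by the set of all functions whose classes belong to it: it is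
  closed under almost everywhere equality and in particular contains all null functions.\<close>

definition L2_subspace :: "'g measure \<Rightarrow> ('g \<Rightarrow> complex) set \<Rightarrow> bool" where
  "L2_subspace \<mu> V \<longleftrightarrow> cfun.subspace V \<and>
     (\<forall>f\<in>V. f \<in> borel_measurable \<mu> \<and> integrable \<mu> (\<lambda>x. (cmod (f x))\<^sup>2)) \<and>
     (\<forall>f\<in>V. \<forall>h\<in>borel_measurable \<mu>. (AE x in \<mu>. h x = f x) \<longrightarrow> h \<in> V)"

definition L2_finite_dim :: "'g measure \<Rightarrow> ('g \<Rightarrow> complex) set \<Rightarrow> bool" where
  "L2_finite_dim \<mu> V \<longleftrightarrow>
     (\<exists>B. finite B \<and> B \<subseteq> V \<and> (\<forall>f\<in>V. \<exists>h\<in>cfun.span B. AE x in \<mu>. f x = h x))"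

definition rho_invariant :: "'g monoid \<Rightarrow> ('g \<Rightarrow> complex) set \<Rightarrow> bool" where
  "rho_invariant G V \<longleftrightarrow> (\<forall>x. \<forall>f\<in>V. right_regular G x f \<in> V)"

definition acts_nontrivially :: "'g monoid \<Rightarrow> 'g measure \<Rightarrow> ('g \<Rightarrow> complex) set \<Rightarrow> bool" where
  "acts_nontrivially G \<mu> V \<longleftrightarrow> (\<exists>x. \<exists>f\<in>V. \<not> (AE y in \<mu>. right_regular G x f y = f y))"

text \<open>Trace of the restriction of the Laplacian to \<open>V\<close>. If \<open>V\<close> represents a finite dimensional
  invariant subspace of \<open>L\<^sup>2\<close>, every class in it has exactly one smooth representative, so the smooth
  members of \<open>V\<close> form a model of that subspace on which the Laplacian acts.\<close>

definition laplacian_trace ::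
  "'g monoid \<Rightarrow> ('g::topological_space, 'e::euclidean_space) chart set \<Rightarrow> 'g metric \<Rightarrow>
   ('g \<Rightarrow> complex) set \<Rightarrow> complex" where
  "laplacian_trace G A g V = trace_on {f\<in>V. smooth_fun A f} (laplacian G A g)"

end

theory Submission
  imports Defs
begin

text \<open>
  Let \<open>W\<close> be the space of smooth members of an invariant subspace \<open>V\<close>. The form
  \<open>(X, Y) \<mapsto> Tr (\<rho>\<^sub>* X \<circ> \<rho>\<^sub>* Y)\<close> on the Lie algebra, taken over \<open>W\<close>, is symmetric and invariant under the
  adjoint action. On a simple Lie algebra every such form is a multiple of the inner product that the
  bi-invariant metric \<open>g0\<close> defines at the identity (\<open>invariant_form_unique\<close>), because the eigenspaces of
  one invariant form relative to another are ideals. If \<open>c\<close> is the factor and \<open>n\<close> the dimension, then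
  \<open>Tr \<Delta>\<^sub>g = - c (\<Sum>\<^sub>j g0 (Y\<^sub>j, Y\<^sub>j))\<close> for a \<open>g\<close>-orthonormal basis \<open>Y\<^sub>j\<close>, whereas \<open>Tr \<Delta>\<^sub>0 = - c n\<close>. So the
  quotient of the traces is \<open>C = (1/n) (\<Sum>\<^sub>j g0 (Y\<^sub>j, Y\<^sub>j))\<close>; only \<open>c\<close> depends on \<open>V\<close>.

  The densities of two left-invariant metrics have a constant quotient (\<open>volume_density_ratio\<close>), and the
  volume is positive and finite. Therefore the hypothesis on the volumes says that the determinant of
  \<open>g0\<close> in a \<open>g\<close>-orthonormal basis is at least \<open>1\<close>. By the inequality between the arithmetic and the
  geometric mean of its eigenvalues, the trace of \<open>g0\<close> in such a basis is at least \<open>n\<close>, with equality only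
  if \<open>g\<close> and \<open>g0\<close> agree at the identity and hence everywhere (\<open>relative_trace_ge\<close>).

  Three points connect this argument with manifolds and function spaces. Ideals are defined by the
  bracket, whereas the forms are invariant under the adjoint action of the group; the two are linked by
  \<open>lie_bracket_eq_Ad_derivative\<close>, which rests on the symmetry of second derivatives. Tangent vectors are
  functionals on globally defined smooth functions, so bump functions are used to show that the
  coordinate vectors of a chart are linearly independent (\<open>linear_functional_realised\<close>). Finally, \<open>W\<close> is
  finite dimensional because a smooth function that vanishes almost everywhere is zero
  (\<open>finite_dim_smooth_part\<close>), and it is mapped into itself by the operators \<open>\<rho>\<^sub>* X\<close> because finitely many
  point evaluations separate it from any function outside (\<open>rho_diff_invariant\<close>).
\<close>

section \<open>Calculus of continuously differentiable functions\<close>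

lemma Ck_on_cong:
  assumes "open S" "\<And>x. x \<in> S \<Longrightarrow> f x = g x"
  shows "Ck_on k S f \<longleftrightarrow> Ck_on k S g"
  using assms(2)
proof (induction k arbitrary: f g)
  case 0
  then show ?case by (simp cong: continuous_on_cong)
next
  case (Suc k)
  have diff: "f differentiable at x \<longleftrightarrow> g differentiable at x" if "x \<in> S" for x
    using that Suc.prems assms(1)
      has_derivative_transform_within_open[of f _ x UNIV S g]
      has_derivative_transform_within_open[of g _ x UNIV S f]
    unfolding differentiable_def by (metis)
  show ?case
  proof (cases "\<forall>x\<in>S. f differentiable at x")
    case True
    have "frechet_derivative f (at x) v = frechet_derivative g (at x) v" if "x \<in> S" for x v
      using frechet_derivative_transform_within_open[of f x S g] True that assms(1) Suc.prems by simp
    then have "Ck_on k S (\<lambda>x. frechet_derivative f (at x) v) \<longleftrightarrow>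
               Ck_on k S (\<lambda>x. frechet_derivative g (at x) v)" for v
      by (intro Suc.IH) auto
    then show ?thesis using True diff by simp
  next
    case False
    then show ?thesis using diff by (metis Ck_on.simps(2))
  qed
qed

lemma Ck_on_SucD: "Ck_on (Suc k) S f \<Longrightarrow> Ck_on k S f"
proof (induction k arbitrary: f)
  case 0
  then show ?case
    by (auto intro!: continuous_at_imp_continuous_on differentiable_imp_continuous_within)
next
  case (Suc k)
  then show ?case by (metis Ck_on.simps(2))
qed

text \<open>Derivatives computed by the differentiation rules rarely have the syntactic form of
  \<^const>\<open>frechet_derivative\<close>; this rule lets the inductions on \<open>k\<close> for sums, products and compositions
  use them all the same.\<close>

lemma Ck_on_SucI:
  assumes "open S" "\<And>x. x \<in> S \<Longrightarrow> (f has_derivative f' x) (at x)"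
    "\<And>v. Ck_on k S (\<lambda>x. f' x v)"
  shows "Ck_on (Suc k) S f"
proof -
  have "Ck_on k S (\<lambda>x. frechet_derivative f (at x) v)" for v
    using Ck_on_cong[OF assms(1), of "\<lambda>x. frechet_derivative f (at x) v" "\<lambda>x. f' x v" k]
      assms(2,3) frechet_derivative_at by metis
  then show ?thesis using assms(2) by (auto simp: differentiable_def)
qed

lemma Ck_on_SucE:
  assumes "Ck_on (Suc k) S f" "x \<in> S"
  shows "(f has_derivative frechet_derivative f (at x)) (at x)"
  using assms frechet_derivative_works by auto

lemma Ck_on_subset: "Ck_on k S f \<Longrightarrow> T \<subseteq> S \<Longrightarrow> Ck_on k T f"
  by (induction k arbitrary: f) (auto intro: continuous_on_subset)

lemma Ck_on_local:
  assumes "\<And>x. x \<in> S \<Longrightarrow> \<exists>T. open T \<and> x \<in> T \<and> Ck_on k T f"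
  shows "Ck_on k S f"
  using assms
proof (induction k arbitrary: f)
  case 0
  have "continuous (at x) f" if x: "x \<in> S" for x
    using 0[OF x] by (auto simp: continuous_on_eq_continuous_at)
  then show ?case by (simp add: continuous_at_imp_continuous_on)
next
  case (Suc k)
  have "f differentiable at x" if "x \<in> S" for x
    using Suc.prems[OF that] by auto
  moreover have "Ck_on k S (\<lambda>x. frechet_derivative f (at x) v)" for v
    by (rule Suc.IH) (use Suc.prems in fastforce)
  ultimately show ?case by simp
qed

lemma Ck_on_const: "Ck_on k S (\<lambda>x. c)"
  by (induction k arbitrary: c) auto

lemma Ck_on_linear:
  assumes "bounded_linear L" "open S"
  shows "Ck_on k S L"
proof (cases k)
  case 0
  then show ?thesis using assms by (simp add: linear_continuous_on)
next
  case (Suc m)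
  show ?thesis unfolding Suc
    by (rule Ck_on_SucI[where f' = "\<lambda>x. L"])
       (use assms in \<open>auto intro: bounded_linear_imp_has_derivative Ck_on_const\<close>)
qed

lemma Ck_on_linear_compose:
  assumes "bounded_linear L" "open S" "Ck_on k S f"
  shows "Ck_on k S (\<lambda>x. L (f x))"
  using assms(3)
proof (induction k arbitrary: f)
  case 0
  then show ?case using assms(1)
    by (simp add: linear_continuous_on_compose bounded_linear.linear bounded_linear.continuous_on)
next
  case (Suc k)
  show ?case
    by (rule Ck_on_SucI[where f' = "\<lambda>x v. L (frechet_derivative f (at x) v)"])
       (use assms Suc Ck_on_SucE[OF Suc.prems] in
         \<open>auto intro: bounded_linear.has_derivative[OF assms(1)]\<close>)
qed

lemma Ck_on_add:
  assumes "open S" "Ck_on k S f" "Ck_on k S g"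
  shows "Ck_on k S (\<lambda>x. f x + g x)"
  using assms(2,3)
proof (induction k arbitrary: f g)
  case 0
  then show ?case by (simp add: continuous_on_add)
next
  case (Suc k)
  show ?case
    by (rule Ck_on_SucI[where f' = "\<lambda>x v. frechet_derivative f (at x) v + frechet_derivative g (at x) v"])
       (use assms Suc Ck_on_SucE[OF Suc.prems(1)] Ck_on_SucE[OF Suc.prems(2)] in
         \<open>auto intro: has_derivative_add\<close>)
qed

lemma Ck_on_sum:
  assumes "open S" "\<And>i. i \<in> I \<Longrightarrow> Ck_on k S (f i)"
  shows "Ck_on k S (\<lambda>x. \<Sum>i\<in>I. f i x)"
  using assms(2) by (induction I rule: infinite_finite_induct) (auto intro: Ck_on_const Ck_on_add[OF assms(1)])

lemma Ck_on_bilinear: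
  assumes "bounded_bilinear m" "open S" "Ck_on k S f" "Ck_on k S g"
  shows "Ck_on k S (\<lambda>x. m (f x) (g x))"
  using assms(3,4)
proof (induction k arbitrary: f g)
  case 0
  then show ?case using assms(1) by (simp add: bounded_bilinear.continuous_on)
next
  case (Suc k)
  show ?case
    by (rule Ck_on_SucI[where f' = "\<lambda>x v. m (f x) (frechet_derivative g (at x) v)
              + m (frechet_derivative f (at x) v) (g x)"])
       (use assms Suc Ck_on_SucE[OF Suc.prems(1)] Ck_on_SucE[OF Suc.prems(2)]
          Ck_on_SucD[OF Suc.prems(1)] Ck_on_SucD[OF Suc.prems(2)] in
         \<open>auto intro!: bounded_bilinear.FDERIV Ck_on_add\<close>)
qed

text \<open>Expanding the inner derivative in a basis turns the chain rule into a finite sum of products of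
  functions that are \<open>k\<close> times differentiable, so that the induction on \<open>k\<close>
  only needs sums and products.\<close>

lemma Ck_on_compose:
  fixes f :: "'a::euclidean_space \<Rightarrow> 'b::euclidean_space" and g :: "'b \<Rightarrow> 'c::real_normed_vector"
  assumes "open S" "open T" "Ck_on k S f" "Ck_on k T g" "\<And>x. x \<in> S \<Longrightarrow> f x \<in> T"
  shows "Ck_on k S (\<lambda>x. g (f x))"
  using assms(3,4)
proof (induction k arbitrary: g)
  case 0
  then show ?case
    using continuous_on_compose2[of T g S f] assms(5) by (auto simp: image_subset_iff)
next
  case (Suc k)
  let ?g = "\<lambda>x. frechet_derivative g (at x)" and ?f = "\<lambda>x. frechet_derivative f (at x)"
  have der: "((\<lambda>x. g (f x)) has_derivative (\<lambda>v. ?g (f x) (?f x v))) (at x)" if "x \<in> S" for x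
    using diff_chain_at[OF Ck_on_SucE[OF Suc.prems(1) that] Ck_on_SucE[OF Suc.prems(2) assms(5)[OF that]]]
    by (simp add: o_def)
  have eq: "?g (f x) (?f x v) = (\<Sum>b\<in>Basis. (?f x v \<bullet> b) *\<^sub>R ?g (f x) b)" if "x \<in> S" for x v
  proof -
    interpret linear "?g (f x)"
      using Suc.prems(2) assms(5)[OF that] by (auto intro: linear_frechet_derivative)
    show ?thesis by (subst euclidean_representation[of "?f x v", symmetric]) (simp add: sum scaleR)
  qed
  have "Ck_on k S (\<lambda>x. \<Sum>b\<in>Basis. (?f x v \<bullet> b) *\<^sub>R ?g (f x) b)" for v
  proof (intro Ck_on_sum Ck_on_bilinear[OF bounded_bilinear_scaleR] assms(1))
    fix b :: 'b assume "b \<in> Basis"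
    show "Ck_on k S (\<lambda>x. ?f x v \<bullet> b)"
      using Suc.prems(1) by (intro Ck_on_linear_compose[OF bounded_linear_inner_left] assms(1)) simp
    show "Ck_on k S (\<lambda>x. ?g (f x) b)"
      using Suc.prems Ck_on_SucD by (intro Suc.IH) auto
  qed
  then have "Ck_on k S (\<lambda>x. ?g (f x) (?f x v))" for v
    using Ck_on_cong[OF assms(1), of "\<lambda>x. ?g (f x) (?f x v)"] eq by (metis (no_types, lifting))
  then show ?case by (intro Ck_on_SucI[OF assms(1) der])
qed

lemma smooth_on_cong:
  "open S \<Longrightarrow> (\<And>x. x \<in> S \<Longrightarrow> f x = g x) \<Longrightarrow> smooth_on S f \<longleftrightarrow> smooth_on S g"
  unfolding smooth_on_def using Ck_on_cong by blast

lemma smooth_on_subset: "smooth_on S f \<Longrightarrow> T \<subseteq> S \<Longrightarrow> smooth_on T f"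
  unfolding smooth_on_def using Ck_on_subset by blast

lemma smooth_on_local:
  assumes "\<And>x. x \<in> S \<Longrightarrow> \<exists>T. open T \<and> x \<in> T \<and> smooth_on T f"
  shows "smooth_on S f"
  unfolding smooth_on_def using assms by (meson Ck_on_local smooth_on_def)

lemma smooth_on_const: "smooth_on S (\<lambda>x. c)"
  by (simp add: smooth_on_def Ck_on_const)

lemma smooth_on_linear: "bounded_linear L \<Longrightarrow> open S \<Longrightarrow> smooth_on S L"
  by (simp add: smooth_on_def Ck_on_linear)

lemma smooth_on_linear_compose:
  "bounded_linear L \<Longrightarrow> open S \<Longrightarrow> smooth_on S f \<Longrightarrow> smooth_on S (\<lambda>x. L (f x))"
  by (simp add: smooth_on_def Ck_on_linear_compose)

lemma smooth_on_add:
  "open S \<Longrightarrow> smooth_on S f \<Longrightarrow> smooth_on S g \<Longrightarrow> smooth_on S (\<lambda>x. f x + g x)"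
  by (simp add: smooth_on_def Ck_on_add)

lemma smooth_on_bilinear:
  "bounded_bilinear m \<Longrightarrow> open S \<Longrightarrow> smooth_on S f \<Longrightarrow> smooth_on S g \<Longrightarrow>
    smooth_on S (\<lambda>x. m (f x) (g x))"
  by (simp add: smooth_on_def Ck_on_bilinear)

lemma smooth_on_compose:
  fixes f :: "'a::euclidean_space \<Rightarrow> 'b::euclidean_space" and g :: "'b \<Rightarrow> 'c::real_normed_vector"
  shows "open S \<Longrightarrow> open T \<Longrightarrow> smooth_on S f \<Longrightarrow> smooth_on T g \<Longrightarrow> (\<And>x. x \<in> S \<Longrightarrow> f x \<in> T) \<Longrightarrow>
    smooth_on S (\<lambda>x. g (f x))"
  unfolding smooth_on_def using Ck_on_compose by blast

lemma smooth_on_Pair: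
  assumes "open S" "smooth_on S f" "smooth_on S g"
  shows "smooth_on S (\<lambda>x. (f x, g x))"
proof -
  have "smooth_on S (\<lambda>x. (f x, 0) + (0, g x))"
    using assms bounded_linear_Pair[OF bounded_linear_ident bounded_linear_zero]
      bounded_linear_Pair[OF bounded_linear_zero bounded_linear_ident]
    by (intro smooth_on_add smooth_on_linear_compose[where L = "\<lambda>y. (y, 0)"]
        smooth_on_linear_compose[where L = "\<lambda>y. (0, y)"]) auto
  then show ?thesis by simp
qed

lemma smooth_on_frechet_derivative:
  "smooth_on S f \<Longrightarrow> smooth_on S (\<lambda>x. frechet_derivative f (at x) v)"
  unfolding smooth_on_def by (metis Ck_on.simps(2))

lemma smooth_on_has_derivative:
  "smooth_on S f \<Longrightarrow> x \<in> S \<Longrightarrow> (f has_derivative frechet_derivative f (at x)) (at x)"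
  using Ck_on_SucE[of 0] by (metis smooth_on_def)

lemma smooth_on_imp_continuous_on: "smooth_on S f \<Longrightarrow> continuous_on S f"
  unfolding smooth_on_def by (metis Ck_on.simps(1))

section \<open>Symmetry of second derivatives\<close>

text \<open>For real-valued functions the second difference
  \<open>f (x + s v + s w) - f (x + s v) - f (x + s w) + f x\<close> is symmetric in \<open>v\<close> and \<open>w\<close>; two applications of
  the mean value theorem express it as \<open>s\<^sup>2\<close> times a value of the second derivative near \<open>x\<close>.\<close>

lemma second_difference_mean_value:
  fixes f :: "'a::euclidean_space \<Rightarrow> real"
  assumes ball: "ball x r \<subseteq> S" and C2: "Ck_on 2 S f" and s: "0 < s" "s * (norm v + norm w) < r"
  shows "\<exists>y. norm (y - x) \<le> s * (norm v + norm w) \<and>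
    f (x + s *\<^sub>R v + s *\<^sub>R w) - f (x + s *\<^sub>R v) - f (x + s *\<^sub>R w) + f x =
      s\<^sup>2 * frechet_derivative (\<lambda>z. frechet_derivative f (at z) v) (at y) w"
proof -
  let ?D = "\<lambda>v z. frechet_derivative f (at z) v"
  let ?D2 = "\<lambda>z. frechet_derivative (?D v) (at z)"
  have d1: "(f has_derivative (\<lambda>u. ?D u z)) (at z)" if "z \<in> S" for z
    using C2 that Ck_on_SucE[of 1 S f z] by (simp add: numeral_2_eq_2)
  have d2: "(?D v has_derivative ?D2 z) (at z)" if "z \<in> S" for z
    using C2 that Ck_on_SucE[of 0 S "?D v" z] by (simp add: numeral_2_eq_2)
  have inS: "x + a *\<^sub>R v + b *\<^sub>R w \<in> S" if "0 \<le> a" "a \<le> s" "0 \<le> b" "b \<le> s" for a b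
  proof -
    have "norm (a *\<^sub>R v + b *\<^sub>R w) \<le> a * norm v + b * norm w"
      using norm_triangle_ineq[of "a *\<^sub>R v" "b *\<^sub>R w"] that by simp
    also have "\<dots> \<le> s * (norm v + norm w)"
      using that by (simp add: distrib_left add_mono mult_right_mono)
    finally have "norm (a *\<^sub>R v + b *\<^sub>R w) < r" using s by simp
    moreover have "dist x (x + a *\<^sub>R v + b *\<^sub>R w) = norm (a *\<^sub>R v + b *\<^sub>R w)"
      by (metis add.assoc add_diff_cancel_left' dist_commute dist_norm)
    ultimately have "dist x (x + a *\<^sub>R v + b *\<^sub>R w) < r" by simp
    then show ?thesis using ball by auto
  qed
  let ?p = "\<lambda>a. f (x + a *\<^sub>R v + s *\<^sub>R w) - f (x + a *\<^sub>R v)"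
  let ?p' = "\<lambda>a. ?D v (x + a *\<^sub>R v + s *\<^sub>R w) - ?D v (x + a *\<^sub>R v)"
  have dp: "(?p has_real_derivative ?p' a) (at a)" if "0 \<le> a" "a \<le> s" for a
  proof -
    have 1: "((\<lambda>a. x + a *\<^sub>R v + b *\<^sub>R w) has_derivative (\<lambda>h. h *\<^sub>R v)) (at a)" for b
      by (auto intro!: derivative_eq_intros)
    have 2: "((\<lambda>a. f (x + a *\<^sub>R v + b *\<^sub>R w)) has_derivative (\<lambda>h. ?D (h *\<^sub>R v) (x + a *\<^sub>R v + b *\<^sub>R w))) (at a)"
      if "0 \<le> b" "b \<le> s" for b
      using diff_chain_at[OF 1 d1[OF inS]] \<open>0 \<le> a\<close> \<open>a \<le> s\<close> that by (auto simp: o_def)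
    have 3: "?D (h *\<^sub>R v) z = h * ?D v z" if "z \<in> S" for h z
      using has_derivative_bounded_linear[OF d1[OF that]]
      by (simp add: linear_simps)
    have 4: "((\<lambda>a. f (x + a *\<^sub>R v + b *\<^sub>R w)) has_real_derivative ?D v (x + a *\<^sub>R v + b *\<^sub>R w)) (at a)"
      if "0 \<le> b" "b \<le> s" for b
      using 2[OF that] 3[OF inS, of a b] \<open>0 \<le> a\<close> \<open>a \<le> s\<close> that
      unfolding has_field_derivative_def by (simp add: mult_commute_abs)
    show ?thesis
      using DERIV_diff[OF 4[of s] 4[of 0]] s by simp
  qed
  obtain a where a: "0 < a" "a < s" "?p s - ?p 0 = (s - 0) * ?p' a"
    using MVT2[OF s(1), of ?p ?p'] dp by auto
  let ?q = "\<lambda>b. ?D v (x + a *\<^sub>R v + b *\<^sub>R w)"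
  have dq: "(?q has_real_derivative ?D2 (x + a *\<^sub>R v + b *\<^sub>R w) w) (at b)" if "0 \<le> b" "b \<le> s" for b
  proof -
    let ?z = "x + a *\<^sub>R v + b *\<^sub>R w"
    have z: "?z \<in> S" using inS a that by simp
    have 1: "((\<lambda>b. x + a *\<^sub>R v + b *\<^sub>R w) has_derivative (\<lambda>h. h *\<^sub>R w)) (at b)"
      by (auto intro!: derivative_eq_intros)
    have "(?q has_derivative (\<lambda>h. ?D2 ?z (h *\<^sub>R w))) (at b)"
      using diff_chain_at[OF 1 d2[OF z]] by (simp add: o_def)
    moreover have "?D2 ?z (h *\<^sub>R w) = h * ?D2 ?z w" for h
      using has_derivative_bounded_linear[OF d2[OF z]] by (simp add: linear_simps)
    ultimately show ?thesis
      unfolding has_field_derivative_def by (simp add: mult_commute_abs)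
  qed
  obtain b where b: "0 < b" "b < s" "?q s - ?q 0 = (s - 0) * ?D2 (x + a *\<^sub>R v + b *\<^sub>R w) w"
    using MVT2[OF s(1), of ?q "\<lambda>b. ?D2 (x + a *\<^sub>R v + b *\<^sub>R w) w"] dq by auto
  have "norm (a *\<^sub>R v + b *\<^sub>R w) \<le> a * norm v + b * norm w"
    using norm_triangle_ineq[of "a *\<^sub>R v" "b *\<^sub>R w"] a b by simp
  also have "\<dots> \<le> s * (norm v + norm w)"
    using a b by (simp add: distrib_left add_mono mult_right_mono)
  finally show ?thesis
    using a b by (intro exI[of _ "x + a *\<^sub>R v + b *\<^sub>R w"]) (auto simp: power2_eq_square algebra_simps)
qed

text \<open>As \<open>s\<close> tends to zero, the symmetric second difference divided by
  \<open>s\<^sup>2\<close> tends to both second derivatives, by their continuity.\<close>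

lemma frechet_derivative_commute_real:
  fixes f :: "'a::euclidean_space \<Rightarrow> real"
  assumes "open S" "Ck_on 2 S f" "x \<in> S"
  shows "frechet_derivative (\<lambda>z. frechet_derivative f (at z) v) (at x) w =
         frechet_derivative (\<lambda>z. frechet_derivative f (at z) w) (at x) v"
proof -
  let ?H = "\<lambda>v w y. frechet_derivative (\<lambda>z. frechet_derivative f (at z) v) (at y) w"
  let ?N = "norm v + norm w"
  obtain r where r: "r > 0" "ball x r \<subseteq> S" using assms openE by blast
  \<comment> \<open>Step sizes tending to zero, all of them small enough for the ball of radius \<open>r\<close>.\<close>
  define s where "s n = r / (?N + 1) * inverse (real (Suc n))" for n :: nat
  have N: "?N + 1 > 0" by (simp add: add_nonneg_pos)
  have s0: "s n > 0" for n using r N by (simp add: s_def)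
  have sr: "s n * ?N < r" for n
  proof -
    have "s n * (?N + 1) = r * inverse (real (Suc n))" using N by (simp add: s_def)
    also have "\<dots> \<le> r * 1" using r by (intro mult_left_mono) (simp_all add: field_simps)
    finally show ?thesis using s0[of n] by (simp add: algebra_simps)
  qed
  have slim: "s \<longlonglongrightarrow> 0"
    unfolding s_def by (rule tendsto_mult_right_zero[OF LIMSEQ_inverse_real_of_nat])
  have "\<exists>y. norm (y - x) \<le> s n * ?N \<and>
      f (x + s n *\<^sub>R v + s n *\<^sub>R w) - f (x + s n *\<^sub>R v) - f (x + s n *\<^sub>R w) + f x = (s n)\<^sup>2 * ?H v w y" for n
    by (rule second_difference_mean_value[OF r(2) assms(2) s0 sr])
  then obtain y where y: "\<And>n. norm (y n - x) \<le> s n * ?N"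
    "\<And>n. f (x + s n *\<^sub>R v + s n *\<^sub>R w) - f (x + s n *\<^sub>R v) - f (x + s n *\<^sub>R w) + f x = (s n)\<^sup>2 * ?H v w (y n)"
    by metis
  have "\<exists>y. norm (y - x) \<le> s n * (norm w + norm v) \<and>
      f (x + s n *\<^sub>R w + s n *\<^sub>R v) - f (x + s n *\<^sub>R w) - f (x + s n *\<^sub>R v) + f x = (s n)\<^sup>2 * ?H w v y" for n
    by (rule second_difference_mean_value[OF r(2) assms(2) s0]) (metis sr add.commute)
  then obtain y' where y': "\<And>n. norm (y' n - x) \<le> s n * ?N"
    "\<And>n. f (x + s n *\<^sub>R w + s n *\<^sub>R v) - f (x + s n *\<^sub>R w) - f (x + s n *\<^sub>R v) + f x = (s n)\<^sup>2 * ?H w v (y' n)"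
    by (metis add.commute)
  have eq: "?H v w (y n) = ?H w v (y' n)" for n
  proof -
    have "(s n)\<^sup>2 * ?H v w (y n) = (s n)\<^sup>2 * ?H w v (y' n)"
      using y(2)[of n] y'(2)[of n] by (simp add: algebra_simps)
    then show ?thesis using s0[of n] by simp
  qed
  have conv: "(\<lambda>n. ?H a b (u n)) \<longlonglongrightarrow> ?H a b x" if u: "\<And>n. norm (u n - x) \<le> s n * ?N" for u a b
  proof -
    have "(\<lambda>n. u n - x) \<longlonglongrightarrow> 0"
      by (rule tendsto_norm_zero_cancel, rule tendsto_sandwich[where f = "\<lambda>_. 0" and h = "\<lambda>n. s n * ?N"])
         (use u tendsto_mult_left_zero[OF slim] in auto)
    then have "u \<longlonglongrightarrow> x" by (simp add: LIM_zero_iff)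
    moreover have "continuous_on S (?H a b)" using assms(2) by (simp add: numeral_2_eq_2)
    then have "isCont (?H a b) x" using assms by (simp add: continuous_on_eq_continuous_at)
    ultimately show ?thesis by (rule isCont_tendsto_compose[rotated])
  qed
  have "(\<lambda>n. ?H v w (y n)) \<longlonglongrightarrow> ?H v w x" "(\<lambda>n. ?H v w (y n)) \<longlonglongrightarrow> ?H w v x"
    using conv[of y v w] conv[of y' w v] y(1) y'(1) by (simp_all add: eq)
  then show ?thesis by (rule LIMSEQ_unique)
qed

lemma frechet_derivative_linear_compose:
  assumes "bounded_linear L" "f differentiable at x"
  shows "frechet_derivative (\<lambda>z. L (f z)) (at x) v = L (frechet_derivative f (at x) v)"
  using frechet_derivative_at[OF bounded_linear.has_derivative[OF assms(1)
      frechet_derivative_works[THEN iffD1, OF assms(2)]]] by metis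

lemma frechet_derivative_commute:
  fixes f :: "'a::euclidean_space \<Rightarrow> complex"
  assumes "open S" "smooth_on S f" "x \<in> S"
  shows "frechet_derivative (\<lambda>z. frechet_derivative f (at z) v) (at x) w =
         frechet_derivative (\<lambda>z. frechet_derivative f (at z) w) (at x) v"
proof -
  have diff: "f differentiable at z" "(\<lambda>z. frechet_derivative f (at z) u) differentiable at z"
    if "z \<in> S" for z u
    using smooth_on_has_derivative[OF assms(2) that]
      smooth_on_has_derivative[OF smooth_on_frechet_derivative[OF assms(2)] that]
    by (auto simp: differentiable_def)
  have *: "L (frechet_derivative (\<lambda>z. frechet_derivative f (at z) v) (at x) w) =
           L (frechet_derivative (\<lambda>z. frechet_derivative f (at z) w) (at x) v)"
    if L: "bounded_linear L" for L :: "complex \<Rightarrow> real"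
  proof -
    have "L (frechet_derivative (\<lambda>z. frechet_derivative f (at z) a) (at x) b) =
          frechet_derivative (\<lambda>z. frechet_derivative (\<lambda>y. L (f y)) (at z) a) (at x) b" for a b
    proof -
      have "L (frechet_derivative (\<lambda>z. frechet_derivative f (at z) a) (at x) b) =
        frechet_derivative (\<lambda>z. L (frechet_derivative f (at z) a)) (at x) b"
        using frechet_derivative_linear_compose[OF L diff(2)[OF assms(3)]] by simp
      also have "\<dots> = frechet_derivative (\<lambda>z. frechet_derivative (\<lambda>y. L (f y)) (at z) a) (at x) b"
      proof (rule fun_cong[OF frechet_derivative_transform_within_open[OF _ assms(1,3)]])
        show "(\<lambda>z. L (frechet_derivative f (at z) a)) differentiable at x"
          using bounded_linear.has_derivative[OF L] diff(2)[OF assms(3), of a]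
          unfolding differentiable_def by blast
        show "L (frechet_derivative f (at z) a) = frechet_derivative (\<lambda>y. L (f y)) (at z) a" if "z \<in> S" for z
          using frechet_derivative_linear_compose[OF L diff(1)[OF that]] by simp
      qed
      finally show ?thesis .
    qed
    moreover have "Ck_on 2 S (\<lambda>y. L (f y))"
      using assms L smooth_on_linear_compose[of L S f] by (simp add: smooth_on_def)
    ultimately show ?thesis
      using frechet_derivative_commute_real[OF assms(1) _ assms(3)] by metis
  qed
  show ?thesis using *[OF bounded_linear_Re] *[OF bounded_linear_Im] by (simp add: complex_eq_iff)
qed

section \<open>Smooth maps between manifolds\<close>

lemma
  assumes "smooth_atlas A" "(U, \<phi>) \<in> A"
  shows chart_open: "open U"
    and chart_inj: "inj_on \<phi> U"
    and chart_continuous: "continuous_on U \<phi>"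
    and chart_inv_continuous: "continuous_on (\<phi> ` U) (inv_into U \<phi>)"
    and chart_range_open: "open (\<phi> ` U)"
proof -
  have *: "open U" "open (\<phi> ` U)" "homeomorphism U (\<phi> ` U) \<phi> (inv_into U \<phi>)"
    using assms unfolding smooth_atlas_def by auto
  then show "open U" "open (\<phi> ` U)" by auto
  show "inj_on \<phi> U" "continuous_on U \<phi>" "continuous_on (\<phi> ` U) (inv_into U \<phi>)"
    using *(3) unfolding homeomorphism_def by (auto intro: inj_on_inverseI)
qed

lemma chart_inv [simp]:
  "smooth_atlas A \<Longrightarrow> (U, \<phi>) \<in> A \<Longrightarrow> p \<in> U \<Longrightarrow> inv_into U \<phi> (\<phi> p) = p"
  using chart_inj by (metis inv_into_f_f)

lemma chart_image_eq:
  assumes "smooth_atlas A" "(U, \<phi>) \<in> A" "W \<subseteq> U"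
  shows "\<phi> ` W = \<phi> ` U \<inter> inv_into U \<phi> -` W"
  using assms by force

lemma chart_image_open:
  assumes "smooth_atlas A" "(U, \<phi>) \<in> A" "open W" "W \<subseteq> U"
  shows "open (\<phi> ` W)"
  unfolding chart_image_eq[OF assms(1,2,4)]
  by (rule continuous_open_preimage[OF chart_inv_continuous[OF assms(1,2)] chart_range_open[OF assms(1,2)] assms(3)])

lemma chart_exists:
  assumes "smooth_atlas A"
  obtains U \<phi> where "(U, \<phi>) \<in> A" "p \<in> U"
proof -
  have "p \<in> (\<Union>(U,\<phi>)\<in>A. U)" using assms unfolding smooth_atlas_def by auto
  then show ?thesis using that by auto
qed

lemma chart_transition:
  "smooth_atlas A \<Longrightarrow> (U, \<phi>) \<in> A \<Longrightarrow> (V, \<psi>) \<in> A \<Longrightarrow> smooth_on (\<phi> ` (U \<inter> V)) (\<psi> \<circ> inv_into U \<phi>)"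
  unfolding smooth_atlas_def by fast

lemma smooth_mapD:
  "smooth_map A B F \<Longrightarrow> (U, \<phi>) \<in> A \<Longrightarrow> (V, \<psi>) \<in> B \<Longrightarrow>
    smooth_on (\<phi> ` (U \<inter> F -` V)) (\<lambda>a. \<psi> (F (inv_into U \<phi> a)))"
  unfolding smooth_map_def by (fastforce simp: o_def)

lemma smooth_map_continuous: "smooth_map A B F \<Longrightarrow> continuous_on UNIV F"
  by (simp add: smooth_map_def)

lemma smooth_mapI:
  "continuous_on UNIV F \<Longrightarrow>
   (\<And>U \<phi> V \<psi>. (U, \<phi>) \<in> A \<Longrightarrow> (V, \<psi>) \<in> B \<Longrightarrow> smooth_on (\<phi> ` (U \<inter> F -` V)) (\<lambda>a. \<psi> (F (inv_into U \<phi> a)))) \<Longrightarrow>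
   smooth_map A B F"
  unfolding smooth_map_def by (auto simp: o_def)

text \<open>Near a point \<open>p\<close> the composition is factored through a chart of the middle manifold
  around \<open>F p\<close>; its domain need not contain the image of the whole chart around
  \<open>p\<close>, hence the restriction to \<open>Q\<close>.\<close>

lemma smooth_map_compose:
  assumes A: "smooth_atlas A" and B: "smooth_atlas B" and C: "smooth_atlas C"
    and F: "smooth_map A B F" and H: "smooth_map B C H"
  shows "smooth_map A C (\<lambda>x. H (F x))"
proof (rule smooth_mapI)
  show cont: "continuous_on UNIV (\<lambda>x. H (F x))"
    using smooth_map_continuous[OF F] smooth_map_continuous[OF H]
    by (metis continuous_on_compose2 subset_UNIV)
  fix U \<phi> W \<xi> assume c: "(U, \<phi>) \<in> A" "(W, \<xi>) \<in> C"
  show "smooth_on (\<phi> ` (U \<inter> (\<lambda>x. H (F x)) -` W)) (\<lambda>a. \<xi> (H (F (inv_into U \<phi> a))))"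
  proof (rule smooth_on_local)
    fix a assume "a \<in> \<phi> ` (U \<inter> (\<lambda>x. H (F x)) -` W)"
    then obtain p where p: "a = \<phi> p" "p \<in> U" "H (F p) \<in> W" by auto
    obtain V \<psi> where V: "(V, \<psi>) \<in> B" "F p \<in> V" by (rule chart_exists[OF B])
    define Q where "Q = U \<inter> F -` (V \<inter> H -` W)"
    have oQ: "open Q"
      using chart_open[OF A c(1)] chart_open[OF B V(1)] chart_open[OF C c(2)]
        smooth_map_continuous[OF F] smooth_map_continuous[OF H]
      unfolding Q_def by (intro open_Int) (auto intro!: open_vimage)
    have oT: "open (\<psi> ` (V \<inter> H -` W))"
      using chart_open[OF B V(1)] chart_open[OF C c(2)] smooth_map_continuous[OF H]
      by (intro chart_image_open[OF B V(1)]) (auto intro!: open_Int open_vimage)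
    have oQ': "open (\<phi> ` Q)" by (rule chart_image_open[OF A c(1) oQ]) (auto simp: Q_def)
    have s1: "smooth_on (\<phi> ` Q) (\<lambda>a. \<psi> (F (inv_into U \<phi> a)))"
      by (rule smooth_on_subset[OF smooth_mapD[OF F c(1) V(1)]]) (auto simp: Q_def)
    have "smooth_on (\<phi> ` Q) (\<lambda>a. \<xi> (H (inv_into V \<psi> (\<psi> (F (inv_into U \<phi> a))))))"
      by (rule smooth_on_compose[OF oQ' oT s1 smooth_mapD[OF H V(1) c(2)]])
         (use A c(1) in \<open>auto simp: Q_def\<close>)
    also have "?this \<longleftrightarrow> smooth_on (\<phi> ` Q) (\<lambda>a. \<xi> (H (F (inv_into U \<phi> a))))"
      by (rule smooth_on_cong[OF oQ']) (use A B c V in \<open>auto simp: Q_def\<close>)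
    finally show "\<exists>T. open T \<and> a \<in> T \<and> smooth_on T (\<lambda>a. \<xi> (H (F (inv_into U \<phi> a))))"
      using oQ' p V by (intro exI[of _ "\<phi> ` Q"]) (auto simp: Q_def)
  qed
qed

lemma smooth_map_id: "smooth_atlas A \<Longrightarrow> smooth_map A A (\<lambda>x. x)"
  using chart_transition by (intro smooth_mapI continuous_on_id) (force simp: o_def)

lemma smooth_map_const: "smooth_map A B (\<lambda>x. c)"
  by (rule smooth_mapI) (rule continuous_on_const smooth_on_const)+

lemma prod_atlasE:
  assumes "(S, \<theta>) \<in> prod_atlas A B"
  obtains U \<phi> V \<psi> where "S = U \<times> V" "\<theta> = map_prod \<phi> \<psi>" "(U, \<phi>) \<in> A" "(V, \<psi>) \<in> B"
  using assms unfolding prod_atlas_def by auto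

lemma map_prod_image_Times: "map_prod \<phi> \<psi> ` (U \<times> V) = \<phi> ` U \<times> \<psi> ` V"
  by auto

lemma prod_chart_inv:
  assumes "inj_on \<phi> U" "inj_on \<psi> V" "a \<in> \<phi> ` U" "b \<in> \<psi> ` V"
  shows "inv_into (U \<times> V) (map_prod \<phi> \<psi>) (a, b) = (inv_into U \<phi> a, inv_into V \<psi> b)"
proof -
  have "inj_on (map_prod \<phi> \<psi>) (U \<times> V)" using assms by (auto simp: inj_on_def)
  then show ?thesis using assms
    by (intro inv_into_f_eq) (auto simp: f_inv_into_f inv_into_into)
qed

lemma smooth_on_map_prod:
  fixes f :: "'a::euclidean_space \<Rightarrow> 'b::euclidean_space" and g :: "'c::euclidean_space \<Rightarrow> 'd::euclidean_space"
  assumes "open S" "open T" "smooth_on S f" "smooth_on T g"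
  shows "smooth_on (S \<times> T) (\<lambda>x. (f (fst x), g (snd x)))"
proof (rule smooth_on_Pair[OF open_Times[OF assms(1,2)]])
  show "smooth_on (S \<times> T) (\<lambda>x. f (fst x))"
    by (rule smooth_on_compose[OF open_Times[OF assms(1,2)] assms(1)
          smooth_on_linear[OF bounded_linear_fst open_Times[OF assms(1,2)]] assms(3)]) auto
  show "smooth_on (S \<times> T) (\<lambda>x. g (snd x))"
    by (rule smooth_on_compose[OF open_Times[OF assms(1,2)] assms(2)
          smooth_on_linear[OF bounded_linear_snd open_Times[OF assms(1,2)]] assms(4)]) auto
qed

lemma smooth_atlas_prod:
  assumes A: "smooth_atlas A" and B: "smooth_atlas B"
  shows "smooth_atlas (prod_atlas A B)"
  unfolding smooth_atlas_def
proof (intro conjI)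
  show "(\<Union>(U,\<phi>)\<in>prod_atlas A B. U) = UNIV"
  proof -
    have "\<exists>c\<in>prod_atlas A B. p \<in> fst c" for p
    proof -
      obtain U \<phi> where "(U, \<phi>) \<in> A" "fst p \<in> U" by (rule chart_exists[OF A])
      moreover obtain V \<psi> where "(V, \<psi>) \<in> B" "snd p \<in> V" by (rule chart_exists[OF B])
      ultimately show ?thesis
        by (intro bexI[of _ "(U \<times> V, map_prod \<phi> \<psi>)"]) (auto simp: prod_atlas_def mem_Times_iff)
    qed
    then show ?thesis by (fastforce simp: case_prod_beta)
  qed
  show "\<forall>(S,\<theta>)\<in>prod_atlas A B. open S \<and> open (\<theta> ` S) \<and> homeomorphism S (\<theta> ` S) \<theta> (inv_into S \<theta>)"
  proof (clarify elim!: prod_atlasE, intro conjI)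
    fix S \<theta> U \<phi> V \<psi> assume U: "(U, \<phi>) \<in> A" and V: "(V, \<psi>) \<in> B"
    show "open (U \<times> V)" by (intro open_Times chart_open[OF A U] chart_open[OF B V])
    show "open (map_prod \<phi> \<psi> ` (U \<times> V))"
      unfolding map_prod_image_Times by (intro open_Times chart_range_open[OF A U] chart_range_open[OF B V])
    have inj: "inj_on \<phi> U" "inj_on \<psi> V" using chart_inj A B U V by auto
    let ?i = "inv_into (U \<times> V) (map_prod \<phi> \<psi>)"
    have "continuous_on (U \<times> V) (map_prod \<phi> \<psi>)"
      using chart_continuous[OF A U] chart_continuous[OF B V]
      unfolding map_prod_def case_prod_beta
      by (auto intro!: continuous_intros continuous_on_compose2[of U \<phi> _ fst] continuous_on_compose2[of V \<psi> _ snd])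
    moreover have "continuous_on (\<phi> ` U \<times> \<psi> ` V) ?i \<longleftrightarrow>
        continuous_on (\<phi> ` U \<times> \<psi> ` V) (\<lambda>x. (inv_into U \<phi> (fst x), inv_into V \<psi> (snd x)))"
      by (rule continuous_on_cong) (auto simp: prod_chart_inv[OF inj])
    moreover have "continuous_on (\<phi> ` U \<times> \<psi> ` V) (\<lambda>x. (inv_into U \<phi> (fst x), inv_into V \<psi> (snd x)))"
      using chart_inv_continuous[OF A U] chart_inv_continuous[OF B V]
      by (auto intro!: continuous_intros continuous_on_compose2[of "\<phi> ` U" "inv_into U \<phi>" _ fst]
          continuous_on_compose2[of "\<psi> ` V" "inv_into V \<psi>" _ snd])
    ultimately have cont: "continuous_on (U \<times> V) (map_prod \<phi> \<psi>)" "continuous_on (\<phi> ` U \<times> \<psi> ` V) ?i"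
      by simp_all
    have l: "?i (map_prod \<phi> \<psi> x) = x" if "x \<in> U \<times> V" for x
      using that A B U V by (cases x) (simp add: prod_chart_inv[OF inj])
    have r: "map_prod \<phi> \<psi> (?i y) = y" if "y \<in> \<phi> ` U \<times> \<psi> ` V" for y
      using that by (cases y) (simp add: prod_chart_inv[OF inj] f_inv_into_f)
    have im: "?i ` (\<phi> ` U \<times> \<psi> ` V) = U \<times> V"
      using l by (force simp flip: map_prod_image_Times simp: image_image)
    show "homeomorphism (U \<times> V) (map_prod \<phi> \<psi> ` (U \<times> V)) (map_prod \<phi> \<psi>) ?i"
      unfolding map_prod_image_Times homeomorphism_def
      using cont l r im map_prod_image_Times[of \<phi> \<psi> U V] by blast
  qed
  show "\<forall>(S,\<theta>)\<in>prod_atlas A B. \<forall>(S',\<theta>')\<in>prod_atlas A B. smooth_on (\<theta> ` (S \<inter> S')) (\<theta>' \<circ> inv_into S \<theta>)"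
  proof (clarify elim!: prod_atlasE)
    fix S \<theta> U \<phi> V \<psi> U' \<phi>' V' \<psi>'
    assume U: "(U, \<phi>) \<in> A" and V: "(V, \<psi>) \<in> B" and U': "(U', \<phi>') \<in> A" and V': "(V', \<psi>') \<in> B"
    have inj: "inj_on \<phi> U" "inj_on \<psi> V" using chart_inj A B U V by auto
    have o: "open (\<phi> ` (U \<inter> U'))" "open (\<psi> ` (V \<inter> V'))"
      using chart_image_open[OF A U] chart_image_open[OF B V] chart_open A B U V U' V'
      by (meson open_Int inf_le1)+
    have eq: "map_prod \<phi> \<psi> ` (U \<times> V \<inter> U' \<times> V') = \<phi> ` (U \<inter> U') \<times> \<psi> ` (V \<inter> V')"
      by (auto simp: Times_Int_Times map_prod_image_Times)
    have "smooth_on (\<phi> ` (U \<inter> U') \<times> \<psi> ` (V \<inter> V'))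
        (\<lambda>x. ((\<phi>' \<circ> inv_into U \<phi>) (fst x), (\<psi>' \<circ> inv_into V \<psi>) (snd x)))"
      by (rule smooth_on_map_prod[OF o chart_transition[OF A U U'] chart_transition[OF B V V']])
    also have "?this \<longleftrightarrow> smooth_on (\<phi> ` (U \<inter> U') \<times> \<psi> ` (V \<inter> V'))
        (map_prod \<phi>' \<psi>' \<circ> inv_into (U \<times> V) (map_prod \<phi> \<psi>))"
      by (rule smooth_on_cong) (use o in \<open>auto intro!: open_Times simp: prod_chart_inv[OF inj]\<close>)
    finally show "smooth_on (map_prod \<phi> \<psi> ` (U \<times> V \<inter> U' \<times> V'))
        (map_prod \<phi>' \<psi>' \<circ> inv_into (U \<times> V) (map_prod \<phi> \<psi>))"
      by (simp only: eq)
  qed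
qed

lemma smooth_map_fst:
  assumes A: "smooth_atlas A" and B: "smooth_atlas B"
  shows "smooth_map (prod_atlas A B) A fst"
proof (rule smooth_mapI)
  fix S \<theta> U' \<phi>' assume S: "(S, \<theta>) \<in> prod_atlas A B" and U': "(U', \<phi>') \<in> A"
  obtain U \<phi> V \<psi> where ST: "S = U \<times> V" "\<theta> = map_prod \<phi> \<psi>" and U: "(U, \<phi>) \<in> A" and V: "(V, \<psi>) \<in> B"
    using S by (rule prod_atlasE)
  have inj: "inj_on \<phi> U" "inj_on \<psi> V" using chart_inj A B U V by auto
  have eq: "\<theta> ` (S \<inter> fst -` U') = \<phi> ` (U \<inter> U') \<times> \<psi> ` V" unfolding ST by force
  have o: "open (\<phi> ` (U \<inter> U'))" "open (\<psi> ` V)"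
    using chart_image_open[OF A U open_Int[OF chart_open[OF A U] chart_open[OF A U']]]
      chart_range_open[OF B V] by auto
  have "smooth_on (\<phi> ` (U \<inter> U') \<times> \<psi> ` V) (\<lambda>a. (\<phi>' \<circ> inv_into U \<phi>) (fst a))"
    by (rule smooth_on_compose[OF open_Times[OF o] o(1) smooth_on_linear[OF bounded_linear_fst open_Times[OF o]]
          chart_transition[OF A U U']]) auto
  also have "?this \<longleftrightarrow> smooth_on (\<phi> ` (U \<inter> U') \<times> \<psi> ` V) (\<lambda>a. \<phi>' (fst (inv_into S \<theta> a)))"
    by (rule smooth_on_cong[OF open_Times[OF o]]) (auto simp: ST prod_chart_inv[OF inj])
  finally show "smooth_on (\<theta> ` (S \<inter> fst -` U')) (\<lambda>a. \<phi>' (fst (inv_into S \<theta> a)))"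
    by (simp only: eq)
qed (auto intro: continuous_intros)

lemma smooth_map_snd:
  assumes A: "smooth_atlas A" and B: "smooth_atlas B"
  shows "smooth_map (prod_atlas A B) B snd"
proof (rule smooth_mapI)
  fix S \<theta> V' \<psi>' assume S: "(S, \<theta>) \<in> prod_atlas A B" and V': "(V', \<psi>') \<in> B"
  obtain U \<phi> V \<psi> where ST: "S = U \<times> V" "\<theta> = map_prod \<phi> \<psi>" and U: "(U, \<phi>) \<in> A" and V: "(V, \<psi>) \<in> B"
    using S by (rule prod_atlasE)
  have inj: "inj_on \<phi> U" "inj_on \<psi> V" using chart_inj A B U V by auto
  have eq: "\<theta> ` (S \<inter> snd -` V') = \<phi> ` U \<times> \<psi> ` (V \<inter> V')" unfolding ST by force
  have o: "open (\<phi> ` U)" "open (\<psi> ` (V \<inter> V'))"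
    using chart_image_open[OF B V open_Int[OF chart_open[OF B V] chart_open[OF B V']]]
      chart_range_open[OF A U] by auto
  have "smooth_on (\<phi> ` U \<times> \<psi> ` (V \<inter> V')) (\<lambda>a. (\<psi>' \<circ> inv_into V \<psi>) (snd a))"
    by (rule smooth_on_compose[OF open_Times[OF o] o(2) smooth_on_linear[OF bounded_linear_snd open_Times[OF o]]
          chart_transition[OF B V V']]) auto
  also have "?this \<longleftrightarrow> smooth_on (\<phi> ` U \<times> \<psi> ` (V \<inter> V')) (\<lambda>a. \<psi>' (snd (inv_into S \<theta> a)))"
    by (rule smooth_on_cong[OF open_Times[OF o]]) (auto simp: ST prod_chart_inv[OF inj])
  finally show "smooth_on (\<theta> ` (S \<inter> snd -` V')) (\<lambda>a. \<psi>' (snd (inv_into S \<theta> a)))"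
    by (simp only: eq)
qed (auto intro: continuous_intros)

lemma smooth_map_Pair:
  assumes A: "smooth_atlas A" and B: "smooth_atlas B" and C: "smooth_atlas C"
    and F: "smooth_map A B F" and H: "smooth_map A C H"
  shows "smooth_map A (prod_atlas B C) (\<lambda>x. (F x, H x))"
proof (rule smooth_mapI)
  show "continuous_on UNIV (\<lambda>x. (F x, H x))"
    using smooth_map_continuous[OF F] smooth_map_continuous[OF H] by (intro continuous_intros)
  fix U \<phi> S \<theta> assume U: "(U, \<phi>) \<in> A" and S: "(S, \<theta>) \<in> prod_atlas B C"
  obtain V \<psi> W \<xi> where ST: "S = V \<times> W" "\<theta> = map_prod \<psi> \<xi>" and V: "(V, \<psi>) \<in> B" and W: "(W, \<xi>) \<in> C"
    using S by (rule prod_atlasE)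
  let ?Q = "U \<inter> (\<lambda>x. (F x, H x)) -` S"
  have "?Q = U \<inter> F -` V \<inter> H -` W" by (auto simp: ST)
  moreover have "open \<dots>"
    using chart_open[OF A U] chart_open[OF B V] chart_open[OF C W]
      smooth_map_continuous[OF F] smooth_map_continuous[OF H]
    by (intro open_Int) (auto intro!: open_vimage)
  ultimately have o: "open (\<phi> ` ?Q)" by (intro chart_image_open[OF A U]) auto
  have "smooth_on (\<phi> ` ?Q) (\<lambda>a. (\<psi> (F (inv_into U \<phi> a)), \<xi> (H (inv_into U \<phi> a))))"
    by (intro smooth_on_Pair o smooth_on_subset[OF smooth_mapD[OF F U V]] smooth_on_subset[OF smooth_mapD[OF H U W]])
       (auto simp: ST)
  then show "smooth_on (\<phi> ` ?Q) (\<lambda>a. \<theta> (F (inv_into U \<phi> a), H (inv_into U \<phi> a)))"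
    by (simp add: ST)
qed

lemma smooth_atlas_euclidean: "smooth_atlas {(UNIV, id :: 'a::euclidean_space \<Rightarrow> 'a)}"
proof -
  have "inv_into UNIV id = (id :: 'a \<Rightarrow> 'a)" by (rule inv_id)
  moreover have "smooth_on UNIV (id :: 'a \<Rightarrow> 'a)"
    by (rule smooth_on_linear) (simp_all add: id_def)
  ultimately show ?thesis
    by (simp only: smooth_atlas_def) (simp add: homeomorphism_def image_id continuous_on_id')
qed

lemma smooth_fun_iff:
  "smooth_fun A f \<longleftrightarrow> continuous_on UNIV f \<and>
    (\<forall>(U, \<phi>)\<in>A. smooth_on (\<phi> ` U) (f \<circ> inv_into U \<phi>))"
  by (simp add: smooth_fun_def smooth_map_def)

lemma smooth_funD: "smooth_fun A f \<Longrightarrow> (U, \<phi>) \<in> A \<Longrightarrow> smooth_on (\<phi> ` U) (f \<circ> inv_into U \<phi>)"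
  by (auto simp: smooth_fun_iff)

lemma smooth_fun_compose:
  assumes "smooth_atlas A" "smooth_atlas B" "smooth_map A B F" "smooth_fun B f"
  shows "smooth_fun A (\<lambda>x. f (F x))"
  using smooth_map_compose[OF assms(1,2) smooth_atlas_euclidean assms(3)] assms(4)
  by (simp add: smooth_fun_def)

lemma smooth_fun_const: "smooth_fun A (\<lambda>x. c)"
  by (simp add: smooth_fun_def smooth_map_const)

lemma smooth_fun_add:
  assumes "smooth_atlas A" "smooth_fun A f" "smooth_fun A g"
  shows "smooth_fun A (\<lambda>x. f x + g x)"
  unfolding smooth_fun_iff o_def
proof (intro conjI ballI, goal_cases)
  case 1
  show ?case using assms by (intro continuous_on_add) (simp_all add: smooth_fun_iff)
next
  case (2 c)
  then show ?case
    using smooth_on_add[OF chart_range_open[OF assms(1)] smooth_funD[OF assms(2)] smooth_funD[OF assms(3)]]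
    by (cases c) (simp add: o_def)
qed

lemma smooth_fun_mult_const:
  assumes "smooth_atlas A" "smooth_fun A f"
  shows "smooth_fun A (\<lambda>x. c * f x)"
  unfolding smooth_fun_iff o_def
proof (intro conjI ballI, goal_cases)
  case 1
  show ?case using assms by (intro continuous_on_mult continuous_on_const) (simp add: smooth_fun_iff)
next
  case (2 d)
  then show ?case
    using smooth_on_linear_compose[OF bounded_linear_mult_right chart_range_open[OF assms(1)] smooth_funD[OF assms(2)]]
    by (cases d) (simp add: o_def)
qed

lemma smooth_fun_sum:
  assumes "smooth_atlas A" "\<And>i. i \<in> I \<Longrightarrow> smooth_fun A (f i)"
  shows "smooth_fun A (\<lambda>x. \<Sum>i\<in>I. f i x)"
  using assms(2)
  by (induction I rule: infinite_finite_induct) (auto intro: smooth_fun_const smooth_fun_add[OF assms(1)])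

text \<open>One chart around each point suffices, because the transition to any other chart is smooth.\<close>

lemma smooth_fun_local:
  assumes A: "smooth_atlas A"
    and loc: "\<And>p. \<exists>U \<phi> Q. (U, \<phi>) \<in> A \<and> open Q \<and> p \<in> Q \<and> Q \<subseteq> U \<and> smooth_on (\<phi> ` Q) (f \<circ> inv_into U \<phi>)"
  shows "smooth_fun A f"
  unfolding smooth_fun_iff
proof (intro conjI)
  have "isCont f p" for p
  proof -
    obtain U \<phi> Q where Q: "(U, \<phi>) \<in> A" "open Q" "p \<in> Q" "Q \<subseteq> U" "smooth_on (\<phi> ` Q) (f \<circ> inv_into U \<phi>)"
      using loc by blast
    have "continuous_on Q (\<lambda>q. (f \<circ> inv_into U \<phi>) (\<phi> q))"
      using smooth_on_imp_continuous_on[OF Q(5)] continuous_on_subset[OF chart_continuous[OF A Q(1)] Q(4)]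
      by (rule continuous_on_compose2) auto
    also have "?this \<longleftrightarrow> continuous_on Q f"
      by (rule continuous_on_cong) (use Q A in auto)
    finally show ?thesis using Q by (simp add: continuous_on_eq_continuous_at)
  qed
  then show "continuous_on UNIV f" by (simp add: continuous_at_imp_continuous_on)
  show "\<forall>(W, \<xi>)\<in>A. smooth_on (\<xi> ` W) (f \<circ> inv_into W \<xi>)"
  proof (clarify, rule smooth_on_local)
    fix W \<xi> a assume W: "(W, \<xi>) \<in> A" and "a \<in> \<xi> ` W"
    then obtain p where p: "p \<in> W" "a = \<xi> p" by auto
    obtain U \<phi> Q where Q: "(U, \<phi>) \<in> A" "open Q" "p \<in> Q" "Q \<subseteq> U" "smooth_on (\<phi> ` Q) (f \<circ> inv_into U \<phi>)"
      using loc by blast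
    have oT: "open (\<xi> ` (Q \<inter> W))"
      using Q(2) chart_open[OF A W] by (intro chart_image_open[OF A W]) auto
    have "smooth_on (\<xi> ` (Q \<inter> W)) (\<lambda>a. (f \<circ> inv_into U \<phi>) ((\<phi> \<circ> inv_into W \<xi>) a))"
      by (rule smooth_on_compose[OF oT chart_image_open[OF A Q(1,2,4)]
            smooth_on_subset[OF chart_transition[OF A W Q(1)]] Q(5)]) (use A W Q in auto)
    also have "?this \<longleftrightarrow> smooth_on (\<xi> ` (Q \<inter> W)) (f \<circ> inv_into W \<xi>)"
      by (rule smooth_on_cong[OF oT]) (use A W Q in auto)
    finally show "\<exists>T. open T \<and> a \<in> T \<and> smooth_on T (f \<circ> inv_into W \<xi>)"
      using oT p Q by blast
  qed
qed

section \<open>Bump functions\<close>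

text \<open>The functions \<open>p (1/t) exp (-1/t)\<close>, extended by zero, form a class that is closed under
  differentiation; this is why they are smooth at zero.\<close>

definition exp_tail :: "real poly \<Rightarrow> real \<Rightarrow> real" where
  "exp_tail p t = (if t > 0 then poly p (inverse t) * exp (- inverse t) else 0)"

lemma poly_times_exp_minus_tendsto_0: "((\<lambda>x::real. poly p x * exp (- x)) \<longlongrightarrow> 0) at_top"
proof -
  have "((\<lambda>x::real. \<Sum>i\<le>degree p. coeff p i * (x ^ i / exp x)) \<longlongrightarrow> (\<Sum>i\<le>degree p. coeff p i * 0)) at_top"
    by (intro tendsto_intros tendsto_power_div_exp_0)
  then show ?thesis
    by (simp add: poly_altdef sum_distrib_right exp_minus divide_inverse mult.assoc)
qed

text \<open>The derivative of \<open>p (1/t) exp (- 1/t)\<close> is \<open>q (1/t) exp (- 1/t)\<close> with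
  \<open>q = X\<^sup>2 (p - p')\<close>. At zero, the difference quotient from the right is of the form
  \<open>u p(u) exp (- u)\<close> with \<open>u = 1/t\<close>.\<close>

lemma exp_tail_has_derivative:
  "(exp_tail p has_real_derivative exp_tail (pCons 0 (pCons 0 (p - pderiv p))) t) (at t)"
proof -
  consider "t > 0" | "t < 0" | "t = 0" by linarith
  then show ?thesis
  proof cases
    case 1
    have d: "((\<lambda>t. poly p (inverse t) * exp (- inverse t)) has_real_derivative
          exp_tail (pCons 0 (pCons 0 (p - pderiv p))) t) (at t)"
      using 1 by (auto intro!: derivative_eq_intros poly_DERIV[THEN DERIV_chain2]
          simp: exp_tail_def algebra_simps power2_eq_square)
    show ?thesis
      by (rule DERIV_cong_ev[THEN iffD2, OF refl _ refl d])
         (use 1 eventually_nhds_in_open[of "{0<..}" t] in \<open>auto elim!: eventually_mono simp: exp_tail_def\<close>)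
  next
    case 2
    show ?thesis
      by (rule DERIV_cong_ev[THEN iffD2, OF refl _ _ DERIV_const[of 0]])
         (use 2 eventually_nhds_in_open[of "{..<0}" t] in \<open>auto elim!: eventually_mono simp: exp_tail_def\<close>)
  next
    case 3
    have "((\<lambda>h. (exp_tail p (0 + h) - exp_tail p 0) / h) \<longlongrightarrow> 0) (at_left 0)"
      by (rule tendsto_eventually) (auto simp: eventually_at_left_field exp_tail_def intro: exI[of _ "-1"])
    moreover have "((\<lambda>h. (exp_tail p (0 + h) - exp_tail p 0) / h) \<longlongrightarrow> 0) (at_right 0)"
      unfolding filterlim_at_right_to_top
    proof (rule Lim_transform_eventually[OF poly_times_exp_minus_tendsto_0[of "pCons 0 p"]])
      show "\<forall>\<^sub>F x in at_top. poly (pCons 0 p) x * exp (- x) =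
          (exp_tail p (0 + inverse x) - exp_tail p 0) / inverse x"
        using eventually_gt_at_top[of 0] by eventually_elim (auto simp: exp_tail_def field_simps)
    qed
    ultimately have "((\<lambda>h. (exp_tail p (0 + h) - exp_tail p 0) / h) \<longlongrightarrow> 0) (at 0)"
      by (simp add: filterlim_split_at)
    then show ?thesis using 3 by (simp add: DERIV_def exp_tail_def)
  qed
qed

lemma smooth_on_exp_tail: "smooth_on UNIV (exp_tail p)"
  unfolding smooth_on_def
proof
  fix k show "Ck_on k UNIV (exp_tail p)"
  proof (induction k arbitrary: p)
    case 0
    show ?case
      using DERIV_isCont[OF exp_tail_has_derivative[of p]] by (auto intro!: continuous_at_imp_continuous_on)
  next
    case (Suc k)
    show ?case
    proof (rule Ck_on_SucI)
      show "(exp_tail p has_derivative (\<lambda>v. v * exp_tail (pCons 0 (pCons 0 (p - pderiv p))) x)) (at x)" for x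
        using exp_tail_has_derivative[of p x] by (simp add: has_field_derivative_def mult_commute_abs)
      show "Ck_on k UNIV (\<lambda>x. v * exp_tail (pCons 0 (pCons 0 (p - pderiv p))) x)" for v
        by (intro Ck_on_linear_compose[OF bounded_linear_mult_right] Suc.IH open_UNIV)
    qed simp
  qed
qed

definition bump :: "'a::euclidean_space \<Rightarrow> real \<Rightarrow> 'a \<Rightarrow> complex" where
  "bump b r a = of_real (exp_tail 1 (r\<^sup>2 - (a - b) \<bullet> (a - b)))"

lemma smooth_on_bump: "smooth_on UNIV (bump b r)"
proof -
  have d: "smooth_on UNIV (\<lambda>a. a - b)"
    using smooth_on_add[OF open_UNIV smooth_on_linear[OF bounded_linear_ident open_UNIV] smooth_on_const[of _ "- b"]]
    by simp
  have "smooth_on UNIV (\<lambda>a. r\<^sup>2 + - ((a - b) \<bullet> (a - b)))"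
    by (intro smooth_on_add smooth_on_const smooth_on_linear_compose[OF bounded_linear_minus[OF bounded_linear_ident]]
        smooth_on_bilinear[OF bounded_bilinear_inner] d open_UNIV)
  then have "smooth_on UNIV (\<lambda>a. exp_tail 1 (r\<^sup>2 - (a - b) \<bullet> (a - b)))"
    using smooth_on_compose[OF open_UNIV open_UNIV _ smooth_on_exp_tail] by fastforce
  then show ?thesis
    unfolding bump_def by (intro smooth_on_linear_compose[OF bounded_linear_of_real]) auto
qed

lemma bump_eq_0: "r \<ge> 0 \<Longrightarrow> a \<notin> cball b r \<Longrightarrow> bump b r a = 0"
  using abs_le_square_iff[of r "norm (a - b)"]
  by (auto simp: bump_def exp_tail_def dist_norm norm_minus_commute power2_norm_eq_inner)

text \<open>The extension by zero is smooth outside the chart because the support corresponds to a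
  compact set, which is closed in a Hausdorff space.\<close>

lemma smooth_fun_chart_bump:
  fixes A :: "('m::{t2_space,second_countable_topology}, 'e::euclidean_space) chart set"
  assumes A: "smooth_atlas A" and U: "(U, \<phi>) \<in> A" and r: "r \<ge> 0" "cball b r \<subseteq> \<phi> ` U"
  shows "smooth_fun A (\<lambda>q. if q \<in> U then bump b r (\<phi> q) else 0)"
proof (rule smooth_fun_local[OF A])
  fix p :: 'm
  let ?f = "\<lambda>q. if q \<in> U then bump b r (\<phi> q) else 0"
  let ?K = "inv_into U \<phi> ` cball b r"
  have "compact ?K"
    by (intro compact_continuous_image continuous_on_subset[OF chart_inv_continuous[OF A U] r(2)]) auto
  then have K: "closed ?K" by (rule compact_imp_closed)
  show "\<exists>W \<xi> Q. (W, \<xi>) \<in> A \<and> open Q \<and> p \<in> Q \<and> Q \<subseteq> W \<and> smooth_on (\<xi> ` Q) (?f \<circ> inv_into W \<xi>)"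
  proof (cases "p \<in> U")
    case True
    have "smooth_on (\<phi> ` U) (?f \<circ> inv_into U \<phi>) \<longleftrightarrow> smooth_on (\<phi> ` U) (bump b r)"
      by (rule smooth_on_cong[OF chart_range_open[OF A U]]) (use A U in auto)
    then show ?thesis using True U chart_open[OF A U] smooth_on_subset[OF smooth_on_bump] by blast
  next
    case False
    obtain W \<xi> where W: "(W, \<xi>) \<in> A" "p \<in> W" by (rule chart_exists[OF A])
    have o: "open (W - ?K)" by (intro open_Diff chart_open[OF A W(1)] K)
    have "p \<notin> ?K" using False r(2) inv_into_into by (metis (no_types, lifting) image_iff subset_iff)
    moreover have "smooth_on (\<xi> ` (W - ?K)) (?f \<circ> inv_into W \<xi>)"
    proof -
      have "bump b r (\<phi> q) = 0" if "q \<in> U" "q \<notin> ?K" for q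
        using that bump_eq_0[OF r(1), of "\<phi> q" b] chart_inv[OF A U, of q] by (metis image_eqI)
      then have "smooth_on (\<xi> ` (W - ?K)) (?f \<circ> inv_into W \<xi>) \<longleftrightarrow> smooth_on (\<xi> ` (W - ?K)) (\<lambda>_. 0::complex)"
        by (intro smooth_on_cong chart_image_open[OF A W(1) o]) (use A W in auto)
      then show ?thesis by (simp add: smooth_on_const)
    qed
    ultimately show ?thesis using o W by blast
  qed
qed

section \<open>Tangent vectors\<close>

lemma coord_vec_not_smooth: "\<not> smooth_fun A f \<Longrightarrow> coord_vec A c p v f = 0"
  by (simp add: coord_vec_def case_prod_beta)

lemma coord_vec_has_derivative:
  assumes "smooth_atlas A" "(U, \<phi>) \<in> A" "p \<in> U" "smooth_fun A f"
  shows "((\<lambda>a. f (inv_into U \<phi> a)) has_derivative (\<lambda>v. coord_vec A (U, \<phi>) p v f)) (at (\<phi> p))"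
  using smooth_on_has_derivative[OF smooth_funD[OF assms(4,2)], of "\<phi> p"] assms
  by (simp add: coord_vec_def o_def)

lemma coord_vec_eqI:
  assumes "smooth_fun A f" "((\<lambda>a. f (inv_into U \<phi> a)) has_derivative D) (at (\<phi> p))"
  shows "coord_vec A (U, \<phi>) p v f = D v"
  using assms frechet_derivative_at[OF assms(2)] by (simp add: coord_vec_def o_def)

lemma has_derivative_transform_open:
  "(f has_derivative D) (at x) \<Longrightarrow> open S \<Longrightarrow> x \<in> S \<Longrightarrow> (\<And>y. y \<in> S \<Longrightarrow> f y = g y) \<Longrightarrow> (g has_derivative D) (at x)"
  using has_derivative_transform_within_open[of f D x UNIV S g] by simp

lemma coord_vec_compose:
  assumes A: "smooth_atlas A" and B: "smooth_atlas B" and F: "smooth_map A B F"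
    and U: "(U, \<phi>) \<in> A" "p \<in> U" and V: "(V, \<psi>) \<in> B" "F p \<in> V" and f: "smooth_fun B f"
  shows "coord_vec A (U, \<phi>) p v (\<lambda>x. f (F x)) =
    coord_vec B (V, \<psi>) (F p) (frechet_derivative (\<lambda>a. \<psi> (F (inv_into U \<phi> a))) (at (\<phi> p)) v) f"
proof (rule coord_vec_eqI[OF smooth_fun_compose[OF A B F f]])
  let ?Q = "U \<inter> F -` V" and ?F = "\<lambda>a. \<psi> (F (inv_into U \<phi> a))"
  have oQ: "open (\<phi> ` ?Q)"
    using chart_open[OF A U(1)] chart_open[OF B V(1)] smooth_map_continuous[OF F]
    by (intro chart_image_open[OF A U(1)] open_Int) (auto intro!: open_vimage)
  have "(?F has_derivative frechet_derivative ?F (at (\<phi> p))) (at (\<phi> p))"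
    by (rule smooth_on_has_derivative[OF smooth_mapD[OF F U(1) V(1)]]) (use U V in auto)
  moreover have "((\<lambda>b. f (inv_into V \<psi> b)) has_derivative (\<lambda>w. coord_vec B (V, \<psi>) (F p) w f)) (at (?F (\<phi> p)))"
    using coord_vec_has_derivative[OF B V f] A U by simp
  ultimately have "((\<lambda>a. f (inv_into V \<psi> (?F a))) has_derivative
      (\<lambda>v. coord_vec B (V, \<psi>) (F p) (frechet_derivative ?F (at (\<phi> p)) v) f)) (at (\<phi> p))"
    using diff_chain_at by (fastforce simp: o_def)
  then show "((\<lambda>a. f (F (inv_into U \<phi> a))) has_derivative
      (\<lambda>v. coord_vec B (V, \<psi>) (F p) (frechet_derivative ?F (at (\<phi> p)) v) f)) (at (\<phi> p))"
    by (rule has_derivative_transform_open[OF _ oQ]) (use A B U V in auto)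
qed

text \<open>The coordinate vectors of two charts are related by the derivative of the transition map;
  this is the chain rule for the identity map.\<close>

lemma tangent_space_chart:
  assumes A: "smooth_atlas A" and X: "X \<in> tangent_space A p" and V: "(V, \<psi>) \<in> A" "p \<in> V"
  obtains v where "X = coord_vec A (V, \<psi>) p v"
proof -
  obtain U \<phi> w where U: "(U, \<phi>) \<in> A" "p \<in> U" and Xw: "X = coord_vec A (U, \<phi>) p w"
    using X unfolding tangent_space_def by fastforce
  have "X f = coord_vec A (V, \<psi>) p (frechet_derivative (\<lambda>a. \<psi> (inv_into U \<phi> a)) (at (\<phi> p)) w) f" for f
  proof (cases "smooth_fun A f")
    case True
    show ?thesis using coord_vec_compose[OF A A smooth_map_id[OF A] U V True, of w] by (simp add: Xw)
  qed (simp add: Xw coord_vec_not_smooth)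
  then show ?thesis using that by blast
qed

lemma coord_vec_in_tangent_space: "(U, \<phi>) \<in> A \<Longrightarrow> p \<in> U \<Longrightarrow> coord_vec A (U, \<phi>) p v \<in> tangent_space A p"
  unfolding tangent_space_def by fastforce

lemma tangent_space_eq_range:
  assumes A: "smooth_atlas A" and V: "(V, \<psi>) \<in> A" "p \<in> V"
  shows "tangent_space A p = range (coord_vec A (V, \<psi>) p)"
proof
  show "tangent_space A p \<subseteq> range (coord_vec A (V, \<psi>) p)"
  proof
    fix X assume "X \<in> tangent_space A p"
    then obtain v where "X = coord_vec A (V, \<psi>) p v" by (rule tangent_space_chart[OF A _ V])
    then show "X \<in> range (coord_vec A (V, \<psi>) p)" by blast
  qed
qed (use coord_vec_in_tangent_space[OF V] in blast)

lemma coord_vec_linear: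
  assumes A: "smooth_atlas A" and U: "(U, \<phi>) \<in> A" "p \<in> U"
  shows "coord_vec A (U, \<phi>) p (v + w) = coord_vec A (U, \<phi>) p v + coord_vec A (U, \<phi>) p w"
    and "coord_vec A (U, \<phi>) p (r *\<^sub>R v) = (\<lambda>f. of_real r * coord_vec A (U, \<phi>) p v f)"
    and "coord_vec A (U, \<phi>) p 0 = 0"
proof -
  have *: "linear (\<lambda>v. coord_vec A (U, \<phi>) p v f)" for f
  proof (cases "smooth_fun A f")
    case True
    show ?thesis using coord_vec_has_derivative[OF A U True] by (rule has_derivative_linear)
  qed (simp add: coord_vec_not_smooth linear_zero)
  show "coord_vec A (U, \<phi>) p (v + w) = coord_vec A (U, \<phi>) p v + coord_vec A (U, \<phi>) p w"
    using linear_add[OF *] by (simp add: fun_eq_iff)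
  show "coord_vec A (U, \<phi>) p (r *\<^sub>R v) = (\<lambda>f. of_real r * coord_vec A (U, \<phi>) p v f)"
    using linear_scale[OF *] by (simp add: fun_eq_iff scaleR_conv_of_real)
  show "coord_vec A (U, \<phi>) p 0 = 0"
    using linear_0[OF *] by (simp add: fun_eq_iff)
qed

lemma coord_vec_sum:
  assumes A: "smooth_atlas A" and U: "(U, \<phi>) \<in> A" "p \<in> U"
  shows "coord_vec A (U, \<phi>) p (\<Sum>i\<in>I. r i *\<^sub>R v i) = (\<lambda>f. \<Sum>i\<in>I. of_real (r i) * coord_vec A (U, \<phi>) p (v i) f)"
  by (induction I rule: infinite_finite_induct)
     (simp_all add: coord_vec_linear[OF A U] fun_eq_iff)

lemma tangent_space_subspace:
  assumes A: "smooth_atlas A"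
  shows "rfun.subspace (tangent_space A p)"
proof -
  obtain U \<phi> where U: "(U, \<phi>) \<in> A" "p \<in> U" by (rule chart_exists[OF A])
  show ?thesis
    unfolding tangent_space_eq_range[OF A U]
  proof (rule rfun.subspaceI)
    show "0 \<in> range (coord_vec A (U, \<phi>) p)"
      using coord_vec_linear(3)[OF A U] by (metis rangeI)
    fix X Y assume "X \<in> range (coord_vec A (U, \<phi>) p)"
    then obtain v where v: "X = coord_vec A (U, \<phi>) p v" by blast
    show "(\<lambda>f. of_real r * X f) \<in> range (coord_vec A (U, \<phi>) p)" for r
      unfolding v coord_vec_linear(2)[OF A U, symmetric] by (rule rangeI)
    assume "Y \<in> range (coord_vec A (U, \<phi>) p)"
    then obtain w where w: "Y = coord_vec A (U, \<phi>) p w" by blast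
    show "X + Y \<in> range (coord_vec A (U, \<phi>) p)"
      unfolding v w coord_vec_linear(1)[OF A U, symmetric] by (rule rangeI)
  qed
qed

lemma tangent_vec_not_smooth: "X \<in> tangent_space A p \<Longrightarrow> \<not> smooth_fun A f \<Longrightarrow> X f = 0"
  by (auto simp: tangent_space_def coord_vec_not_smooth)

lemma
  assumes A: "smooth_atlas A" and X: "X \<in> tangent_space A p"
  shows tangent_vec_add: "smooth_fun A f \<Longrightarrow> smooth_fun A g \<Longrightarrow> X (\<lambda>x. f x + g x) = X f + X g"
    and tangent_vec_mult: "smooth_fun A f \<Longrightarrow> X (\<lambda>x. c * f x) = c * X f"
    and tangent_vec_const: "X (\<lambda>x. c) = 0"
proof -
  obtain U \<phi> where U: "(U, \<phi>) \<in> A" "p \<in> U" by (rule chart_exists[OF A])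
  obtain v where v: "X = coord_vec A (U, \<phi>) p v" by (rule tangent_space_chart[OF A X U])
  show "X (\<lambda>x. f x + g x) = X f + X g" if "smooth_fun A f" "smooth_fun A g"
    unfolding v using coord_vec_has_derivative[OF A U] that
    by (intro coord_vec_eqI smooth_fun_add[OF A] has_derivative_add) auto
  show "X (\<lambda>x. c * f x) = c * X f" if "smooth_fun A f"
    unfolding v using coord_vec_has_derivative[OF A U] that
    by (intro coord_vec_eqI smooth_fun_mult_const[OF A] has_derivative_mult_right) auto
  show "X (\<lambda>x. c) = 0"
    unfolding v by (intro coord_vec_eqI[where D = "\<lambda>_. 0"] smooth_fun_const has_derivative_const)
qed

lemma tangent_vec_sum:
  assumes A: "smooth_atlas A" and X: "X \<in> tangent_space A p" and f: "\<And>i. i \<in> I \<Longrightarrow> smooth_fun A (f i)"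
  shows "X (\<lambda>x. \<Sum>i\<in>I. f i x) = (\<Sum>i\<in>I. X (f i))"
  using f
  by (induction I rule: infinite_finite_induct)
     (simp_all add: tangent_vec_const[OF A X] tangent_vec_add[OF A X] smooth_fun_sum[OF A])

text \<open>The derivative at the origin of a radial bump centred at a point \<open>u\<close> close to it is a
  non-zero multiple of \<open>\<bullet> u\<close>. Hence globally smooth functions realise every linear
  functional on a tangent space; without them the tangent vectors of a chart might coincide.\<close>

lemma linear_functional_realised:
  assumes A: "smooth_atlas A" and U: "(U, \<phi>) \<in> A" "p \<in> U"
  obtains f where "smooth_fun A f" "\<And>w. coord_vec A (U, \<phi>) p w f = of_real (w \<bullet> v)"
proof (cases "v = 0")
  case True
  moreover have "coord_vec A (U, \<phi>) p w (\<lambda>_. 0) = 0" for w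
    by (rule coord_vec_eqI[OF smooth_fun_const has_derivative_const])
  ultimately show ?thesis
    using that[OF smooth_fun_const[of A 0]] by simp
next
  case False
  have "\<phi> p \<in> \<phi> ` U" using U by simp
  then obtain e where e: "e > 0" "ball (\<phi> p) e \<subseteq> \<phi> ` U"
    using chart_range_open[OF A U(1)] openE by blast
  \<comment> \<open>The point \<open>\<phi> p\<close> has to lie inside the bump but off its centre \<open>b\<close>,
    and the bump inside the chart: the distance \<open>e / 4\<close> is less than the radius
    \<open>e / 2\<close>, and both add up to less than \<open>e\<close>.\<close>
  define u where "u = (e / 4 / norm v) *\<^sub>R v"
  define b where "b = \<phi> p + u"
  define r where "r = e / 2"
  have nu: "norm u = e / 4" using False e by (simp add: u_def)
  have r: "r \<ge> 0" "cball b r \<subseteq> \<phi> ` U"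
  proof -
    have "dist (\<phi> p) b = e / 4" by (simp add: b_def dist_norm nu)
    then have "dist (\<phi> p) x < e" if "dist b x \<le> r" for x
      using that dist_triangle[of "\<phi> p" x b] e(1) by (simp add: r_def)
    then have "cball b r \<subseteq> ball (\<phi> p) e" by auto
    then show "r \<ge> 0" "cball b r \<subseteq> \<phi> ` U" using e by (auto simp: r_def)
  qed
  let ?f = "\<lambda>q. if q \<in> U then bump b r (\<phi> q) else 0"
  have f: "smooth_fun A ?f" by (rule smooth_fun_chart_bump[OF A U(1) r])
  let ?q = "pCons 0 (pCons 0 (1 - pderiv 1)) :: real poly"
  define t where "t = r\<^sup>2 - u \<bullet> u"
  have t: "t > 0" using e by (simp add: t_def r_def nu power2_norm_eq_inner[symmetric] power_divide)
  have d1: "(exp_tail 1 has_real_derivative exp_tail ?q t) (at (r\<^sup>2 - (\<phi> p - b) \<bullet> (\<phi> p - b)))"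
    using exp_tail_has_derivative[of 1 t] by (simp add: t_def b_def)
  have d2: "((\<lambda>a. r\<^sup>2 - (a - b) \<bullet> (a - b)) has_derivative (\<lambda>w. 2 * (w \<bullet> u))) (at (\<phi> p))"
    by (auto intro!: derivative_eq_intros simp: b_def inner_commute fun_eq_iff)
  have "((\<lambda>a. exp_tail 1 (r\<^sup>2 - (a - b) \<bullet> (a - b))) has_derivative
      (\<lambda>w. 2 * exp_tail ?q t * (w \<bullet> u))) (at (\<phi> p))"
    using DERIV_compose_FDERIV[OF d1 d2] by (simp add: mult_ac)
  then have "(bump b r has_derivative (\<lambda>w. of_real (2 * exp_tail ?q t * (w \<bullet> u)))) (at (\<phi> p))"
    unfolding bump_def by (rule has_derivative_of_real)
  then have "((\<lambda>a. ?f (inv_into U \<phi> a)) has_derivative (\<lambda>w. of_real (2 * exp_tail ?q t * (w \<bullet> u)))) (at (\<phi> p))"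
    by (rule has_derivative_transform_open[OF _ chart_range_open[OF A U(1)]]) (use A U in auto)
  then have "coord_vec A (U, \<phi>) p w ?f = of_real (2 * exp_tail ?q t * (w \<bullet> u))" for w
    by (rule coord_vec_eqI[OF f])
  moreover define c where "c = 2 * exp_tail ?q t * (e / 4 / norm v)"
  ultimately have D: "coord_vec A (U, \<phi>) p w ?f = of_real (c * (w \<bullet> v))" for w
    by (simp add: u_def mult.assoc)
  have "c \<noteq> 0" using t e False by (simp add: c_def exp_tail_def)
  then have "coord_vec A (U, \<phi>) p w (\<lambda>q. of_real (inverse c) * ?f q) = of_real (w \<bullet> v)" for w
    using tangent_vec_mult[OF A coord_vec_in_tangent_space[OF U] f, of w "of_real (inverse c)"] D
    by simp
  then show ?thesis using that[OF smooth_fun_mult_const[OF A f]] by blast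
qed

lemma coord_vec_eq_0_iff:
  assumes A: "smooth_atlas A" and U: "(U, \<phi>) \<in> A" "p \<in> U"
  shows "coord_vec A (U, \<phi>) p v = 0 \<longleftrightarrow> v = 0"
proof
  assume 0: "coord_vec A (U, \<phi>) p v = 0"
  obtain f where "\<And>w. coord_vec A (U, \<phi>) p w f = of_real (w \<bullet> v)"
    using linear_functional_realised[OF A U, of v] by blast
  from this[of v] show "v = 0" using 0 by simp
qed (simp add: coord_vec_linear[OF A U])

lemma tangent_vec_real:
  assumes A: "smooth_atlas A" and X: "X \<in> tangent_space A p" and f: "smooth_fun A f" "\<And>q. Im (f q) = 0"
  shows "Im (X f) = 0"
proof -
  obtain U \<phi> where U: "(U, \<phi>) \<in> A" "p \<in> U" by (rule chart_exists[OF A])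
  obtain v where v: "X = coord_vec A (U, \<phi>) p v" by (rule tangent_space_chart[OF A X U])
  have "((\<lambda>a. Im (f (inv_into U \<phi> a))) has_derivative (\<lambda>v. Im (coord_vec A (U, \<phi>) p v f))) (at (\<phi> p))"
    by (rule has_derivative_Im[OF coord_vec_has_derivative[OF A U f(1)]])
  then have "((\<lambda>a. 0) has_derivative (\<lambda>v. Im (coord_vec A (U, \<phi>) p v f))) (at (\<phi> p))"
    by (simp only: f(2))
  from has_derivative_unique[OF this has_derivative_const] show ?thesis
    unfolding v by (rule fun_cong)
qed

text \<open>The right inverse \<open>H\<close> serves the convention for functions that are not smooth: if
  \<open>f \<circ> F\<close> is smooth, then so is \<open>f = f \<circ> F \<circ> H\<close>, hence
  \<open>push_forward F X\<close> vanishes on every function that is not smooth.\<close>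

lemma push_forward_tangent:
  assumes A: "smooth_atlas A" and F: "smooth_map A A F" and H: "smooth_map A A H" "\<And>y. F (H y) = y"
    and X: "X \<in> tangent_space A p"
  shows "push_forward F X \<in> tangent_space A (F p)"
proof -
  obtain U \<phi> where U: "(U, \<phi>) \<in> A" "p \<in> U" by (rule chart_exists[OF A])
  obtain v where v: "X = coord_vec A (U, \<phi>) p v" by (rule tangent_space_chart[OF A X U])
  obtain V \<psi> where V: "(V, \<psi>) \<in> A" "F p \<in> V" by (rule chart_exists[OF A])
  let ?w = "frechet_derivative (\<lambda>a. \<psi> (F (inv_into U \<phi> a))) (at (\<phi> p)) v"
  have "push_forward F X f = coord_vec A (V, \<psi>) (F p) ?w f" for f
  proof (cases "smooth_fun A f")
    case True
    then show ?thesis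
      using coord_vec_compose[OF A A F U V True, of v] by (simp add: push_forward_def o_def v)
  next
    case False
    have "\<not> smooth_fun A (\<lambda>x. f (F x))"
      using smooth_fun_compose[OF A A H(1), of "\<lambda>x. f (F x)"] False by (auto simp: H(2))
    then show ?thesis using False by (simp add: push_forward_def o_def v coord_vec_not_smooth)
  qed
  then show ?thesis
    using coord_vec_in_tangent_space[OF V] by (metis ext)
qed

lemma push_forward_push_forward: "push_forward F (push_forward H X) = push_forward (\<lambda>x. F (H x)) X"
  by (simp add: push_forward_def o_def)

section \<open>Derivatives of functions of two variables\<close>

lemma partial_fst_has_derivative:
  assumes "(k has_derivative D) (at (a, b))"
  shows "((\<lambda>a. k (a, b)) has_derivative (\<lambda>v. D (v, 0))) (at a)"
proof -
  have "((\<lambda>a. (a, b)) has_derivative (\<lambda>v. (v, 0))) (at a)" by (intro derivative_intros)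
  from diff_chain_at[OF this assms] show ?thesis by (simp add: o_def)
qed

lemma partial_snd_has_derivative:
  assumes "(k has_derivative D) (at (a, b))"
  shows "((\<lambda>b. k (a, b)) has_derivative (\<lambda>v. D (0, v))) (at b)"
proof -
  have "((\<lambda>b. (a, b)) has_derivative (\<lambda>v. (0, v))) (at b)" by (intro derivative_intros)
  from diff_chain_at[OF this assms] show ?thesis by (simp add: o_def)
qed

context
  fixes A :: "('m::{t2_space,second_countable_topology}, 'e::euclidean_space) chart set"
    and B :: "('k::{t2_space,second_countable_topology}, 'f::euclidean_space) chart set"
    and F :: "'m \<times> 'k \<Rightarrow> complex"
  assumes A: "smooth_atlas A" and B: "smooth_atlas B" and F: "smooth_fun (prod_atlas A B) F"
begin

lemma smooth_fun_section_fst: "smooth_fun A (\<lambda>x. F (x, z))"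
  by (rule smooth_fun_compose[OF A smooth_atlas_prod[OF A B]
        smooth_map_Pair[OF A A B smooth_map_id[OF A] smooth_map_const] F])

lemma smooth_fun_section_snd: "smooth_fun B (\<lambda>z. F (x, z))"
  by (rule smooth_fun_compose[OF B smooth_atlas_prod[OF A B]
        smooth_map_Pair[OF B A B smooth_map_const smooth_map_id[OF B]] F])

lemma smooth_on_product_chart:
  assumes U: "(U, \<phi>) \<in> A" and V: "(V, \<psi>) \<in> B"
  shows "smooth_on (\<phi> ` U \<times> \<psi> ` V) (\<lambda>c. F (inv_into U \<phi> (fst c), inv_into V \<psi> (snd c)))"
proof -
  have inj: "inj_on \<phi> U" "inj_on \<psi> V" using chart_inj A B U V by auto
  have "(U \<times> V, map_prod \<phi> \<psi>) \<in> prod_atlas A B" using U V by (auto simp: prod_atlas_def)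
  from smooth_funD[OF F this]
  have "smooth_on (\<phi> ` U \<times> \<psi> ` V) (F \<circ> inv_into (U \<times> V) (map_prod \<phi> \<psi>))"
    by (simp only: map_prod_image_Times)
  also have "?this \<longleftrightarrow> ?thesis"
    by (rule smooth_on_cong) (use prod_chart_inv[OF inj] chart_range_open[OF A U] chart_range_open[OF B V] in \<open>auto intro!: open_Times\<close>)
  finally show ?thesis .
qed

lemma coord_vec_section:
  assumes U: "(U, \<phi>) \<in> A" "p \<in> U" and V: "(V, \<psi>) \<in> B" "q \<in> V"
  defines "u \<equiv> \<lambda>c. F (inv_into U \<phi> (fst c), inv_into V \<psi> (snd c))"
  shows "coord_vec A (U, \<phi>) p v (\<lambda>x. F (x, q)) = frechet_derivative u (at (\<phi> p, \<psi> q)) (v, 0)"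
    and "coord_vec B (V, \<psi>) q w (\<lambda>z. F (p, z)) = frechet_derivative u (at (\<phi> p, \<psi> q)) (0, w)"
proof -
  have D: "(u has_derivative frechet_derivative u (at (\<phi> p, \<psi> q))) (at (\<phi> p, \<psi> q))"
    using smooth_on_has_derivative[OF smooth_on_product_chart[OF U(1) V(1)], of "(\<phi> p, \<psi> q)"] U V
    by (simp add: u_def)
  show "coord_vec A (U, \<phi>) p v (\<lambda>x. F (x, q)) = frechet_derivative u (at (\<phi> p, \<psi> q)) (v, 0)"
    by (rule coord_vec_eqI[OF smooth_fun_section_fst])
       (use partial_fst_has_derivative[OF D] B V in \<open>simp add: u_def\<close>)
  show "coord_vec B (V, \<psi>) q w (\<lambda>z. F (p, z)) = frechet_derivative u (at (\<phi> p, \<psi> q)) (0, w)"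
    by (rule coord_vec_eqI[OF smooth_fun_section_snd])
       (use partial_snd_has_derivative[OF D] A U in \<open>simp add: u_def\<close>)
qed

lemma smooth_fun_partial_snd:
  assumes Y: "Y \<in> tangent_space B q"
  shows "smooth_fun A (\<lambda>x. Y (\<lambda>z. F (x, z)))"
proof (rule smooth_fun_local[OF A])
  fix p
  obtain U \<phi> where U: "(U, \<phi>) \<in> A" "p \<in> U" by (rule chart_exists[OF A])
  obtain V \<psi> where V: "(V, \<psi>) \<in> B" "q \<in> V" by (rule chart_exists[OF B])
  obtain w where w: "Y = coord_vec B (V, \<psi>) q w" by (rule tangent_space_chart[OF B Y V])
  let ?u = "\<lambda>c. F (inv_into U \<phi> (fst c), inv_into V \<psi> (snd c))"
  have o: "open (\<phi> ` U)" "open (\<phi> ` U \<times> \<psi> ` V)"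
    using chart_range_open[OF A U(1)] chart_range_open[OF B V(1)] by (auto intro!: open_Times)
  have "smooth_on (\<phi> ` U) (\<lambda>a. frechet_derivative ?u (at (a, \<psi> q)) (0, w))"
    by (rule smooth_on_compose[OF o smooth_on_Pair[OF o(1) smooth_on_linear[OF bounded_linear_ident o(1)] smooth_on_const]
          smooth_on_frechet_derivative[OF smooth_on_product_chart[OF U(1) V(1)]]]) (use V in auto)
  also have "?this \<longleftrightarrow> smooth_on (\<phi> ` U) ((\<lambda>x. Y (\<lambda>z. F (x, z))) \<circ> inv_into U \<phi>)"
    by (rule smooth_on_cong[OF o(1)]) (use A U V in \<open>auto simp: w coord_vec_section(2)\<close>)
  finally show "\<exists>U \<phi> Q. (U, \<phi>) \<in> A \<and> open Q \<and> p \<in> Q \<and> Q \<subseteq> U \<and>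
      smooth_on (\<phi> ` Q) ((\<lambda>x. Y (\<lambda>z. F (x, z))) \<circ> inv_into U \<phi>)"
    using U chart_open[OF A U(1)] by blast
qed

end

lemma smooth_fun_swap:
  assumes A: "smooth_atlas A" and B: "smooth_atlas B" and F: "smooth_fun (prod_atlas A B) F"
  shows "smooth_fun (prod_atlas B A) (\<lambda>y. F (snd y, fst y))"
  by (rule smooth_fun_compose[OF smooth_atlas_prod[OF B A] smooth_atlas_prod[OF A B]
        smooth_map_Pair[OF smooth_atlas_prod[OF B A] A B smooth_map_snd[OF B A] smooth_map_fst[OF B A]] F])

lemma smooth_fun_partial_fst:
  assumes A: "smooth_atlas A" and B: "smooth_atlas B" and F: "smooth_fun (prod_atlas A B) F"
    and X: "X \<in> tangent_space A p"
  shows "smooth_fun B (\<lambda>z. X (\<lambda>x. F (x, z)))"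
  using smooth_fun_partial_snd[OF B A smooth_fun_swap[OF A B F] X] by simp

text \<open>In coordinates both sides are second derivatives of one function of two vector variables, in the
  directions \<open>(v, 0)\<close> and \<open>(0, w)\<close>.\<close>

lemma mixed_partials_commute:
  assumes A: "smooth_atlas A" and B: "smooth_atlas B" and F: "smooth_fun (prod_atlas A B) F"
    and X: "X \<in> tangent_space A p" and Y: "Y \<in> tangent_space B q"
  shows "X (\<lambda>x. Y (\<lambda>z. F (x, z))) = Y (\<lambda>z. X (\<lambda>x. F (x, z)))"
proof -
  obtain U \<phi> where U: "(U, \<phi>) \<in> A" "p \<in> U" by (rule chart_exists[OF A])
  obtain v where v: "X = coord_vec A (U, \<phi>) p v" by (rule tangent_space_chart[OF A X U])
  obtain V \<psi> where V: "(V, \<psi>) \<in> B" "q \<in> V" by (rule chart_exists[OF B])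
  obtain w where w: "Y = coord_vec B (V, \<psi>) q w" by (rule tangent_space_chart[OF B Y V])
  let ?u = "\<lambda>c. F (inv_into U \<phi> (fst c), inv_into V \<psi> (snd c))"
  let ?S = "\<phi> ` U \<times> \<psi> ` V" and ?D = "\<lambda>h c. frechet_derivative ?u (at c) h"
  have o: "open (\<phi> ` U)" "open (\<psi> ` V)" "open ?S"
    using chart_range_open[OF A U(1)] chart_range_open[OF B V(1)] by (auto intro!: open_Times)
  have pq: "(\<phi> p, \<psi> q) \<in> ?S" using U V by auto
  have sm: "smooth_on ?S ?u" by (rule smooth_on_product_chart[OF A B F U(1) V(1)])
  have D2: "(?D h has_derivative frechet_derivative (?D h) (at (\<phi> p, \<psi> q))) (at (\<phi> p, \<psi> q))" for h
    by (rule smooth_on_has_derivative[OF smooth_on_frechet_derivative[OF sm] pq])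
  have "X (\<lambda>x. Y (\<lambda>z. F (x, z))) = frechet_derivative (?D (0, w)) (at (\<phi> p, \<psi> q)) (v, 0)"
    unfolding v
  proof (rule coord_vec_eqI[OF smooth_fun_partial_snd[OF A B F Y]])
    show "((\<lambda>a. Y (\<lambda>z. F (inv_into U \<phi> a, z))) has_derivative
        (\<lambda>v. frechet_derivative (?D (0, w)) (at (\<phi> p, \<psi> q)) (v, 0))) (at (\<phi> p))"
      by (rule has_derivative_transform_open[OF partial_fst_has_derivative[OF D2] o(1)])
         (use A U V in \<open>auto simp: w coord_vec_section(2)[OF A B F]\<close>)
  qed
  also have "\<dots> = frechet_derivative (?D (v, 0)) (at (\<phi> p, \<psi> q)) (0, w)"
    by (rule frechet_derivative_commute[OF o(3) sm pq])
  also have "\<dots> = Y (\<lambda>z. X (\<lambda>x. F (x, z)))"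
    unfolding w
  proof (rule coord_vec_eqI[OF smooth_fun_partial_fst[OF A B F X], symmetric])
    show "((\<lambda>b. X (\<lambda>x. F (x, inv_into V \<psi> b))) has_derivative
        (\<lambda>w. frechet_derivative (?D (v, 0)) (at (\<phi> p, \<psi> q)) (0, w))) (at (\<psi> q))"
      by (rule has_derivative_transform_open[OF partial_snd_has_derivative[OF D2] o(2)])
         (use B U V in \<open>auto simp: v coord_vec_section(1)[OF A B F]\<close>)
  qed
  finally show ?thesis .
qed

text \<open>The derivative in the direction \<open>(v, v)\<close> of the diagonal splits as
  \<open>(v, 0) + (0, v)\<close>.\<close>

lemma tangent_vec_diagonal:
  assumes A: "smooth_atlas A" and F: "smooth_fun (prod_atlas A A) F" and X: "X \<in> tangent_space A p"
  shows "X (\<lambda>x. F (x, x)) = X (\<lambda>x. F (x, p)) + X (\<lambda>x. F (p, x))"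
proof -
  obtain U \<phi> where U: "(U, \<phi>) \<in> A" "p \<in> U" by (rule chart_exists[OF A])
  obtain v where v: "X = coord_vec A (U, \<phi>) p v" by (rule tangent_space_chart[OF A X U])
  let ?u = "\<lambda>c. F (inv_into U \<phi> (fst c), inv_into U \<phi> (snd c))"
  have D: "(?u has_derivative frechet_derivative ?u (at (\<phi> p, \<phi> p))) (at (\<phi> p, \<phi> p))"
    by (rule smooth_on_has_derivative[OF smooth_on_product_chart[OF A A F U(1) U(1)]]) (use U in auto)
  have sm: "smooth_fun A (\<lambda>x. F (x, x))"
    by (rule smooth_fun_compose[OF A smooth_atlas_prod[OF A A]
          smooth_map_Pair[OF A A A smooth_map_id[OF A] smooth_map_id[OF A]] F])
  have "((\<lambda>a. (a, a)) has_derivative (\<lambda>v. (v, v))) (at (\<phi> p))" by (intro derivative_intros)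
  from diff_chain_at[OF this D]
  have "X (\<lambda>x. F (x, x)) = frechet_derivative ?u (at (\<phi> p, \<phi> p)) (v, v)"
    unfolding v by (intro coord_vec_eqI[OF sm]) (simp add: o_def)
  also have "\<dots> = frechet_derivative ?u (at (\<phi> p, \<phi> p)) (v, 0) + frechet_derivative ?u (at (\<phi> p, \<phi> p)) (0, v)"
    using linear_add[OF has_derivative_linear[OF D], of "(v, 0)" "(0, v)"] by simp
  finally show ?thesis
    by (simp add: v coord_vec_section[OF A A F U U])
qed

section \<open>Pairs of symmetric bilinear forms\<close>

lemma bilinear_continuous_on_diag:
  fixes q :: "'a::euclidean_space \<Rightarrow> 'a \<Rightarrow> real"
  assumes "bilinear q"
  shows "continuous_on S (\<lambda>x. q x x)"
  using bounded_bilinear.continuous_on[OF bilinear_conv_bounded_bilinear[THEN iffD1, OF assms]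
      continuous_on_id continuous_on_id] .

text \<open>A maximum point \<open>v\<close> of the quotient \<open>q x x / p x x\<close> is an eigenvector: with the maximal value \<open>\<lambda>\<close>,
  the form \<open>\<lambda> p - q\<close> is positive semidefinite and vanishes at \<open>v\<close>.\<close>

lemma exists_relative_eigenvector:
  fixes p q :: "'a::euclidean_space \<Rightarrow> 'a \<Rightarrow> real"
  assumes p: "bilinear p" "\<And>x y. p x y = p y x" "\<And>x. x \<noteq> 0 \<Longrightarrow> p x x > 0"
    and q: "bilinear q" "\<And>x y. q x y = q y x"
    and S: "subspace S" "S \<noteq> {0}"
  obtains v l where "v \<in> S" "v \<noteq> 0" "\<And>w. w \<in> S \<Longrightarrow> q v w = l * p v w"
proof -
  let ?K = "S \<inter> sphere 0 1"
  obtain x where x: "x \<in> S" "x \<noteq> 0" using S subspace_0 by blast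
  have "(1 / norm x) *\<^sub>R x \<in> ?K" using x S(1) by (auto simp: subspace_scale)
  then have ne: "?K \<noteq> {}" by blast
  have comp: "compact ?K" by (intro closed_Int_compact closed_subspace S compact_sphere)
  have p0: "p x x \<noteq> 0" if "x \<in> ?K" for x using p(3)[of x] that by fastforce
  have "continuous_on ?K (\<lambda>x. q x x / p x x)"
    using p0 by (intro continuous_on_divide bilinear_continuous_on_diag p q) auto
  from continuous_attains_sup[OF comp ne this] obtain v where
    v: "v \<in> ?K" "\<And>x. x \<in> ?K \<Longrightarrow> q x x / p x x \<le> q v v / p v v" by blast
  define l where "l = q v v / p v v"
  define r where "r x y = l * p x y - q x y" for x y
  note bl = bilinear_ladd[OF p(1)] bilinear_radd[OF p(1)] bilinear_lmul[OF p(1)] bilinear_rmul[OF p(1)]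
      bilinear_ladd[OF q(1)] bilinear_radd[OF q(1)] bilinear_lmul[OF q(1)] bilinear_rmul[OF q(1)]
  have r_nonneg: "r x x \<ge> 0" if "x \<in> S" for x
  proof (cases "x = 0")
    case True
    then show ?thesis by (simp add: r_def bilinear_lzero[OF p(1)] bilinear_lzero[OF q(1)])
  next
    case False
    let ?y = "(1 / norm x) *\<^sub>R x"
    have "?y \<in> ?K" using that False S(1) by (auto simp: subspace_scale)
    from v(2)[OF this] have "q x x / p x x \<le> l" using False by (simp add: l_def bl)
    then show ?thesis using p(3)[OF False] by (simp add: r_def field_simps)
  qed
  have rv: "r v v = 0" using p0[OF v(1)] by (simp add: r_def l_def)
  have "r v w = 0" if w: "w \<in> S" for w
  proof (rule ccontr)
    assume b: "r v w \<noteq> 0"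
    define c where "c = r w w"
    \<comment> \<open>A small step against the sign of \<open>r v w\<close>; the summand \<open>1\<close> only avoids
      division by zero.\<close>
    define t where "t = - r v w / (c + 1)"
    have c: "c \<ge> 0" using r_nonneg[OF w] by (simp add: c_def)
    have "v + t *\<^sub>R w \<in> S" using v(1) w S(1) by (auto intro: subspace_add subspace_scale)
    from r_nonneg[OF this] have "0 \<le> r v v + 2 * t * r v w + t * t * c"
      using p(2)[of w v] q(2)[of w v] by (simp add: r_def c_def bl algebra_simps)
    also have "\<dots> = 2 * t * r v w + t * t * c" by (simp add: rv)
    also have "t * t * c \<le> t * t * (c + 1)" by (intro mult_left_mono) simp_all
    also have "t * t * (c + 1) = - (t * r v w)" using c by (simp add: t_def)
    finally have "0 \<le> t * r v w" by simp
    also have "t * r v w = - ((r v w)\<^sup>2 / (c + 1))" by (simp add: t_def power2_eq_square)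
    also have "\<dots> < 0" using b c by (simp add: divide_pos_pos)
    finally show False by simp
  qed
  then have "q v w = l * p v w" if "w \<in> S" for w using that by (simp add: r_def)
  moreover have "v \<in> S" "v \<noteq> 0" using v(1) by auto
  ultimately show ?thesis using that by blast
qed

text \<open>Induction on the dimension of \<open>S\<close>: a relative eigenvector \<open>v\<close> satisfies
  \<open>q v w = l * p v w\<close>, so the \<open>p\<close>-orthogonal complement of \<open>v\<close>
  in \<open>S\<close> is also \<open>q\<close>-orthogonal to \<open>v\<close>.\<close>

lemma simultaneous_diagonalization:
  fixes p q :: "'a::euclidean_space \<Rightarrow> 'a \<Rightarrow> real"
  assumes p: "bilinear p" "\<And>x y. p x y = p y x" "\<And>x. x \<noteq> 0 \<Longrightarrow> p x x > 0"
    and q: "bilinear q" "\<And>x y. q x y = q y x"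
    and S: "subspace S"
  shows "\<exists>B. finite B \<and> independent B \<and> span B = S \<and>
    (\<forall>b\<in>B. \<forall>c\<in>B. p b c = (if b = c then 1 else 0) \<and> (b \<noteq> c \<longrightarrow> q b c = 0))"
  using S
proof (induction "dim S" arbitrary: S rule: less_induct)
  case less
  show ?case
  proof (cases "S = {0}")
    case True
    then show ?thesis by (intro exI[of _ "{}"]) (auto simp: independent_empty)
  next
    case False
    obtain v0 l where v0: "v0 \<in> S" "v0 \<noteq> 0" "\<And>w. w \<in> S \<Longrightarrow> q v0 w = l * p v0 w"
      using exists_relative_eigenvector[OF p q less.prems False] by blast
    define v where "v = (1 / sqrt (p v0 v0)) *\<^sub>R v0"
    have v: "v \<in> S" "p v v = 1" "\<And>w. w \<in> S \<Longrightarrow> q v w = l * p v w"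
      using v0 p(3)[OF v0(2)] less.prems
      by (auto simp: v_def subspace_scale bilinear_lmul[OF p(1)] bilinear_rmul[OF p(1)] bilinear_lmul[OF q(1)])
    define S' where "S' = {w \<in> S. p v w = 0}"
    have S': "subspace S'"
      using less.prems by (auto simp: S'_def subspace_def bilinear_radd[OF p(1)] bilinear_rmul[OF p(1)] bilinear_rzero[OF p(1)])
    have vS': "v \<notin> S'" using v by (simp add: S'_def)
    have "S' \<subset> S" using v(1) vS' by (auto simp: S'_def)
    then have "dim S' < dim S"
      using S' less.prems by (intro dim_psubset) (simp add: span_eq_iff[THEN iffD2])
    from less.hyps[OF this S'] obtain B where B: "finite B" "independent B" "span B = S'"
      "\<And>b c. b \<in> B \<Longrightarrow> c \<in> B \<Longrightarrow> p b c = (if b = c then 1 else 0) \<and> (b \<noteq> c \<longrightarrow> q b c = 0)"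
      by blast
    have BS': "B \<subseteq> S'" using B(3) span_superset by blast
    show ?thesis
    proof (intro exI[of _ "insert v B"] conjI ballI)
      show "finite (insert v B)" "independent (insert v B)"
        using B vS' by (auto simp: independent_insert)
      show "span (insert v B) = S"
      proof
        show "span (insert v B) \<subseteq> S"
          using v(1) BS' less.prems by (intro span_minimal) (auto simp: S'_def)
        show "S \<subseteq> span (insert v B)"
        proof
          fix x assume x: "x \<in> S"
          have "x - p v x *\<^sub>R v \<in> S'"
            using x v less.prems by (auto simp: S'_def subspace_diff subspace_scale
                bilinear_rsub[OF p(1)] bilinear_rmul[OF p(1)])
          then show "x \<in> span (insert v B)"
            unfolding span_insert using B(3) by blast
        qed
      qed
      fix b c assume b: "b \<in> insert v B" and c: "c \<in> insert v B"
      have *: "p v b = 0" "q v b = 0" "p b v = 0" "q b v = 0" if "b \<in> B" for b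
        using that BS' v(3)[of b] p(2)[of b v] q(2)[of b v] by (auto simp: S'_def)
      have "v \<notin> B" using BS' vS' by blast
      with b c show "p b c = (if b = c then 1 else 0)"
        using * B(4)[of b c] v(2) by (cases "b = v"; cases "c = v") simp_all
      from \<open>v \<notin> B\<close> b c show "b \<noteq> c \<longrightarrow> q b c = 0"
        using * B(4)[of b c] by (cases "b = v"; cases "c = v") auto
    qed
  qed
qed

lemma det_gram:
  fixes p :: "real^'n \<Rightarrow> real^'n \<Rightarrow> real" and h :: "'n \<Rightarrow> real^'n"
  assumes p: "bilinear p"
  shows "det (\<chi> i j. p (h i) (h j)) = (det (\<chi> k i. h i $ k))\<^sup>2 * det (\<chi> i j. p (axis i 1) (axis j 1))"
proof -
  let ?V = "(\<chi> k i. h i $ k) :: real^'n^'n" and ?P = "(\<chi> i j. p (axis i 1) (axis j 1)) :: real^'n^'n"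
  have e: "(\<Sum>k\<in>UNIV. x $ k *\<^sub>R axis k 1) = x" for x :: "real^'n"
    using basis_expansion[of x] by (simp add: scalar_mult_eq_scaleR)
  have expand_l: "p x y = (\<Sum>k\<in>UNIV. x $ k * p (axis k 1) y)" for x y
  proof -
    interpret linear "\<lambda>x. p x y" using p by (simp add: bilinear_def)
    have "p (\<Sum>k\<in>UNIV. x $ k *\<^sub>R axis k 1) y = (\<Sum>k\<in>UNIV. x $ k * p (axis k 1) y)"
      by (simp only: sum scaleR real_scaleR_def)
    then show ?thesis by (simp only: e)
  qed
  have expand_r: "p x y = (\<Sum>k\<in>UNIV. y $ k * p x (axis k 1))" for x y
  proof -
    interpret linear "\<lambda>y. p x y" using p by (simp add: bilinear_def)
    have "p x (\<Sum>k\<in>UNIV. y $ k *\<^sub>R axis k 1) = (\<Sum>k\<in>UNIV. y $ k * p x (axis k 1))"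
      by (simp only: sum scaleR real_scaleR_def)
    then show ?thesis by (simp only: e)
  qed
  have "p (h i) (h j) = (\<Sum>l\<in>UNIV. (\<Sum>k\<in>UNIV. h i $ k * p (axis k 1) (axis l 1)) * h j $ l)" for i j
    by (subst expand_r, subst expand_l) (simp add: mult.commute)
  then have "(\<chi> i j. p (h i) (h j)) = transpose ?V ** ?P ** ?V"
    by (simp add: vec_eq_iff matrix_matrix_mult_def transpose_def)
  then show ?thesis by (simp add: det_mul power2_eq_square mult_ac)
qed

text \<open>In a basis that is orthonormal for \<open>p\<close> and orthogonal for \<open>q\<close>, the numbers \<open>d i = q (h i) (h i)\<close>
  have product \<open>det q / det p\<close>, so this is the inequality between the arithmetic and the geometric mean in
  the form \<open>ln d \<le> d - 1\<close>.\<close>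

lemma relative_trace_ge:
  fixes p q :: "real^'n \<Rightarrow> real^'n \<Rightarrow> real"
  assumes p: "bilinear p" "\<And>x y. p x y = p y x" "\<And>x. x \<noteq> 0 \<Longrightarrow> p x x > 0"
    and q: "bilinear q" "\<And>x y. q x y = q y x" "\<And>x. x \<noteq> 0 \<Longrightarrow> q x x > 0"
    and det: "det (\<chi> i j. p (axis i 1) (axis j 1)) \<le> det (\<chi> i j. q (axis i 1) (axis j 1))"
    and ne: "p \<noteq> q"
  obtains B where "finite B" "span B = UNIV"
    "\<And>b c. b \<in> B \<Longrightarrow> c \<in> B \<Longrightarrow> p b c = (if b = c then 1 else 0)"
    "(\<Sum>b\<in>B. q b b) > CARD('n)"
proof -
  obtain B where B: "finite B" "independent B" "span B = UNIV"
    "\<And>b c. b \<in> B \<Longrightarrow> c \<in> B \<Longrightarrow> p b c = (if b = c then 1 else 0)"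
    "\<And>b c. b \<in> B \<Longrightarrow> c \<in> B \<Longrightarrow> b \<noteq> c \<Longrightarrow> q b c = 0"
    using simultaneous_diagonalization[OF p q(1,2) subspace_UNIV] by metis
  have card: "card B = CARD('n)"
    using dim_eq_card[of B UNIV] B by simp
  obtain h where h: "bij_betw h (UNIV :: 'n set) B"
    using finite_same_card_bij[of "UNIV :: 'n set" B] B(1) card by auto
  have hB: "h i \<in> B" and hinj: "h i = h j \<longleftrightarrow> i = j" for i j
    using h by (auto simp: bij_betw_def inj_on_def)
  have hne: "h i \<noteq> 0" for i using hB[of i] B(2) dependent_zero by metis
  define d where "d i = q (h i) (h i)" for i
  have d: "d i > 0" for i using q(3)[OF hne] by (simp add: d_def)
  let ?V = "(det (\<chi> k i. h i $ k))\<^sup>2"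
  have "det (\<chi> i j. p (h i) (h j)) = (\<Prod>i\<in>UNIV. (1::real))"
    by (subst det_diagonal) (auto simp: B(4) hB hinj)
  then have dp: "?V * det (\<chi> i j. p (axis i 1) (axis j 1)) = 1"
    by (simp add: det_gram[OF p(1), of h])
  have "det (\<chi> i j. q (h i) (h j)) = (\<Prod>i\<in>UNIV. d i)"
    by (subst det_diagonal) (auto simp: B(5) hB hinj d_def)
  then have dq: "?V * det (\<chi> i j. q (axis i 1) (axis j 1)) = (\<Prod>i\<in>UNIV. d i)"
    by (simp add: det_gram[OF q(1), of h])
  have "?V * det (\<chi> i j. p (axis i 1) (axis j 1)) \<le> ?V * det (\<chi> i j. q (axis i 1) (axis j 1))"
    by (intro mult_left_mono det) simp
  then have "1 \<le> (\<Prod>i\<in>UNIV. d i)" by (simp only: dp dq)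
  then have "0 \<le> ln (\<Prod>i\<in>UNIV. d i)" by simp
  also have "\<dots> = (\<Sum>i\<in>UNIV. ln (d i))"
    using d[THEN less_imp_neq, THEN not_sym] by (intro ln_prod) simp_all
  finally have ln0: "0 \<le> (\<Sum>i\<in>UNIV. ln (d i))" .
  have "\<exists>i. d i \<noteq> 1"
  proof (rule ccontr)
    assume "\<not> ?thesis"
    then have d1: "q (h i) (h i) = 1" for i by (simp add: d_def)
    have eq: "p b c = q b c" if bc: "b \<in> B" "c \<in> B" for b c
    proof -
      obtain i where "b = h i" using bc h by (auto simp: bij_betw_def)
      then show ?thesis using B(4,5)[OF bc] d1[of i] by auto
    qed
    have "p x y = q x y" for x y
      by (rule bilinear_eq[OF p(1) q(1), of UNIV B UNIV B]) (use B(3) eq in auto)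
    then show False using ne by blast
  qed
  then obtain i where i: "d i \<noteq> 1" by blast
  have "(\<Sum>i\<in>UNIV. ln (d i)) < (\<Sum>i\<in>UNIV. d i - 1)"
  proof (rule sum_strict_mono_ex1)
    show "\<forall>i\<in>UNIV. ln (d i) \<le> d i - 1" using d by (auto intro: ln_le_minus_one)
    show "\<exists>i\<in>UNIV. ln (d i) < d i - 1"
      using i d[of i] ln_eq_minus_one[of "d i"] ln_le_minus_one[of "d i"] by (intro bexI[of _ i]) force+
  qed simp
  then have "(\<Sum>i\<in>UNIV. d i) > CARD('n)" using ln0 by (simp add: sum_subtractf)
  also have "(\<Sum>i\<in>UNIV. d i) = (\<Sum>b\<in>B. q b b)"
    unfolding d_def by (rule sum.reindex_bij_betw[OF h, of "\<lambda>b. q b b"])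
  finally show ?thesis using that[OF B(1,3,4)] by simp
qed

lemma det_gram_pos:
  fixes p :: "real^'n \<Rightarrow> real^'n \<Rightarrow> real"
  assumes p: "bilinear p" "\<And>x y. p x y = p y x" "\<And>x. x \<noteq> 0 \<Longrightarrow> p x x > 0"
  shows "det (\<chi> i j. p (axis i 1) (axis j 1)) > 0"
proof -
  obtain B where B: "finite B" "independent B" "span B = UNIV"
    "\<And>b c. b \<in> B \<Longrightarrow> c \<in> B \<Longrightarrow> p b c = (if b = c then 1 else 0)"
    using simultaneous_diagonalization[OF p p(1,2) subspace_UNIV] by metis
  have card: "card B = CARD('n)"
    using dim_eq_card[of B UNIV] B by simp
  obtain h where h: "bij_betw h (UNIV :: 'n set) B"
    using finite_same_card_bij[of "UNIV :: 'n set" B] B(1) card by auto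
  have hB: "h i \<in> B" and hinj: "h i = h j \<longleftrightarrow> i = j" for i j
    using h by (auto simp: bij_betw_def inj_on_def)
  have "det (\<chi> i j. p (h i) (h j)) = (\<Prod>i\<in>UNIV. (1::real))"
    by (subst det_diagonal) (auto simp: B(4) hB hinj)
  then have "(det (\<chi> k i. h i $ k))\<^sup>2 * det (\<chi> i j. p (axis i 1) (axis j 1)) = 1"
    by (simp add: det_gram[OF p(1), of h])
  then have "0 < (det (\<chi> k i. h i $ k))\<^sup>2 * det (\<chi> i j. p (axis i 1) (axis j 1))" by simp
  then show ?thesis by (simp add: zero_less_mult_iff)
qed

section \<open>Lie groups and the adjoint action\<close>

locale lie_grp =
  fixes G :: "'g::{t2_space,second_countable_topology} monoid" (structure)
    and A :: "('g, 'e::euclidean_space) chart set"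
  assumes lie_group: "lie_group G A"
begin

sublocale group G
  using lie_group by (simp add: lie_group_def)

lemma carrier_UNIV [simp]: "carrier G = UNIV"
  using lie_group by (simp add: lie_group_def)

lemma atlas: "smooth_atlas A"
  using lie_group by (simp add: lie_group_def)

lemma atlas2: "smooth_atlas (prod_atlas A A)"
  by (rule smooth_atlas_prod[OF atlas atlas])

lemma inv_mult_cancel [simp]: "inv x \<otimes> (x \<otimes> y) = y" "x \<otimes> (inv x \<otimes> y) = y"
  using m_assoc[of "inv x" x y] m_assoc[of x "inv x" y] by simp_all

lemma smooth_map_mult:
  assumes "smooth_atlas M" "smooth_map M A F" "smooth_map M A H"
  shows "smooth_map M A (\<lambda>x. F x \<otimes> H x)"
proof -
  have "smooth_map (prod_atlas A A) A (\<lambda>(x, y). x \<otimes> y)"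
    using lie_group by (simp add: lie_group_def)
  from smooth_map_compose[OF assms(1) atlas2 atlas smooth_map_Pair[OF assms(1) atlas atlas assms(2,3)] this]
  show ?thesis by simp
qed

lemma smooth_map_inv:
  assumes "smooth_atlas M" "smooth_map M A F"
  shows "smooth_map M A (\<lambda>x. inv (F x))"
  using smooth_map_compose[OF assms(1) atlas atlas assms(2)] lie_group by (simp add: lie_group_def)

lemma smooth_map_left: "smooth_map A A (\<lambda>y. x \<otimes> y)"
  by (intro smooth_map_mult smooth_map_const smooth_map_id atlas)

lemma smooth_map_right: "smooth_map A A (\<lambda>y. y \<otimes> x)"
  by (intro smooth_map_mult smooth_map_const smooth_map_id atlas)

lemma smooth_fun_right_regular: "smooth_fun A f \<Longrightarrow> smooth_fun A (right_regular G x f)"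
  unfolding right_regular_def by (rule smooth_fun_compose[OF atlas atlas smooth_map_right])

lemma smooth_fun_left: "smooth_fun A f \<Longrightarrow> smooth_fun A (\<lambda>y. f (x \<otimes> y))"
  by (rule smooth_fun_compose[OF atlas atlas smooth_map_left])

lemma push_forward_left:
  "X \<in> tangent_space A p \<Longrightarrow> push_forward (\<lambda>q. x \<otimes> q) X \<in> tangent_space A (x \<otimes> p)"
  by (rule push_forward_tangent[OF atlas smooth_map_left smooth_map_left[of "inv x"]]) simp_all

lemma push_forward_right:
  "X \<in> tangent_space A p \<Longrightarrow> push_forward (\<lambda>q. q \<otimes> x) X \<in> tangent_space A (p \<otimes> x)"
  by (rule push_forward_tangent[OF atlas smooth_map_right smooth_map_right[of "inv x"]]) (simp_all add: m_assoc)

definition Ad :: "'g \<Rightarrow> 'g tvec \<Rightarrow> 'g tvec" where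
  "Ad x X = push_forward (\<lambda>z. x \<otimes> z \<otimes> inv x) X"

lemma Ad_eq: "Ad x X = push_forward (\<lambda>q. q \<otimes> inv x) (push_forward (\<lambda>q. x \<otimes> q) X)"
  by (simp add: Ad_def push_forward_push_forward)

lemma Ad_in_lie_algebra: "X \<in> lie_algebra G A \<Longrightarrow> Ad x X \<in> lie_algebra G A"
  unfolding lie_algebra_def Ad_eq
  using push_forward_right[OF push_forward_left[of X \<one> x], of "inv x"] by simp

lemma rho_diff_eq: "rho_diff G X f y = X (\<lambda>x. f (y \<otimes> x))"
  by (simp add: rho_diff_def right_regular_def)

lemma smooth_fun_mult2: "smooth_fun A f \<Longrightarrow> smooth_fun (prod_atlas A A) (\<lambda>x. f (fst x \<otimes> snd x))"
  by (rule smooth_fun_compose[OF atlas2 atlas smooth_map_mult[OF atlas2 smooth_map_fst[OF atlas atlas]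
          smooth_map_snd[OF atlas atlas]]])

lemma smooth_fun_rho_diff:
  assumes "X \<in> lie_algebra G A" "smooth_fun A f"
  shows "smooth_fun A (rho_diff G X f)"
  using smooth_fun_partial_snd[OF atlas atlas smooth_fun_mult2[OF assms(2)]] assms(1)
  by (simp add: rho_diff_eq[abs_def] lie_algebra_def)

text \<open>The function \<open>f (x x\<^sup>-\<^sup>1)\<close> is constant, and its derivative at the identity
  is the sum of the derivatives in its two occurrences of \<open>x\<close>.\<close>

lemma tangent_vec_inv:
  assumes X: "X \<in> lie_algebra G A" and f: "smooth_fun A f"
  shows "X (\<lambda>x. f (inv x)) = - X f"
proof -
  have X': "X \<in> tangent_space A \<one>" using X by (simp add: lie_algebra_def)
  have "smooth_fun (prod_atlas A A) (\<lambda>x. f (fst x \<otimes> inv (snd x)))"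
    by (rule smooth_fun_compose[OF atlas2 atlas smooth_map_mult[OF atlas2 smooth_map_fst[OF atlas atlas]
          smooth_map_inv[OF atlas2 smooth_map_snd[OF atlas atlas]]] f])
  from tangent_vec_diagonal[OF atlas this X'] tangent_vec_const[OF atlas X'] show ?thesis
    by (simp add: eq_neg_iff_add_eq_0 add.commute)
qed

lemma smooth_fun_Ad:
  assumes Y: "Y \<in> lie_algebra G A" and f: "smooth_fun A f"
  shows "smooth_fun A (\<lambda>x. Ad x Y f)"
proof -
  have "smooth_fun (prod_atlas A A) (\<lambda>x. f (fst x \<otimes> snd x \<otimes> inv (fst x)))"
    by (rule smooth_fun_compose[OF atlas2 atlas _ f])
       (intro smooth_map_mult smooth_map_inv atlas2 smooth_map_fst smooth_map_snd atlas)
  from smooth_fun_partial_snd[OF atlas atlas this] Y show ?thesis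
    by (simp add: Ad_def push_forward_def o_def lie_algebra_def)
qed

text \<open>The bracket is the differential of the adjoint action. In \<open>f (x z x\<^sup>-\<^sup>1)\<close> the two occurrences of \<open>x\<close>
  are differentiated separately; the second one gives \<open>- Y (rho_diff G X f)\<close> because mixed partial
  derivatives commute and inversion has differential \<open>-1\<close> at the identity.\<close>

lemma lie_bracket_eq_Ad_derivative:
  assumes X: "X \<in> lie_algebra G A" and Y: "Y \<in> lie_algebra G A" and f: "smooth_fun A f"
  shows "lie_bracket G X Y f = X (\<lambda>x. Ad x Y f)"
proof -
  have X': "X \<in> tangent_space A \<one>" and Y': "Y \<in> tangent_space A \<one>"
    using X Y by (simp_all add: lie_algebra_def)
  have "smooth_fun (prod_atlas (prod_atlas A A) A) (\<lambda>c. f (fst (fst c) \<otimes> snd c \<otimes> inv (snd (fst c))))"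
    by (rule smooth_fun_compose[OF smooth_atlas_prod[OF atlas2 atlas] atlas _ f])
       (intro smooth_map_mult smooth_map_inv smooth_atlas_prod atlas smooth_map_snd
         smooth_map_compose[OF smooth_atlas_prod[OF atlas2 atlas] atlas2 atlas smooth_map_fst[OF atlas2 atlas]]
         smooth_map_fst)
  from smooth_fun_partial_snd[OF atlas2 atlas this Y']
  have H: "smooth_fun (prod_atlas A A) (\<lambda>c. Y (\<lambda>z. f (fst c \<otimes> z \<otimes> inv (snd c))))" by simp
  have F: "smooth_fun (prod_atlas A A) (\<lambda>c. f (snd c \<otimes> inv (fst c)))"
    by (rule smooth_fun_compose[OF atlas2 atlas _ f])
       (intro smooth_map_mult smooth_map_inv smooth_map_fst smooth_map_snd atlas2 atlas)
  have "X (\<lambda>x. Ad x Y f) = X (\<lambda>x. Y (\<lambda>z. f (x \<otimes> z \<otimes> inv x)))"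
    by (simp add: Ad_def push_forward_def o_def)
  also have "\<dots> = X (\<lambda>x. Y (\<lambda>z. f (x \<otimes> z))) + X (\<lambda>x. Y (\<lambda>z. f (z \<otimes> inv x)))"
    using tangent_vec_diagonal[OF atlas H X'] by simp
  also have "X (\<lambda>x. Y (\<lambda>z. f (z \<otimes> inv x))) = Y (\<lambda>z. X (\<lambda>x. f (z \<otimes> inv x)))"
    using mixed_partials_commute[OF atlas atlas F X' Y'] by simp
  also have "\<dots> = Y (\<lambda>z. - 1 * rho_diff G X f z)"
    using tangent_vec_inv[OF X smooth_fun_left[OF f]] by (simp add: rho_diff_eq)
  also have "\<dots> = - Y (rho_diff G X f)"
    using tangent_vec_mult[OF atlas Y' smooth_fun_rho_diff[OF X f], of "- 1"] by simp
  finally show ?thesis by (simp add: lie_bracket_def rho_diff_eq[abs_def])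
qed

lemma lie_bracket_not_smooth:
  assumes X: "X \<in> lie_algebra G A" and Y: "Y \<in> lie_algebra G A" and f: "\<not> smooth_fun A f"
  shows "lie_bracket G X Y f = 0"
proof -
  have *: "rho_diff G Z f = (\<lambda>_. 0)" if Z: "Z \<in> lie_algebra G A" for Z
  proof
    fix y
    have "\<not> smooth_fun A (\<lambda>x. f (y \<otimes> x))"
      using smooth_fun_left[of "\<lambda>x. f (y \<otimes> x)" "inv y"] f by auto
    then show "rho_diff G Z f y = 0"
      using Z tangent_vec_not_smooth by (auto simp: rho_diff_eq lie_algebra_def)
  qed
  have "X (\<lambda>_. 0) = 0" "Y (\<lambda>_. 0) = 0"
    using X Y by (auto simp: lie_algebra_def intro: tangent_vec_const[OF atlas])
  then show ?thesis using X Y by (simp add: lie_bracket_def *)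
qed

text \<open>A subspace of a finite dimensional space is closed, so it contains the derivatives of the curves that
  run in it, in particular those of the orbits of the adjoint action.\<close>

lemma lie_bracket_in_Ad_invariant:
  assumes E: "E \<subseteq> lie_algebra G A" "rfun.subspace E" and inv: "\<And>x Y. Y \<in> E \<Longrightarrow> Ad x Y \<in> E"
    and X: "X \<in> lie_algebra G A" and Y: "Y \<in> E"
  shows "lie_bracket G X Y \<in> E"
proof -
  obtain U \<phi> where U: "(U, \<phi>) \<in> A" "\<one> \<in> U" by (rule chart_exists[OF atlas])
  let ?c = "coord_vec A (U, \<phi>) \<one>"
  have X': "X \<in> tangent_space A \<one>" using X by (simp add: lie_algebra_def)
  have YL: "Y \<in> lie_algebra G A" using Y E by blast
  define E' where "E' = {v. ?c v \<in> E}"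
  have "subspace E'"
    using E(2) unfolding E'_def subspace_def rfun.subspace_def by (auto simp: coord_vec_linear[OF atlas U])
  have "\<exists>v. Ad x Y = ?c v" for x
    using tangent_space_chart[OF atlas _ U] Ad_in_lie_algebra[OF YL] unfolding lie_algebra_def by metis
  then obtain a where a: "\<And>x. Ad x Y = ?c (a x)" by metis
  have aE: "a x \<in> E'" for x using inv[OF Y, of x] by (simp add: a E'_def)
  \<comment> \<open>The coordinates of the orbit are smooth, because functions realising the linear
    functionals read them off.\<close>
  have dual: "smooth_fun A (\<lambda>x. complex_of_real (a x \<bullet> u))" for u
  proof -
    obtain f where f: "smooth_fun A f" "\<And>w. ?c w f = of_real (w \<bullet> u)"
      using linear_functional_realised[OF atlas U, of u] by blast
    show ?thesis using smooth_fun_Ad[OF YL f(1)] by (simp add: a f(2))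
  qed
  define w where "w = (\<Sum>b\<in>Basis. Re (X (\<lambda>x. complex_of_real (a x \<bullet> b))) *\<^sub>R b)"
  have wb: "of_real (w \<bullet> b) = X (\<lambda>x. complex_of_real (a x \<bullet> b))" if "b \<in> Basis" for b
    using that tangent_vec_real[OF atlas X' dual[of b]] by (simp add: w_def complex_eq_iff)
  have Xc: "X (\<lambda>x. ?c (a x) f) = ?c w f" for f
  proof -
    have cv: "?c v f = (\<Sum>b\<in>Basis. ?c b f * of_real (v \<bullet> b))" for v
      using coord_vec_sum[OF atlas U, of "\<lambda>b. v \<bullet> b" "\<lambda>b. b" Basis]
      by (simp add: euclidean_representation fun_eq_iff mult.commute)
    have "X (\<lambda>x. ?c (a x) f) = X (\<lambda>x. \<Sum>b\<in>Basis. ?c b f * of_real (a x \<bullet> b))"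
      using cv[of "a _"] by presburger
    also have "\<dots> = (\<Sum>b\<in>Basis. X (\<lambda>x. ?c b f * of_real (a x \<bullet> b)))"
      by (intro tangent_vec_sum[OF atlas X'] smooth_fun_mult_const[OF atlas] dual)
    also have "\<dots> = (\<Sum>b\<in>Basis. ?c b f * of_real (w \<bullet> b))"
      using tangent_vec_mult[OF atlas X' dual] wb by simp
    finally show ?thesis by (simp add: cv[of w])
  qed
  have br: "lie_bracket G X Y = ?c w"
  proof
    fix f show "lie_bracket G X Y f = ?c w f"
    proof (cases "smooth_fun A f")
      case True
      then show ?thesis by (simp add: lie_bracket_eq_Ad_derivative[OF X YL True] a Xc)
    next
      case False
      then show ?thesis by (simp add: lie_bracket_not_smooth[OF X YL False] coord_vec_not_smooth)
    qed
  qed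
  \<comment> \<open>The component \<open>z\<close> of \<open>w\<close> orthogonal to \<open>E'\<close> is zero: the functional \<open>\<bullet> z\<close> vanishes along the
    orbit of \<open>Y\<close>, hence so does its derivative, which is \<open>w \<bullet> z\<close>.\<close>
  obtain y z where yz: "y \<in> span E'" "\<And>u. u \<in> span E' \<Longrightarrow> orthogonal z u" "w = y + z"
    using orthogonal_subspace_decomp_exists[of E' w] by blast
  obtain f where f: "smooth_fun A f" "\<And>v. ?c v f = of_real (v \<bullet> z)"
    using linear_functional_realised[OF atlas U, of z] by blast
  have "of_real (w \<bullet> z) = X (\<lambda>x. complex_of_real (a x \<bullet> z))"
    using Xc[of f] by (simp add: f(2))
  also have "\<dots> = 0"
    using yz(2)[OF span_base[OF aE]] tangent_vec_const[OF atlas X', of 0]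
    by (simp add: orthogonal_def inner_commute)
  finally have "w \<bullet> z = 0" by simp
  moreover have "y \<bullet> z = 0" using yz(2)[OF yz(1)] by (simp add: orthogonal_def inner_commute)
  ultimately have "z \<bullet> z = 0" by (simp add: yz(3) inner_add_left)
  then have "w \<in> E'" using yz(1,3) \<open>subspace E'\<close> by (simp add: span_eq_iff[THEN iffD2])
  then show ?thesis by (simp add: br E'_def)
qed

end

section \<open>Traces on finite dimensional function spaces\<close>

definition finite_dim :: "('a \<Rightarrow> complex) set \<Rightarrow> bool" where
  "finite_dim W \<longleftrightarrow> (\<exists>B. finite B \<and> cfun.independent B \<and> cfun.span B = W)"

definition endo_on :: "('a \<Rightarrow> complex) set \<Rightarrow> (('a \<Rightarrow> complex) \<Rightarrow> 'a \<Rightarrow> complex) \<Rightarrow> bool" where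
  "endo_on W T \<longleftrightarrow> (\<forall>f\<in>W. T f \<in> W) \<and> (\<forall>f\<in>W. \<forall>h\<in>W. T (f + h) = T f + T h) \<and>
     (\<forall>c. \<forall>f\<in>W. T (\<lambda>x. c * f x) = (\<lambda>x. c * T f x))"

lemma endo_onI:
  assumes "\<And>f. f \<in> W \<Longrightarrow> T f \<in> W" "\<And>f h. f \<in> W \<Longrightarrow> h \<in> W \<Longrightarrow> T (f + h) = T f + T h"
    "\<And>c f. f \<in> W \<Longrightarrow> T (\<lambda>x. c * f x) = (\<lambda>x. c * T f x)"
  shows "endo_on W T"
  using assms by (simp add: endo_on_def)

lemma endo_onD:
  assumes "endo_on W T"
  shows "f \<in> W \<Longrightarrow> T f \<in> W" "f \<in> W \<Longrightarrow> h \<in> W \<Longrightarrow> T (f + h) = T f + T h"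
    "f \<in> W \<Longrightarrow> T (\<lambda>x. c * f x) = (\<lambda>x. c * T f x)"
  using assms by (simp_all add: endo_on_def)

lemma endo_on_compose: "endo_on W S \<Longrightarrow> endo_on W T \<Longrightarrow> endo_on W (\<lambda>f. S (T f))"
  by (simp add: endo_on_def)

lemma trace_on_basis:
  assumes "finite_dim W"
  obtains B where "finite B" "cfun.independent B" "cfun.span B = W"
    "\<And>T. trace_on W T = (\<Sum>b\<in>B. cfun.representation B (T b) b)"
proof -
  let ?B = "SOME B. finite B \<and> cfun.independent B \<and> cfun.span B = W"
  have "finite ?B \<and> cfun.independent ?B \<and> cfun.span ?B = W"
    using someI_ex[OF assms[unfolded finite_dim_def]] .
  then show ?thesis using that[of ?B] by (simp add: trace_on_def Let_def)
qed

lemma finite_dim_subspace: "finite_dim W \<Longrightarrow> cfun.subspace W"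
  unfolding finite_dim_def using cfun.subspace_span by blast

lemma representation_endo_on:
  assumes B: "finite B" "cfun.independent B" and S: "endo_on (cfun.span B) S" and f: "f \<in> cfun.span B"
  shows "cfun.representation B (S f) b = (\<Sum>b'\<in>B. cfun.representation B f b' * cfun.representation B (S b') b)"
proof -
  have *: "(\<Sum>b'\<in>F. (\<lambda>x. c b' * b' x)) \<in> cfun.span B \<and> cfun.representation B (S (\<Sum>b'\<in>F. (\<lambda>x. c b' * b' x))) b =
      (\<Sum>b'\<in>F. c b' * cfun.representation B (S b') b)" if "F \<subseteq> B" "finite F" for F and c :: "('a \<Rightarrow> complex) \<Rightarrow> complex"
    using that(2,1)
  proof (induction F rule: finite_induct)
    case empty
    have "S (\<lambda>x. 0 * f x) = (\<lambda>x. 0 * S f x)" by (rule endo_onD(3)[OF S f])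
    then have "S 0 = 0" by (simp add: zero_fun_def)
    then show ?case
      unfolding sum.empty by (intro conjI cfun.span_zero) (simp only: cfun.representation_zero)
  next
    case (insert a F)
    let ?s = "\<Sum>b'\<in>F. (\<lambda>x. c b' * b' x)"
    have a: "a \<in> cfun.span B" using insert.prems by (auto intro: cfun.span_base)
    have ca: "(\<lambda>x. c a * a x) \<in> cfun.span B" by (rule cfun.span_scale[OF a])
    have s: "?s \<in> cfun.span B" using insert by auto
    have eq: "S ((\<lambda>x. c a * a x) + ?s) = (\<lambda>x. c a * S a x) + S ?s"
      by (simp add: endo_onD(2)[OF S ca s] endo_onD(3)[OF S a])
    have IH: "cfun.representation B (S ?s) b = (\<Sum>b'\<in>F. c b' * cfun.representation B (S b') b)"
      using insert by auto
    have r: "cfun.representation B ((\<lambda>x. c a * S a x) + S ?s) b =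
        c a * cfun.representation B (S a) b + cfun.representation B (S ?s) b"
      unfolding cfun.representation_add[OF B(2) endo_onD(1)[OF S s] cfun.span_scale[OF endo_onD(1)[OF S a]]]
        cfun.representation_scale[OF B(2) endo_onD(1)[OF S a]] ..
    show ?case
      unfolding sum.insert[OF insert.hyps] eq r IH using cfun.span_add[OF ca s] by blast
  qed
  have "(\<Sum>b'\<in>B. (\<lambda>x. cfun.representation B f b' * b' x)) = f"
    by (rule cfun.sum_representation_eq[OF B(2) f B(1)]) simp
  with *[of B "cfun.representation B f"] B(1) show ?thesis by simp
qed

text \<open>In the matrices of \<open>S\<close> and \<open>T\<close> both sides are the same double sum.\<close>

lemma trace_on_commute:
  assumes W: "finite_dim W" and S: "endo_on W S" and T: "endo_on W T"
  shows "trace_on W (\<lambda>f. S (T f)) = trace_on W (\<lambda>f. T (S f))"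
proof -
  obtain B where B: "finite B" "cfun.independent B" "cfun.span B = W"
    and tr: "\<And>T. trace_on W T = (\<Sum>b\<in>B. cfun.representation B (T b) b)"
    using trace_on_basis[OF W] by blast
  have BW: "b \<in> W" if "b \<in> B" for b using that B(3) cfun.span_base by blast
  have *: "trace_on W (\<lambda>f. S (T f)) =
      (\<Sum>b\<in>B. \<Sum>b'\<in>B. cfun.representation B (T b) b' * cfun.representation B (S b') b)"
    if S: "endo_on W S" and T: "endo_on W T" for S T
    unfolding tr
    by (rule sum.cong[OF refl], rule representation_endo_on[OF B(1,2)])
       (use S T BW B(3) in \<open>auto intro: endo_onD\<close>)
  show ?thesis
    unfolding *[OF S T] *[OF T S] by (subst sum.swap) (simp add: mult.commute)
qed

lemma
  assumes W: "finite_dim W" and T: "\<And>f. f \<in> W \<Longrightarrow> T f \<in> W"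
  shows trace_on_add: "(\<And>f. f \<in> W \<Longrightarrow> S f \<in> W) \<Longrightarrow> trace_on W (\<lambda>f. S f + T f) = trace_on W S + trace_on W T"
    and trace_on_mult: "trace_on W (\<lambda>f x. c * T f x) = c * trace_on W T"
proof -
  obtain B where B: "finite B" "cfun.independent B" "cfun.span B = W"
    and tr: "\<And>T. trace_on W T = (\<Sum>b\<in>B. cfun.representation B (T b) b)"
    using trace_on_basis[OF W] by blast
  have BW: "b \<in> W" if "b \<in> B" for b using that B(3) cfun.span_base by blast
  show "trace_on W (\<lambda>f. S f + T f) = trace_on W S + trace_on W T" if S: "\<And>f. f \<in> W \<Longrightarrow> S f \<in> W"
    unfolding tr sum.distrib[symmetric]
  proof (rule sum.cong[OF refl])
    fix b assume "b \<in> B"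
    then show "cfun.representation B (S b + T b) b = cfun.representation B (S b) b + cfun.representation B (T b) b"
      using cfun.representation_add[OF B(2), of "T b" "S b"] S T BW B(3) by (simp add: add.commute)
  qed
  show "trace_on W (\<lambda>f x. c * T f x) = c * trace_on W T"
    unfolding tr sum_distrib_left
  proof (rule sum.cong[OF refl])
    fix b assume "b \<in> B"
    then show "cfun.representation B (\<lambda>x. c * T b x) b = c * cfun.representation B (T b) b"
      using cfun.representation_scale[OF B(2), of "T b" c] T BW B(3) by simp
  qed
qed

lemma trace_on_sum:
  assumes W: "finite_dim W" and T: "\<And>i f. i \<in> I \<Longrightarrow> f \<in> W \<Longrightarrow> T i f \<in> W"
  shows "trace_on W (\<lambda>f. \<Sum>i\<in>I. T i f) = (\<Sum>i\<in>I. trace_on W (T i))"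
proof -
  note sub = finite_dim_subspace[OF W]
  have 0: "trace_on W (\<lambda>f. 0) = 0"
    using trace_on_mult[OF W, of "\<lambda>f. 0" 0] cfun.subspace_0[OF sub] by (simp add: zero_fun_def)
  show ?thesis using T
  proof (induction I rule: infinite_finite_induct)
    case (insert i I)
    have "trace_on W (\<lambda>f. T i f + (\<Sum>i\<in>I. T i f)) = trace_on W (T i) + trace_on W (\<lambda>f. \<Sum>i\<in>I. T i f)"
      by (rule trace_on_add[OF W]) (use insert.prems in \<open>auto intro!: cfun.subspace_sum[OF sub]\<close>)
    moreover have "trace_on W (\<lambda>f. \<Sum>i\<in>I. T i f) = (\<Sum>i\<in>I. trace_on W (T i))"
      by (rule insert.IH) (use insert.prems in blast)
    ultimately show ?case unfolding sum.insert[OF insert.hyps] by (simp only:)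
  qed (simp_all only: sum.infinite sum.empty 0 not_False_eq_True if_True)
qed

section \<open>Evaluations separate functions from finite dimensional spaces\<close>

text \<open>The finite linear combinations of point evaluations. In this inductive form it is immediate that
  they commute with differentiation with respect to a parameter.\<close>

inductive evaluation_comb :: "(('a \<Rightarrow> complex) \<Rightarrow> complex) \<Rightarrow> bool" where
  evaluation: "evaluation_comb (\<lambda>f. f y)"
| add: "evaluation_comb l \<Longrightarrow> evaluation_comb m \<Longrightarrow> evaluation_comb (\<lambda>f. l f + m f)"
| mult: "evaluation_comb l \<Longrightarrow> evaluation_comb (\<lambda>f. c * l f)"

lemma evaluation_comb_linear:
  assumes "evaluation_comb l"
  shows "l (f + h) = l f + l h" "l (\<lambda>x. c * f x) = c * l f"
  using assms by (induction rule: evaluation_comb.induct) (auto simp: algebra_simps)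

lemma evaluation_comb_zero_span:
  assumes "evaluation_comb l" "\<And>b. b \<in> B \<Longrightarrow> l b = 0" "f \<in> cfun.span B"
  shows "l f = 0"
  using assms(3)
proof (induction rule: cfun.span_induct_alt)
  case base
  show ?case using evaluation_comb_linear(2)[OF assms(1), of 0 0] by (simp add: zero_fun_def)
next
  case (step c x y)
  then show ?case unfolding evaluation_comb_linear[OF assms(1)] by (simp add: assms(2))
qed

text \<open>In the induction step with \<open>a\<close> outside the span of \<open>B\<close>, a functional
  \<open>la\<close> detects \<open>a\<close>. Subtracting from \<open>f\<close> a multiple of
  \<open>a\<close> that makes \<open>la\<close> vanish gives \<open>f'\<close>, still outside the span
  of \<open>B\<close>; a functional for \<open>f'\<close> is then corrected by a multiple of
  \<open>la\<close> to vanish at \<open>a\<close>.\<close>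

lemma evaluation_comb_separates:
  assumes "finite B" "f \<notin> cfun.span B"
  shows "\<exists>l. evaluation_comb l \<and> (\<forall>b\<in>B. l b = 0) \<and> l f \<noteq> 0"
  using assms
proof (induction B arbitrary: f rule: finite_induct)
  case empty
  then obtain y where "f y \<noteq> 0" by (auto simp: cfun.span_empty fun_eq_iff)
  then show ?case using evaluation_comb.evaluation[of y] by auto
next
  case (insert a B)
  show ?case
  proof (cases "a \<in> cfun.span B")
    case True
    then have "f \<notin> cfun.span B" using insert.prems by (simp add: cfun.span_redundant)
    from insert.IH[OF this] obtain l where "evaluation_comb l" "\<forall>b\<in>B. l b = 0" "l f \<noteq> 0" by blast
    with evaluation_comb_zero_span[of l B a] True show ?thesis by auto
  next
    case False
    from insert.IH[OF this] obtain la where la: "evaluation_comb la" "\<forall>b\<in>B. la b = 0" "la a \<noteq> 0" by blast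
    define c where "c = la f / la a"
    define f' where "f' = f + (\<lambda>x. - c * a x)"
    have "f' \<notin> cfun.span B"
    proof
      assume "f' \<in> cfun.span B"
      then have "f - (\<lambda>x. c * a x) \<in> cfun.span B"
        by (simp add: f'_def fun_diff_def plus_fun_def)
      then have "f \<in> cfun.span (insert a B)" unfolding cfun.span_insert by blast
      then show False using insert.prems by blast
    qed
    from insert.IH[OF this] obtain l1 where l1: "evaluation_comb l1" "\<forall>b\<in>B. l1 b = 0" "l1 f' \<noteq> 0" by blast
    let ?l = "\<lambda>f. l1 f + (- l1 a / la a) * la f"
    have "evaluation_comb ?l" by (intro evaluation_comb.intros l1 la)
    moreover have "\<forall>b\<in>insert a B. ?l b = 0" using l1 la by auto
    moreover have "?l f = l1 f'"
      unfolding f'_def evaluation_comb_linear[OF l1(1)] by (simp add: c_def)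
    ultimately show ?thesis using l1(3) by (intro exI[of _ ?l] conjI) simp_all
  qed
qed

section \<open>Invariant forms on the Lie algebra\<close>

lemma riemannian_metricD:
  assumes "riemannian_metric A g" "X \<in> tangent_space A p" "Y \<in> tangent_space A p"
  shows "Z \<in> tangent_space A p \<Longrightarrow> g p (X + Y) Z = g p X Z + g p Y Z"
    and "g p (\<lambda>f. of_real r * X f) Y = r * g p X Y"
    and "g p X Y = g p Y X"
    and "X \<noteq> 0 \<Longrightarrow> g p X X > 0"
proof -
  note m = assms(1)[unfolded riemannian_metric_def, THEN conjunct2]
  note * = m[THEN conjunct1] m[THEN conjunct2, THEN conjunct1] m[THEN conjunct2, THEN conjunct2, THEN conjunct1]
  show "Z \<in> tangent_space A p \<Longrightarrow> g p (X + Y) Z = g p X Z + g p Y Z"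
    and "g p (\<lambda>f. of_real r * X f) Y = r * g p X Y"
    and "g p X Y = g p Y X"
    and "X \<noteq> 0 \<Longrightarrow> g p X X > 0"
    using * assms(2,3) by simp_all
qed

lemma metric_coord_form:
  assumes A: "smooth_atlas A" and g: "riemannian_metric A g" and U: "(U, \<phi>) \<in> A" "p \<in> U"
  defines "k \<equiv> \<lambda>v w. g p (coord_vec A (U, \<phi>) p v) (coord_vec A (U, \<phi>) p w)"
  shows "bilinear k" "k v w = k w v" "v \<noteq> 0 \<Longrightarrow> k v v > 0"
proof -
  note c = coord_vec_in_tangent_space[OF U]
  have sym: "k v w = k w v" for v w unfolding k_def by (rule riemannian_metricD(3)[OF g c c])
  then show "k v w = k w v" .
  have "linear (\<lambda>v. k v w)" for w
    unfolding k_def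
    by (rule linearI)
       (simp_all add: coord_vec_linear[OF A U] riemannian_metricD(1)[OF g c c c] riemannian_metricD(2)[OF g c c])
  moreover have "(\<lambda>w. k v w) = (\<lambda>w. k w v)" for v using sym by blast
  ultimately show "bilinear k" unfolding bilinear_def by metis
  show "k v v > 0" if "v \<noteq> 0"
    unfolding k_def using riemannian_metricD(4)[OF g c c] that coord_vec_eq_0_iff[OF A U] by blast
qed

context lie_grp
begin

text \<open>Linearity in the second argument follows from symmetry. The conditions concern the Lie algebra only,
  since a metric vanishes outside the tangent spaces and is not additive on all of the ambient
  function space.\<close>

definition sym_form :: "('g tvec \<Rightarrow> 'g tvec \<Rightarrow> real) \<Rightarrow> bool" where
  "sym_form k \<longleftrightarrow> (\<forall>X\<in>lie_algebra G A. \<forall>Y\<in>lie_algebra G A. k X Y = k Y X \<and>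
     (\<forall>Z\<in>lie_algebra G A. k (X + Z) Y = k X Y + k Z Y) \<and>
     (\<forall>r. k (\<lambda>f. of_real r * X f) Y = r * k X Y))"

lemma sym_formD:
  assumes "sym_form k" "X \<in> lie_algebra G A" "Y \<in> lie_algebra G A"
  shows "k X Y = k Y X" "Z \<in> lie_algebra G A \<Longrightarrow> k (X + Z) Y = k X Y + k Z Y"
    "k (\<lambda>f. of_real r * X f) Y = r * k X Y"
  using assms unfolding sym_form_def by blast+

lemma sym_form_metric:
  assumes g: "riemannian_metric A g"
  shows "sym_form (g \<one>)"
  unfolding sym_form_def lie_algebra_def
proof (intro ballI conjI allI)
  fix X Y assume XY: "X \<in> tangent_space A \<one>" "Y \<in> tangent_space A \<one>"
  show "g \<one> X Y = g \<one> Y X" by (rule riemannian_metricD(3)[OF g XY])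
  show "g \<one> (X + Z) Y = g \<one> X Y + g \<one> Z Y" if Z: "Z \<in> tangent_space A \<one>" for Z
    by (rule riemannian_metricD(1)[OF g XY(1) Z XY(2)])
  show "g \<one> (\<lambda>f. of_real r * X f) Y = r * g \<one> X Y" for r
    by (rule riemannian_metricD(2)[OF g XY])
qed

lemma lie_algebra_subspace: "rfun.subspace (lie_algebra G A)"
  unfolding lie_algebra_def by (rule tangent_space_subspace[OF atlas])

lemma sym_form_zero:
  assumes "sym_form k" "Y \<in> lie_algebra G A"
  shows "k 0 Y = 0"
  using sym_formD(3)[OF assms(1) assms(2,2), of 0]  by (simp add: zero_fun_def)

lemma sym_form_bilinear:
  assumes k: "sym_form k" and U: "(U, \<phi>) \<in> A" "\<one> \<in> U"
  shows "bilinear (\<lambda>v w. k (coord_vec A (U, \<phi>) \<one> v) (coord_vec A (U, \<phi>) \<one> w))"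
proof -
  let ?c = "coord_vec A (U, \<phi>) \<one>"
  have c: "?c v \<in> lie_algebra G A" for v
    unfolding lie_algebra_def by (rule coord_vec_in_tangent_space[OF U])
  have "linear (\<lambda>v. k (?c v) (?c w))" for w
    by (rule linearI) (simp_all add: coord_vec_linear[OF atlas U] sym_formD[OF k] c)
  moreover have "(\<lambda>w. k (?c v) (?c w)) = (\<lambda>w. k (?c w) (?c v))" for v
    using sym_formD(1)[OF k c c] by blast
  ultimately show ?thesis unfolding bilinear_def by metis
qed

lemma coord_vec_one_cases:
  assumes "X \<in> lie_algebra G A" "(U, \<phi>) \<in> A" "\<one> \<in> U"
  obtains v where "X = coord_vec A (U, \<phi>) \<one> v"
  using assms tangent_space_chart[OF atlas] unfolding lie_algebra_def by metis

text \<open>\<open>Ad x\<close> is the differential of the left translation by \<open>x\<close> followed by the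
  right translation by \<open>inv x\<close>, and the metric is preserved by both.\<close>

lemma Ad_invariant:
  assumes g: "bi_invariant G A g" and X: "X \<in> lie_algebra G A" and Y: "Y \<in> lie_algebra G A"
  shows "g \<one> (Ad x X) (Ad x Y) = g \<one> X Y"
proof -
  let ?L = "\<lambda>q. x \<otimes> q"
  have X': "X \<in> tangent_space A \<one>" and Y': "Y \<in> tangent_space A \<one>"
    using X Y by (simp_all add: lie_algebra_def)
  have "g \<one> (Ad x X) (Ad x Y) = g (x \<otimes> \<one> \<otimes> inv x) (Ad x X) (Ad x Y)" by simp
  also have "\<dots> = g (x \<otimes> \<one>) (push_forward ?L X) (push_forward ?L Y)"
    unfolding Ad_eq
    using g push_forward_left[OF X', of x] push_forward_left[OF Y', of x]
    unfolding bi_invariant_def right_invariant_def by blast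
  also have "\<dots> = g \<one> X Y"
    using g X' Y' unfolding bi_invariant_def left_invariant_def by blast
  finally show ?thesis .
qed

lemma Ad_Ad_inv [simp]: "Ad x (Ad (inv x) X) = X"
  by (simp add: Ad_def push_forward_push_forward m_assoc) (simp add: push_forward_def o_def)

text \<open>The eigenspace of one invariant form relative to another is invariant under the adjoint
  action, hence an ideal.\<close>

lemma invariant_form_unique:
  assumes simple: "simple_lie_group G A"
    and h: "sym_form h" "\<And>X. X \<in> lie_algebra G A \<Longrightarrow> X \<noteq> 0 \<Longrightarrow> h X X > 0"
      "\<And>x X Y. X \<in> lie_algebra G A \<Longrightarrow> Y \<in> lie_algebra G A \<Longrightarrow> h (Ad x X) (Ad x Y) = h X Y"
    and k: "sym_form k"
      "\<And>x X Y. X \<in> lie_algebra G A \<Longrightarrow> Y \<in> lie_algebra G A \<Longrightarrow> k (Ad x X) (Ad x Y) = k X Y"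
  shows "\<exists>l. \<forall>X\<in>lie_algebra G A. \<forall>Y\<in>lie_algebra G A. k X Y = l * h X Y"
proof -
  obtain U \<phi> where U: "(U, \<phi>) \<in> A" "\<one> \<in> U" by (rule chart_exists[OF atlas])
  let ?c = "coord_vec A (U, \<phi>) \<one>" and ?L = "lie_algebra G A"
  have c: "?c v \<in> ?L" for v
    unfolding lie_algebra_def by (rule coord_vec_in_tangent_space[OF U])
  obtain b :: 'e where b: "b \<in> Basis" using nonempty_Basis by blast
  have "(UNIV :: 'e set) \<noteq> {0}" using nonzero_Basis[OF b] by blast
  moreover have "h (?c v) (?c v) > 0" if "v \<noteq> 0" for v
    using h(2)[OF c] that coord_vec_eq_0_iff[OF atlas U] by blast
  ultimately obtain v l where v: "v \<noteq> 0" "\<And>w. k (?c v) (?c w) = l * h (?c v) (?c w)"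
    using exists_relative_eigenvector[OF sym_form_bilinear[OF h(1) U] sym_formD(1)[OF h(1) c c] _
        sym_form_bilinear[OF k(1) U] sym_formD(1)[OF k(1) c c] subspace_UNIV]
    by (metis UNIV_I)
  define E where "E = {X \<in> ?L. \<forall>Y\<in>?L. k X Y = l * h X Y}"
  have sub: "rfun.subspace E"
  proof (rule rfun.subspaceI)
    show "0 \<in> E"
      using rfun.subspace_0[OF lie_algebra_subspace] sym_form_zero[OF h(1)] sym_form_zero[OF k(1)]
      by (simp add: E_def)
    fix X Y assume X: "X \<in> E"
    then show "(\<lambda>f. of_real r * X f) \<in> E" for r
      using rfun.subspace_scale[OF lie_algebra_subspace]
      by (simp add: E_def sym_formD(3)[OF h(1)] sym_formD(3)[OF k(1)])
    assume "Y \<in> E"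
    with X show "X + Y \<in> E"
      using rfun.subspace_add[OF lie_algebra_subspace, of X Y]
        sym_formD(2)[OF h(1), of X _ Y] sym_formD(2)[OF k(1), of X _ Y]
      unfolding E_def mem_Collect_eq by (metis distrib_left)
  qed
  have inv: "Ad x X \<in> E" if X: "X \<in> E" for x X
  proof -
    have XL: "X \<in> ?L" using X by (simp add: E_def)
    have "k (Ad x X) Y = l * h (Ad x X) Y" if Y: "Y \<in> ?L" for Y
    proof -
      have Y': "Ad (inv x) Y \<in> ?L" by (rule Ad_in_lie_algebra[OF Y])
      have "k (Ad x X) (Ad x (Ad (inv x) Y)) = l * h (Ad x X) (Ad x (Ad (inv x) Y))"
        unfolding h(3)[OF XL Y'] k(2)[OF XL Y'] using X Y' by (simp add: E_def)
      then show ?thesis by simp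
    qed
    then show ?thesis using Ad_in_lie_algebra[OF XL] by (simp add: E_def)
  qed
  have EL: "E \<subseteq> ?L" by (auto simp: E_def)
  have "lie_ideal G A E"
    unfolding lie_ideal_def using EL sub lie_bracket_in_Ad_invariant[OF EL sub inv] by blast
  then have "E = {0} \<or> E = ?L" using simple by (simp add: simple_lie_group_def)
  moreover have "?c v \<in> E" using v(2) c coord_vec_one_cases[OF _ U] unfolding E_def by blast
  moreover have "?c v \<noteq> 0" using v(1) coord_vec_eq_0_iff[OF atlas U] by blast
  ultimately have "E = ?L" by blast
  then show ?thesis unfolding E_def by blast
qed

section \<open>Orthonormal bases of the Lie algebra\<close>

lemma span_coord_vec_image:
  assumes U: "(U, \<phi>) \<in> A" "\<one> \<in> U" and B: "span B = UNIV"
  shows "rfun.span (coord_vec A (U, \<phi>) \<one> ` B) = lie_algebra G A"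
proof
  let ?c = "coord_vec A (U, \<phi>) \<one>"
  show "rfun.span (?c ` B) \<subseteq> lie_algebra G A"
    using coord_vec_in_tangent_space[OF U]
    by (intro rfun.span_minimal lie_algebra_subspace) (auto simp: lie_algebra_def)
  have "subspace {v. ?c v \<in> rfun.span (?c ` B)}"
    unfolding subspace_def
    by (auto simp: coord_vec_linear[OF atlas U] intro: rfun.span_zero rfun.span_add rfun.span_scale)
  then have "span B \<subseteq> {v. ?c v \<in> rfun.span (?c ` B)}"
    by (intro span_minimal) (auto intro: rfun.span_base)
  then show "lie_algebra G A \<subseteq> rfun.span (?c ` B)"
    unfolding B using coord_vec_one_cases[OF _ U] by blast
qed

lemma orthonormal_basis_coord_vec_image:
  assumes U: "(U, \<phi>) \<in> A" "\<one> \<in> U" and B: "finite B" "span B = UNIV"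
    and on: "\<And>b c. b \<in> B \<Longrightarrow> c \<in> B \<Longrightarrow>
      g \<one> (coord_vec A (U, \<phi>) \<one> b) (coord_vec A (U, \<phi>) \<one> c) = (if b = c then 1 else 0)"
  shows "orthonormal_basis G A g (coord_vec A (U, \<phi>) \<one> ` B)" "inj_on (coord_vec A (U, \<phi>) \<one>) B"
proof -
  let ?c = "coord_vec A (U, \<phi>) \<one>"
  show "inj_on ?c B"
  proof (rule inj_onI)
    fix b d assume "b \<in> B" "d \<in> B" "?c b = ?c d"
    then show "b = d" using on[of b d] on[of b b] by (metis zero_neq_one)
  qed
  then show "orthonormal_basis G A g (?c ` B)"
    unfolding orthonormal_basis_def
    using B span_coord_vec_image[OF U B(2)] coord_vec_in_tangent_space[OF U]
    by (auto simp: lie_algebra_def on inj_on_eq_iff)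
qed

lemma orthonormal_basis_exists:
  assumes g: "riemannian_metric A g"
  obtains B where "orthonormal_basis G A g B" "card B = DIM('e)"
proof -
  obtain U \<phi> where U: "(U, \<phi>) \<in> A" "\<one> \<in> U" by (rule chart_exists[OF atlas])
  let ?c = "coord_vec A (U, \<phi>) \<one>"
  note p = metric_coord_form[OF atlas g U]
  obtain B where B: "finite B" "independent B" "span B = UNIV"
    "\<And>b d. b \<in> B \<Longrightarrow> d \<in> B \<Longrightarrow> g \<one> (?c b) (?c d) = (if b = d then 1 else 0)"
    using simultaneous_diagonalization[OF p p(1,2) subspace_UNIV] by metis
  note on = orthonormal_basis_coord_vec_image[OF U B(1,3), of g, OF B(4)]
  have "card (?c ` B) = DIM('e)"
    using dim_eq_card[of B UNIV] B card_image[OF on(2)] by simp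
  then show ?thesis using that on(1) by blast
qed

text \<open>Both sides are linear in \<open>X\<close> and agree on \<open>D\<close>.\<close>

lemma orthonormal_expansion:
  assumes g: "riemannian_metric A g" and D: "orthonormal_basis G A g D" and k: "sym_form k"
    and X: "X \<in> lie_algebra G A" and Y: "Y \<in> lie_algebra G A"
  shows "k X Y = (\<Sum>Z\<in>D. g \<one> X Z * k Z Y)"
proof -
  let ?L = "lie_algebra G A"
  note gf = sym_form_metric[OF g]
  have D': "finite D" "D \<subseteq> ?L" "rfun.span D = ?L"
    "\<And>X Y. X \<in> D \<Longrightarrow> Y \<in> D \<Longrightarrow> g \<one> X Y = (if X = Y then 1 else 0)"
    using D unfolding orthonormal_basis_def by auto
  let ?S = "{X \<in> ?L. k X Y = (\<Sum>Z\<in>D. g \<one> X Z * k Z Y)}"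
  have "rfun.subspace ?S"
  proof (rule rfun.subspaceI)
    show "0 \<in> ?S"
      using rfun.subspace_0[OF lie_algebra_subspace] D'(2)
      by (auto simp: sym_form_zero[OF k Y] sym_form_zero[OF gf] subset_iff intro!: sum.neutral[symmetric])
    fix V W assume V: "V \<in> ?S"
    have "(\<lambda>f. of_real r * V f) \<in> ?L" for r
      using V rfun.subspace_scale[OF lie_algebra_subspace] by blast
    moreover have "(\<Sum>Z\<in>D. g \<one> (\<lambda>f. of_real r * V f) Z * k Z Y) = r * (\<Sum>Z\<in>D. g \<one> V Z * k Z Y)" for r
      unfolding sum_distrib_left
      by (rule sum.cong) (use V D'(2) in \<open>auto simp: sym_formD(3)[OF gf] subset_iff\<close>)
    ultimately show "(\<lambda>f. of_real r * V f) \<in> ?S" for r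
      using V sym_formD(3)[OF k _ Y] by simp
    assume W: "W \<in> ?S"
    have "(\<Sum>Z\<in>D. g \<one> (V + W) Z * k Z Y) = (\<Sum>Z\<in>D. g \<one> V Z * k Z Y) + (\<Sum>Z\<in>D. g \<one> W Z * k Z Y)"
      unfolding sum.distrib[symmetric]
      by (rule sum.cong) (use V W D'(2) in \<open>auto simp: sym_formD(2)[OF gf] subset_iff distrib_right\<close>)
    then show "V + W \<in> ?S"
      using V W rfun.subspace_add[OF lie_algebra_subspace] sym_formD(2)[OF k _ Y] by simp
  qed
  moreover have "D \<subseteq> ?S"
  proof
    fix V assume V: "V \<in> D"
    have "(\<Sum>Z\<in>D. g \<one> V Z * k Z Y) = (\<Sum>Z\<in>D. if V = Z then k Z Y else 0)"
      by (rule sum.cong) (simp_all add: D'(4)[OF V])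
    then show "V \<in> ?S" using V D'(1,2) by auto
  qed
  ultimately have "rfun.span D \<subseteq> ?S" by (rule rfun.span_minimal[rotated])
  then show ?thesis using X D'(3) by blast
qed

lemma orthonormal_trace_unique:
  assumes g: "riemannian_metric A g" and B: "orthonormal_basis G A g B" and D: "orthonormal_basis G A g D"
    and k: "sym_form k"
  shows "(\<Sum>Y\<in>B. k Y Y) = (\<Sum>Z\<in>D. k Z Z)"
proof -
  have BL: "Y \<in> lie_algebra G A" if "Y \<in> B" for Y using B that by (auto simp: orthonormal_basis_def)
  have DL: "Y \<in> lie_algebra G A" if "Y \<in> D" for Y using D that by (auto simp: orthonormal_basis_def)
  have "(\<Sum>Y\<in>B. k Y Y) = (\<Sum>Y\<in>B. \<Sum>Z\<in>D. g \<one> Y Z * k Z Y)"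
    using orthonormal_expansion[OF g D k] BL by simp
  also have "\<dots> = (\<Sum>Z\<in>D. \<Sum>Y\<in>B. g \<one> Y Z * k Z Y)" by (rule sum.swap)
  also have "\<dots> = (\<Sum>Z\<in>D. \<Sum>Y\<in>B. g \<one> Z Y * k Y Z)"
    using sym_formD(1)[OF sym_form_metric[OF g]] sym_formD(1)[OF k] BL DL by (intro sum.cong) simp_all
  also have "\<dots> = (\<Sum>Z\<in>D. k Z Z)"
    using orthonormal_expansion[OF g B k] DL by simp
  finally show ?thesis .
qed

section \<open>The trace form of an invariant function space\<close>

lemma rho_diff_add_fun:
  assumes X: "X \<in> lie_algebra G A" and f: "smooth_fun A f" and h: "smooth_fun A h"
  shows "rho_diff G X (f + h) = rho_diff G X f + rho_diff G X h"
  using X tangent_vec_add[OF atlas _ smooth_fun_left[OF f] smooth_fun_left[OF h]]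
  by (simp add: fun_eq_iff rho_diff_eq lie_algebra_def)

lemma rho_diff_mult_fun:
  assumes X: "X \<in> lie_algebra G A" and f: "smooth_fun A f"
  shows "rho_diff G X (\<lambda>x. c * f x) = (\<lambda>x. c * rho_diff G X f x)"
  using X tangent_vec_mult[OF atlas _ smooth_fun_left[OF f]]
  by (simp add: fun_eq_iff rho_diff_eq lie_algebra_def)

lemma rho_diff_Ad: "rho_diff G (Ad x X) f = right_regular G x (rho_diff G X (right_regular G (inv x) f))"
  by (simp add: fun_eq_iff rho_diff_eq right_regular_def Ad_def push_forward_def o_def m_assoc)

lemma right_regular_inv [simp]:
  "right_regular G (inv x) (right_regular G x f) = f" "right_regular G x (right_regular G (inv x) f) = f"
  by (simp_all add: right_regular_def m_assoc)

text \<open>A combination of evaluations that vanishes on \<open>W\<close> commutes with the differentiation defining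
  \<open>rho_diff\<close>, so it vanishes on \<open>rho_diff G X f\<close> as well.\<close>

lemma rho_diff_invariant:
  assumes W: "finite_dim W" "\<And>f. f \<in> W \<Longrightarrow> smooth_fun A f" "rho_invariant G W"
    and X: "X \<in> lie_algebra G A" and f: "f \<in> W"
  shows "rho_diff G X f \<in> W"
proof (rule ccontr)
  assume n: "rho_diff G X f \<notin> W"
  obtain B where B: "finite B" "cfun.span B = W" using W(1) by (auto simp: finite_dim_def)
  obtain l where l: "evaluation_comb l" "\<forall>b\<in>B. l b = 0" "l (rho_diff G X f) \<noteq> 0"
    using evaluation_comb_separates[OF B(1)] n B(2) by blast
  have X': "X \<in> tangent_space A \<one>" using X by (simp add: lie_algebra_def)
  have "smooth_fun A (\<lambda>x. l (right_regular G x f)) \<and> l (rho_diff G X f) = X (\<lambda>x. l (right_regular G x f))"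
    using l(1)
  proof (induction rule: evaluation_comb.induct)
    case (evaluation y)
    show ?case using smooth_fun_left[OF W(2)[OF f]] by (simp add: rho_diff_eq right_regular_def)
  next
    case (add l m)
    then show ?case by (auto simp: smooth_fun_add[OF atlas] tangent_vec_add[OF atlas X'])
  next
    case (mult l c)
    then show ?case by (auto simp: smooth_fun_mult_const[OF atlas] tangent_vec_mult[OF atlas X'])
  qed
  moreover have "l (right_regular G x f) = 0" for x
    using evaluation_comb_zero_span[OF l(1), of B] l(2) B(2) W(3) f by (auto simp: rho_invariant_def)
  ultimately show False using l(3) tangent_vec_const[OF atlas X', of 0] by simp
qed

text \<open>For the adjoint representation in place of \<open>W\<close> this would be the Killing form. The
  trace of a Laplacian on \<open>W\<close> is minus the sum of the diagonal values of the trace form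
  on an orthonormal basis.\<close>

definition trace_form :: "('g \<Rightarrow> complex) set \<Rightarrow> 'g tvec \<Rightarrow> 'g tvec \<Rightarrow> complex" where
  "trace_form W X Y = trace_on W (\<lambda>f. rho_diff G X (rho_diff G Y f))"

context
  fixes W
  assumes W: "finite_dim W" and smooth: "\<And>f. f \<in> W \<Longrightarrow> smooth_fun A f" and inv: "rho_invariant G W"
begin

lemma endo_on_rho_diff: "X \<in> lie_algebra G A \<Longrightarrow> endo_on W (rho_diff G X)"
  using rho_diff_invariant[OF W smooth inv] rho_diff_add_fun rho_diff_mult_fun smooth
  by (intro endo_onI) auto

lemma endo_on_right_regular: "endo_on W (right_regular G x)"
  using inv by (intro endo_onI) (auto simp: rho_invariant_def right_regular_def)

lemma trace_form_sym:
  "X \<in> lie_algebra G A \<Longrightarrow> Y \<in> lie_algebra G A \<Longrightarrow> trace_form W X Y = trace_form W Y X"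
  unfolding trace_form_def by (intro trace_on_commute W endo_on_rho_diff)

lemma trace_form_linear:
  assumes X: "X \<in> lie_algebra G A" and Y: "Y \<in> lie_algebra G A"
  shows "Z \<in> lie_algebra G A \<Longrightarrow> trace_form W (X + Z) Y = trace_form W X Y + trace_form W Z Y"
    and "trace_form W (\<lambda>f. of_real r * X f) Y = of_real r * trace_form W X Y"
proof -
  note e = endo_onD(1)[OF endo_on_rho_diff]
  show "trace_form W (X + Z) Y = trace_form W X Y + trace_form W Z Y" if Z: "Z \<in> lie_algebra G A"
  proof -
    have "rho_diff G (X + Z) f = rho_diff G X f + rho_diff G Z f" for f
      by (simp add: fun_eq_iff rho_diff_eq)
    then show ?thesis
      unfolding trace_form_def
      using trace_on_add[OF W e[OF Z e[OF Y]] e[OF X e[OF Y]]] by simp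
  qed
  have "rho_diff G (\<lambda>f. of_real r * X f) f = (\<lambda>x. of_real r * rho_diff G X f x)" for f
    by (simp add: fun_eq_iff rho_diff_eq)
  then show "trace_form W (\<lambda>f. of_real r * X f) Y = of_real r * trace_form W X Y"
    unfolding trace_form_def using trace_on_mult[OF W e[OF X e[OF Y]]] by simp
qed

text \<open>By \<open>rho_diff_Ad\<close>, replacing \<open>X\<close> and \<open>Y\<close> by
  \<open>Ad x X\<close> and \<open>Ad x Y\<close> conjugates the operators on \<open>W\<close> by the right
  translation with \<open>x\<close>, which does not change the trace.\<close>

lemma trace_form_Ad:
  assumes X: "X \<in> lie_algebra G A" and Y: "Y \<in> lie_algebra G A"
  shows "trace_form W (Ad x X) (Ad x Y) = trace_form W X Y"
proof -
  let ?R = "right_regular G"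
  have "trace_form W (Ad x X) (Ad x Y) =
      trace_on W (\<lambda>f. ?R x (rho_diff G X (rho_diff G Y (?R (inv x) f))))"
    by (simp add: trace_form_def rho_diff_Ad)
  also have "\<dots> = trace_on W (\<lambda>f. rho_diff G X (rho_diff G Y (?R (inv x) (?R x f))))"
    by (rule trace_on_commute[OF W endo_on_right_regular
          endo_on_compose[OF endo_on_rho_diff[OF X] endo_on_compose[OF endo_on_rho_diff[OF Y] endo_on_right_regular]]])
  finally show ?thesis by (simp add: trace_form_def)
qed

text \<open>Simplicity is a statement about real forms, so it is applied to the real and to the imaginary part.\<close>

lemma trace_form_proportional:
  assumes simple: "simple_lie_group G A" and g0: "riemannian_metric A g0" "bi_invariant G A g0"
  obtains c :: complex where
    "\<And>X Y. X \<in> lie_algebra G A \<Longrightarrow> Y \<in> lie_algebra G A \<Longrightarrow> trace_form W X Y = c * of_real (g0 \<one> X Y)"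
proof -
  have pos: "g0 \<one> X X > 0" if "X \<in> lie_algebra G A" "X \<noteq> 0" for X
    using riemannian_metricD(4)[OF g0(1)] that by (simp add: lie_algebra_def)
  have *: "\<exists>l. \<forall>X\<in>lie_algebra G A. \<forall>Y\<in>lie_algebra G A. R (trace_form W X Y) = l * g0 \<one> X Y"
    if R: "\<And>a b. R (a + b) = R a + R b" "\<And>r a. R (of_real r * a) = r * R a" for R :: "complex \<Rightarrow> real"
    by (rule invariant_form_unique[OF simple sym_form_metric[OF g0(1)] pos Ad_invariant[OF g0(2)]])
       (simp_all add: sym_form_def trace_form_sym trace_form_linear trace_form_Ad R)
  obtain a where "\<And>X Y. X \<in> lie_algebra G A \<Longrightarrow> Y \<in> lie_algebra G A \<Longrightarrow> Re (trace_form W X Y) = a * g0 \<one> X Y"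
    using *[of Re] by auto
  moreover obtain b where "\<And>X Y. X \<in> lie_algebra G A \<Longrightarrow> Y \<in> lie_algebra G A \<Longrightarrow> Im (trace_form W X Y) = b * g0 \<one> X Y"
    using *[of Im] by auto
  ultimately show ?thesis using that[of "Complex a b"] by (simp add: complex_eq_iff)
qed

lemma trace_on_laplacian:
  assumes g: "riemannian_metric A g"
  shows "\<exists>B. orthonormal_basis G A g B \<and> trace_on W (laplacian G A g) = - (\<Sum>Y\<in>B. trace_form W Y Y)"
proof (intro exI conjI)
  let ?B = "SOME B. orthonormal_basis G A g B"
  show on: "orthonormal_basis G A g ?B"
  proof -
    obtain D where "orthonormal_basis G A g D" using orthonormal_basis_exists[OF g] by blast
    then show ?thesis by (rule someI)
  qed
  then have BL: "Y \<in> lie_algebra G A" if "Y \<in> ?B" for Y using that by (auto simp: orthonormal_basis_def)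
  note e = endo_onD(1)[OF endo_on_rho_diff]
  let ?S = "\<lambda>f. \<Sum>Y\<in>?B. rho_diff G Y (rho_diff G Y f)"
  have "laplacian G A g = (\<lambda>f x. (- 1) * ?S f x)"
    by (simp add: laplacian_def fun_eq_iff)
  moreover have "?S f \<in> W" if "f \<in> W" for f
    by (intro cfun.subspace_sum finite_dim_subspace[OF W] e BL that)
  ultimately have "trace_on W (laplacian G A g) = (- 1) * trace_on W ?S"
    using trace_on_mult[OF W, of ?S "- 1"] by simp
  also have "trace_on W ?S = (\<Sum>Y\<in>?B. trace_form W Y Y)"
    unfolding trace_form_def by (rule trace_on_sum[OF W e[OF BL e[OF BL]]])
  finally show "trace_on W (laplacian G A g) = - (\<Sum>Y\<in>?B. trace_form W Y Y)" by simp
qed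

end

end

section \<open>Finite dimensional subspaces of the square-integrable functions\<close>

context lie_grp
begin

text \<open>Finitely many translates of a non-empty open set cover the compact group.\<close>

lemma haar_measure_open_pos:
  assumes comp: "compact (UNIV :: 'g set)" and \<mu>: "haar_measure G \<mu>" and Q: "open Q" "Q \<noteq> {}"
  shows "emeasure \<mu> Q \<noteq> 0"
proof
  assume 0: "emeasure \<mu> Q = 0"
  have sets: "sets \<mu> = sets borel" and one: "emeasure \<mu> UNIV = 1"
    and inv: "\<And>x. distr \<mu> borel (\<lambda>y. x \<otimes> y) = \<mu>"
    using \<mu> by (auto simp: haar_measure_def)
  have space: "space \<mu> = UNIV" using sets_eq_imp_space_eq[OF sets] by simp
  have cont: "continuous_on UNIV (\<lambda>y. x \<otimes> y)" for x by (rule smooth_map_continuous[OF smooth_map_left])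
  have meas: "(\<lambda>y. x \<otimes> y) \<in> measurable \<mu> borel" for x
    using borel_measurable_continuous_onI[OF cont] measurable_cong_sets[OF sets refl] by blast
  let ?Q = "\<lambda>x. (\<lambda>y. x \<otimes> y) -` Q"
  have null: "?Q x \<in> null_sets \<mu>" for x
  proof -
    have "emeasure \<mu> (?Q x) = emeasure (distr \<mu> borel (\<lambda>y. x \<otimes> y)) Q"
      using Q(1) meas by (subst emeasure_distr) (simp_all add: space)
    moreover have "?Q x \<in> sets \<mu>"
      unfolding sets using open_vimage[OF Q(1) cont] by simp
    ultimately show ?thesis by (simp add: inv 0 null_sets_def)
  qed
  obtain q where q: "q \<in> Q" using Q(2) by blast
  have "y \<in> ?Q (q \<otimes> inv y)" for y using q by (simp add: m_assoc)
  then have "UNIV \<subseteq> (\<Union>x\<in>UNIV. ?Q x)" by blast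
  then obtain F where F: "finite F" "UNIV \<subseteq> (\<Union>x\<in>F. ?Q x)"
    using compactE_image[OF comp, of UNIV ?Q] open_vimage[OF Q(1) cont] by metis
  have "(\<Union>x\<in>F. ?Q x) \<in> null_sets \<mu>" using F(1) null by (intro null_sets.finite_UN) auto
  moreover have "(\<Union>x\<in>F. ?Q x) = UNIV" using F(2) by blast
  ultimately show False using one by (simp add: null_sets_def)
qed

lemma smooth_fun_AE_zero:
  assumes comp: "compact (UNIV :: 'g set)" and \<mu>: "haar_measure G \<mu>"
    and f: "smooth_fun A f" "AE x in \<mu>. f x = 0"
  shows "f = 0"
proof (rule ccontr)
  assume "f \<noteq> 0"
  then have ne: "{x. f x \<noteq> 0} \<noteq> {}" by (auto simp: fun_eq_iff)
  have sets: "sets \<mu> = sets borel" using \<mu> by (auto simp: haar_measure_def)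
  have space: "space \<mu> = UNIV" using sets_eq_imp_space_eq[OF sets] by simp
  have "open (f -` (- {0}))" using f(1) by (intro open_vimage) (auto simp: smooth_fun_iff)
  then have o: "open {x. f x \<noteq> 0}" by (simp add: vimage_def)
  then have "emeasure \<mu> {x. f x \<noteq> 0} = 0"
    using f(2) AE_iff_measurable[of "{x. f x \<noteq> 0}" \<mu> "\<lambda>x. f x = 0"] by (simp add: sets space)
  then show False using haar_measure_open_pos[OF comp \<mu> o ne] by blast
qed

lemma smooth_part_subspace:
  assumes "cfun.subspace V"
  shows "cfun.subspace {f \<in> V. smooth_fun A f}"
proof (rule cfun.subspaceI)
  show "0 \<in> {f \<in> V. smooth_fun A f}"
    using cfun.subspace_0[OF assms] smooth_fun_const[of A 0] by (simp add: zero_fun_def)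
  show "x + y \<in> {f \<in> V. smooth_fun A f}" if "x \<in> {f \<in> V. smooth_fun A f}" "y \<in> {f \<in> V. smooth_fun A f}" for x y
    using that cfun.subspace_add[OF assms] smooth_fun_add[OF atlas, of x y] by (auto simp: plus_fun_def)
  show "(\<lambda>x. c * f x) \<in> {f \<in> V. smooth_fun A f}" if "f \<in> {f \<in> V. smooth_fun A f}" for c f
    using that cfun.subspace_scale[OF assms] smooth_fun_mult_const[OF atlas] by auto
qed

text \<open>A smooth function is determined by its class, so the smooth members of \<open>V\<close> embed in the finite
  dimensional space of classes.\<close>

lemma finite_dim_smooth_part:
  assumes comp: "compact (UNIV :: 'g set)" and \<mu>: "haar_measure G \<mu>"
    and V: "L2_subspace \<mu> V" "L2_finite_dim \<mu> V"
  shows "finite_dim {f \<in> V. smooth_fun A f}"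
proof -
  let ?W = "{f \<in> V. smooth_fun A f}"
  have W: "cfun.subspace ?W" using V(1) smooth_part_subspace by (simp add: L2_subspace_def)
  obtain B where B: "finite B" "\<And>f. f \<in> V \<Longrightarrow> \<exists>h\<in>cfun.span B. AE x in \<mu>. f x = h x"
    using V(2) unfolding L2_finite_dim_def by blast
  define U where "U = {h \<in> cfun.span B. \<exists>f\<in>?W. AE x in \<mu>. f x = h x}"
  obtain C where C: "C \<subseteq> U" "cfun.independent C" "U \<subseteq> cfun.span C"
    using cfun.maximal_independent_subset[of U] by blast
  have finC: "finite C"
    using cfun.independent_span_bound[OF B(1) C(2)] C(1) by (auto simp: U_def)
  have "\<forall>c\<in>C. \<exists>f\<in>?W. AE x in \<mu>. f x = c x" using C(1) by (auto simp: U_def)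
  then obtain s where s: "\<And>c. c \<in> C \<Longrightarrow> s c \<in> ?W \<and> (AE x in \<mu>. s c x = c x)" by metis
  have sW: "cfun.span (s ` C) \<subseteq> ?W" by (rule cfun.span_minimal[OF _ W]) (use s in blast)
  have lift: "\<exists>f'\<in>cfun.span (s ` C). AE x in \<mu>. f' x = h x" if "h \<in> cfun.span C" for h
    using that
  proof (induction rule: cfun.span_induct_alt)
    case base
    show ?case by (rule bexI[OF _ cfun.span_zero]) simp
  next
    case (step a c h)
    then obtain f' where f': "f' \<in> cfun.span (s ` C)" "AE x in \<mu>. f' x = h x" by blast
    have "(\<lambda>x. a * s c x) + f' \<in> cfun.span (s ` C)"
      by (intro cfun.span_add cfun.span_scale cfun.span_base f'(1) imageI step)
    moreover have "AE x in \<mu>. ((\<lambda>x. a * s c x) + f') x = ((\<lambda>x. a * c x) + h) x"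
      using f'(2) conjunct2[OF s[OF step(1)]] by eventually_elim simp
    ultimately show ?case by blast
  qed
  have WC: "?W \<subseteq> cfun.span (s ` C)"
  proof
    fix f assume f: "f \<in> ?W"
    obtain h where h: "h \<in> cfun.span B" "AE x in \<mu>. f x = h x" using B(2) f by blast
    then have "h \<in> cfun.span C" using f C(3) by (auto simp: U_def)
    from lift[OF this] obtain f' where f': "f' \<in> cfun.span (s ` C)" "AE x in \<mu>. f' x = h x" by blast
    have sm: "smooth_fun A f" "smooth_fun A f'" using f f'(1) sW by auto
    have "(\<lambda>x. f x + (- 1) * f' x) = 0"
    proof (rule smooth_fun_AE_zero[OF comp \<mu>])
      show "smooth_fun A (\<lambda>x. f x + (- 1) * f' x)"
        by (intro smooth_fun_add[OF atlas] smooth_fun_mult_const[OF atlas] sm)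
      show "AE x in \<mu>. f x + (- 1) * f' x = 0"
        using h(2) f'(2) by eventually_elim simp
    qed
    then have "f = f'" by (auto simp: fun_eq_iff)
    then show "f \<in> cfun.span (s ` C)" using f'(1) by simp
  qed
  obtain D where D: "D \<subseteq> ?W" "cfun.independent D" "?W \<subseteq> cfun.span D"
    using cfun.maximal_independent_subset[of ?W] by blast
  have "finite D"
    using cfun.independent_span_bound[OF _ D(2), of "s ` C"] finC D(1) WC by auto
  moreover have "cfun.span D = ?W" using D W cfun.span_minimal[OF D(1) W] by blast
  ultimately show ?thesis unfolding finite_dim_def using D(2) by blast
qed

end

section \<open>The Riemannian volume of a left-invariant metric\<close>

text \<open>Each point has a neighbourhood whose closure lies in a chart, namely the preimage of a small ball:
  its closure lies in the preimage of the closed ball, which is compact. A finite subcover is then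
  made disjoint by successive differences.\<close>

lemma chart_partition_exists:
  fixes A :: "('m::{t2_space,second_countable_topology}, 'e::euclidean_space) chart set"
  assumes A: "smooth_atlas A" and comp: "compact (UNIV :: 'm set)"
  shows "\<exists>P. chart_partition A P"
proof -
  have "\<exists>c W. c \<in> A \<and> open W \<and> p \<in> W \<and> closure W \<subseteq> fst c" for p
  proof -
    obtain U \<phi> where U: "(U, \<phi>) \<in> A" "p \<in> U" by (rule chart_exists[OF A])
    have "\<phi> p \<in> \<phi> ` U" using U by simp
    then obtain e where e: "e > 0" "cball (\<phi> p) e \<subseteq> \<phi> ` U"
      using chart_range_open[OF A U(1)] open_contains_cball by metis
    let ?W = "U \<inter> \<phi> -` ball (\<phi> p) e" and ?K = "inv_into U \<phi> ` cball (\<phi> p) e"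
    have "compact ?K"
      by (intro compact_continuous_image continuous_on_subset[OF chart_inv_continuous[OF A U(1)] e(2)]) auto
    then have "closed ?K" by (rule compact_imp_closed)
    moreover have "?W \<subseteq> ?K"
    proof
      fix q assume q: "q \<in> ?W"
      then have "inv_into U \<phi> (\<phi> q) = q" using A U by simp
      then show "q \<in> ?K" using q by (intro image_eqI[of _ _ "\<phi> q"]) auto
    qed
    moreover have "?K \<subseteq> U" using e(2) inv_into_into by (metis (no_types, lifting) image_subset_iff subset_iff)
    ultimately have "closure ?W \<subseteq> U" by (meson closure_minimal subset_trans)
    moreover have "open ?W"
      by (rule continuous_open_preimage[OF chart_continuous[OF A U(1)] chart_open[OF A U(1)] open_ball])
    moreover have "p \<in> ?W" using U e by simp
    ultimately show ?thesis using U by (intro exI[of _ "(U, \<phi>)"] exI[of _ ?W]) simp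
  qed
  then obtain c W where cW: "\<And>p. c p \<in> A" "\<And>p. open (W p)" "\<And>p. p \<in> W p" "\<And>p. closure (W p) \<subseteq> fst (c p)"
    by metis
  have "UNIV \<subseteq> (\<Union>p\<in>UNIV. W p)" using cW(3) by blast
  then obtain F where F: "finite F" "UNIV \<subseteq> (\<Union>p\<in>F. W p)"
    using compactE_image[OF comp, of UNIV W] cW(2) by metis
  have "\<exists>P. finite P \<and> (\<forall>(c,S)\<in>P. c \<in> A \<and> S \<in> sets borel \<and> closure S \<subseteq> fst c) \<and>
     (\<forall>q\<in>P. \<forall>q'\<in>P. q \<noteq> q' \<longrightarrow> snd q \<inter> snd q' = {}) \<and> (\<Union>q\<in>P. snd q) = (\<Union>p\<in>F. W p)"
    using F(1)
  proof (induction F rule: finite_induct)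
    case empty
    show ?case by (intro exI[of _ "{}"]) auto
  next
    case (insert p F)
    from insert.IH obtain P where
      *: "finite P \<and> (\<forall>(c,S)\<in>P. c \<in> A \<and> S \<in> sets borel \<and> closure S \<subseteq> fst c) \<and>
        (\<forall>q\<in>P. \<forall>q'\<in>P. q \<noteq> q' \<longrightarrow> snd q \<inter> snd q' = {}) \<and> (\<Union>q\<in>P. snd q) = (\<Union>p\<in>F. W p)" ..
    note P = *[THEN conjunct1] *[THEN conjunct2, THEN conjunct1] *[THEN conjunct2, THEN conjunct2, THEN conjunct1]
      *[THEN conjunct2, THEN conjunct2, THEN conjunct2]
    let ?S = "W p - (\<Union>p\<in>F. W p)"
    have "?S \<in> sets borel" using cW(2) by (intro sets.Diff borel_open open_UN) simp_all
    moreover have "closure ?S \<subseteq> fst (c p)" using cW(4)[of p] closure_mono[of ?S "W p"] by blast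
    moreover have disj: "snd q \<inter> ?S = {}" if "q \<in> P" for q using that P(4) by blast
    moreover have "(\<Union>q\<in>insert (c p, ?S) P. snd q) = (\<Union>p\<in>insert p F. W p)" using P(4) by auto
    moreover have "\<forall>q\<in>insert (c p, ?S) P. \<forall>q'\<in>insert (c p, ?S) P. q \<noteq> q' \<longrightarrow> snd q \<inter> snd q' = {}"
    proof (intro ballI impI)
      fix q q' assume "q \<in> insert (c p, ?S) P" "q' \<in> insert (c p, ?S) P" "q \<noteq> q'"
      then consider "q = (c p, ?S)" "q' \<in> P" | "q \<in> P" "q' = (c p, ?S)" | "q \<in> P" "q' \<in> P" by blast
      then show "snd q \<inter> snd q' = {}"
        using disj P(3) \<open>q \<noteq> q'\<close> by cases (simp_all add: Int_commute)
    qed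
    ultimately show ?case
      using P(1,2) cW(1)[of p] by (intro exI[of _ "insert (c p, ?S) P"] conjI) simp_all
  qed
  moreover have cover: "(\<Union>p\<in>F. W p) = UNIV" using F(2) by blast
  ultimately show ?thesis unfolding chart_partition_def cover by (elim exE) (rule exI)
qed

lemma chart_partitionD:
  assumes "chart_partition A P" "((U, \<phi>), S) \<in> P"
  shows "(U, \<phi>) \<in> A \<and> S \<in> sets borel \<and> closure S \<subseteq> U"
  using bspec[OF assms(1)[unfolded chart_partition_def, THEN conjunct2, THEN conjunct1] assms(2)] by simp

lemma chart_image_borel:
  assumes A: "smooth_atlas A" and U: "(U, \<phi>) \<in> A" and S: "S \<in> sets borel" "S \<subseteq> U"
  shows "\<phi> ` S \<in> sets borel"
proof -
  have o: "\<phi> ` U \<in> sets borel" using chart_range_open[OF A U] by simp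
  have "inv_into U \<phi> \<in> borel_measurable (restrict_space borel (\<phi> ` U))"
    by (rule borel_measurable_continuous_on_restrict[OF chart_inv_continuous[OF A U]])
  from measurable_sets[OF this S(1)]
  have "inv_into U \<phi> -` S \<inter> \<phi> ` U \<in> sets borel"
    using o by (simp add: sets_restrict_space_iff space_restrict_space)
  then show ?thesis unfolding chart_image_eq[OF A U S(2)] by (simp add: Int_commute)
qed

lemma volume_density_pos:
  fixes A :: "('m::{t2_space,second_countable_topology}, real^'n) chart set"
  assumes A: "smooth_atlas A" and g: "riemannian_metric A g" and U: "(U, \<phi>) \<in> A" "p \<in> U"
  shows "volume_density A g (U, \<phi>) p > 0"
  unfolding volume_density_def using det_gram_pos[OF metric_coord_form[OF A g U]] by simp

lemma volume_density_continuous: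
  fixes A :: "('m::{t2_space,second_countable_topology}, real^'n) chart set"
  assumes g: "riemannian_metric A g" and U: "(U, \<phi>) \<in> A"
  shows "continuous_on (\<phi> ` U) (\<lambda>a. volume_density A g (U, \<phi>) (inv_into U \<phi> a))"
proof -
  note m = g[unfolded riemannian_metric_def, THEN conjunct2, THEN conjunct2, THEN conjunct2, THEN conjunct2]
  have "smooth_on (\<phi> ` U) (\<lambda>a. g (inv_into U \<phi> a) (coord_vec A (U, \<phi>) (inv_into U \<phi> a) v)
      (coord_vec A (U, \<phi>) (inv_into U \<phi> a) w))" for v w
    using bspec[OF m U] by (simp add: Let_def)
  from smooth_on_imp_continuous_on[OF this] show ?thesis
    unfolding volume_density_def det_def
    by (intro continuous_on_real_sqrt continuous_on_sum continuous_on_mult continuous_on_prod continuous_on_const) simp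
qed

lemma volume_integrand_measurable:
  fixes A :: "('m::{t2_space,second_countable_topology}, real^'n) chart set"
  assumes A: "smooth_atlas A" and g: "riemannian_metric A g"
    and U: "(U, \<phi>) \<in> A" and S: "S \<in> sets borel" "S \<subseteq> U"
  shows "(\<lambda>a. ennreal (volume_density A g (U, \<phi>) (inv_into U \<phi> a)) * indicator (\<phi> ` S) a)
    \<in> borel_measurable lborel"
proof -
  let ?d = "\<lambda>a. volume_density A g (U, \<phi>) (inv_into U \<phi> a)"
  have "continuous_on (\<phi> ` S) ?d"
    by (rule continuous_on_subset[OF volume_density_continuous[OF g U]]) (use S in blast)
  then have "(\<lambda>a. indicator (\<phi> ` S) a *\<^sub>R ?d a) \<in> borel_measurable borel"
    by (rule borel_measurable_continuous_on_indicator[OF chart_image_borel[OF A U S]])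
  then have "(\<lambda>a. ennreal (indicator (\<phi> ` S) a *\<^sub>R ?d a)) \<in> borel_measurable lborel" by simp
  moreover have "(\<lambda>a. ennreal (indicator (\<phi> ` S) a *\<^sub>R ?d a)) = (\<lambda>a. ennreal (?d a) * indicator (\<phi> ` S) a)"
    by (auto simp: indicator_def fun_eq_iff)
  ultimately show ?thesis by simp
qed

lemma open_not_negligible:
  fixes S :: "'a::euclidean_space set"
  assumes "open S" "S \<noteq> {}"
  shows "\<not> negligible S"
proof
  assume n: "negligible S"
  obtain x r where r: "r > 0" "ball x r \<subseteq> S" using assms openE by blast
  have "negligible (ball x r)" by (rule negligible_subset[OF n r(2)])
  then have "emeasure lborel (ball x r) = 0"
    by (simp add: negligible_iff_null_sets null_sets_def)
  then show False using content_ball_pos[OF r(1), of x] by (simp add: measure_def)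
qed

text \<open>The closure of the piece is compact, so its image has finite Lebesgue measure and the density
  is bounded on it.\<close>

lemma volume_piece_finite:
  fixes A :: "('m::{t2_space,second_countable_topology}, real^'n) chart set"
  assumes A: "smooth_atlas A" and comp: "compact (UNIV :: 'm set)" and g: "riemannian_metric A g"
    and U: "(U, \<phi>) \<in> A" and S: "closure S \<subseteq> U"
  shows "(\<integral>\<^sup>+a\<in>\<phi> ` S. ennreal (volume_density A g (U, \<phi>) (inv_into U \<phi> a)) \<partial>lborel) < \<infinity>"
proof -
  let ?d = "\<lambda>a. volume_density A g (U, \<phi>) (inv_into U \<phi> a)"
  let ?K = "\<phi> ` closure S"
  have "compact (closure S)" using comp closed_Int_compact[of "closure S" UNIV] by simp
  then have K: "compact ?K"
    by (rule compact_continuous_image[OF continuous_on_subset[OF chart_continuous[OF A U] S]])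
  have "continuous_on ?K ?d"
    by (rule continuous_on_subset[OF volume_density_continuous[OF g U]]) (use S in blast)
  then have "bounded (?d ` ?K)" using K by (rule compact_imp_bounded[OF compact_continuous_image])
  then obtain M where M: "\<And>a. a \<in> ?K \<Longrightarrow> ?d a \<le> M"
    unfolding bounded_iff by (metis abs_le_D1 imageI real_norm_def)
  have "(\<integral>\<^sup>+a\<in>\<phi> ` S. ennreal (?d a) \<partial>lborel) \<le> (\<integral>\<^sup>+a. ennreal M * indicator ?K a \<partial>lborel)"
    using M closure_subset[of S]
    by (intro nn_integral_mono) (auto simp: indicator_def intro!: ennreal_leI)
  also have "\<dots> = ennreal M * emeasure lborel ?K"
    using K by (intro nn_integral_cmult_indicator) (simp add: borel_compact)
  also have "\<dots> < \<infinity>" using emeasure_compact_finite[OF K] by (simp add: ennreal_mult_less_top)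
  finally show ?thesis .
qed

lemma volume_piece_zero:
  fixes A :: "('m::{t2_space,second_countable_topology}, real^'n) chart set"
  assumes A: "smooth_atlas A" and g: "riemannian_metric A g"
    and U: "(U, \<phi>) \<in> A" and S: "S \<in> sets borel" "S \<subseteq> U"
    and 0: "(\<integral>\<^sup>+a\<in>\<phi> ` S. ennreal (volume_density A g (U, \<phi>) (inv_into U \<phi> a)) \<partial>lborel) = 0"
  shows "negligible (\<phi> ` S)"
proof -
  let ?d = "\<lambda>a. volume_density A g (U, \<phi>) (inv_into U \<phi> a)"
  note m = volume_integrand_measurable[OF A g U S]
  have "emeasure lborel {a \<in> space lborel. ennreal (?d a) * indicator (\<phi> ` S) a \<noteq> 0} = 0"
    using 0 nn_integral_0_iff[OF m] by simp
  also have "{a \<in> space lborel. ennreal (?d a) * indicator (\<phi> ` S) a \<noteq> 0} = \<phi> ` S"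
  proof -
    have "?d (\<phi> p) > 0" if "p \<in> S" for p
      using volume_density_pos[OF A g U, of p] that S(2) A U by auto
    then have "ennreal (?d (\<phi> p)) \<noteq> 0" if "p \<in> S" for p
      using that by (metis ennreal_eq_0_iff not_le)
    then show ?thesis by (auto simp: indicator_def)
  qed
  finally show ?thesis
    using chart_image_borel[OF A U S] by (simp add: negligible_iff_null_sets null_sets_def)
qed

text \<open>If the volume were zero, every piece would be negligible in its own chart, hence negligible in every
  other chart, because transition maps are differentiable. The finitely many pieces cover the range of
  any chart, which is a non-empty open set.\<close>

lemma riemannian_volume_finite_pos:
  fixes A :: "('m::{t2_space,second_countable_topology}, real^'n) chart set"
  assumes A: "smooth_atlas A" and comp: "compact (UNIV :: 'm set)" and g: "riemannian_metric A g"
  shows "riemannian_volume A g < \<infinity>" "riemannian_volume A g \<noteq> 0"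
proof -
  define R where "R = (SOME P. chart_partition A P)"
  let ?I = "\<lambda>((U, \<phi>), S). \<integral>\<^sup>+a\<in>\<phi> ` S. ennreal (volume_density A g (U, \<phi>) (inv_into U \<phi> a)) \<partial>lborel"
  have P: "chart_partition A R" unfolding R_def using someI_ex[OF chart_partition_exists[OF A comp]] .
  have fin: "finite R" using P by (simp add: chart_partition_def)
  have piece: "(U, \<phi>) \<in> A \<and> S \<in> sets borel \<and> closure S \<subseteq> U" if "((U, \<phi>), S) \<in> R" for U \<phi> S
    by (rule chart_partitionD[OF P that])
  have cover: "(\<Union>q\<in>R. snd q) = UNIV" using P by (simp add: chart_partition_def)
  have vol: "riemannian_volume A g = (\<Sum>q\<in>R. ?I q)" by (simp add: riemannian_volume_def R_def)
  have "?I q < \<infinity>" if "q \<in> R" for q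
    using volume_piece_finite[OF A comp g] piece that by (cases q) auto
  then show "riemannian_volume A g < \<infinity>"
    unfolding vol by (simp add: ennreal_sum_less_top fin)
  show "riemannian_volume A g \<noteq> 0"
  proof
    assume "riemannian_volume A g = 0"
    then have I0: "?I q = 0" if "q \<in> R" for q using that fin by (simp add: vol)
    obtain V \<psi> where V: "(V, \<psi>) \<in> A" "undefined \<in> V" by (rule chart_exists[OF A])
    have "negligible (\<psi> ` (V \<inter> S))" if "((U, \<phi>), S) \<in> R" for U \<phi> S
    proof -
      note pc = piece[OF that]
      have SU: "S \<subseteq> U" using pc closure_subset by blast
      have "negligible (\<phi> ` S)"
        by (rule volume_piece_zero[OF A g _ _ SU]) (use pc I0[OF that] in auto)
      then have n: "negligible (\<phi> ` (V \<inter> S))" by (rule negligible_subset) blast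
      have "(\<psi> \<circ> inv_into U \<phi>) differentiable_on (\<phi> ` (V \<inter> S))"
      proof (rule differentiable_at_imp_differentiable_on)
        fix a assume "a \<in> \<phi> ` (V \<inter> S)"
        then have "a \<in> \<phi> ` (U \<inter> V)" using SU by blast
        from smooth_on_has_derivative[OF chart_transition[OF A conjunct1[OF pc] V(1)] this]
        show "(\<psi> \<circ> inv_into U \<phi>) differentiable at a" by (auto simp: differentiable_def)
      qed
      from negligible_differentiable_image_negligible[OF order_refl n this]
      have "negligible ((\<psi> \<circ> inv_into U \<phi>) ` \<phi> ` (V \<inter> S))" .
      moreover have "(\<psi> \<circ> inv_into U \<phi>) ` \<phi> ` (V \<inter> S) = \<psi> ` (V \<inter> S)"
        unfolding image_image by (rule image_cong) (use A pc SU in auto)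
      ultimately show ?thesis by simp
    qed
    then have "negligible (\<Union>q\<in>R. \<psi> ` (V \<inter> snd q))"
      using fin by (intro negligible_Union) auto
    moreover have "(\<Union>q\<in>R. \<psi> ` (V \<inter> snd q)) = \<psi> ` V" using cover by blast
    ultimately show False
      using open_not_negligible[OF chart_range_open[OF A V(1)]] V(2) by auto
  qed
qed

lemma riemannian_volume_scaled:
  fixes A :: "('m::{t2_space,second_countable_topology}, real^'n) chart set"
  assumes A: "smooth_atlas A" and comp: "compact (UNIV :: 'm set)" and g: "riemannian_metric A g"
    and k: "k \<ge> 0"
    and eq: "\<And>U \<phi> p. (U, \<phi>) \<in> A \<Longrightarrow> p \<in> U \<Longrightarrow> volume_density A h (U, \<phi>) p = k * volume_density A g (U, \<phi>) p"
  shows "riemannian_volume A h = ennreal k * riemannian_volume A g"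
proof -
  define R where "R = (SOME P. chart_partition A P)"
  have P: "chart_partition A R" unfolding R_def using someI_ex[OF chart_partition_exists[OF A comp]] .
  have "(\<integral>\<^sup>+a\<in>\<phi> ` S. ennreal (volume_density A h (U, \<phi>) (inv_into U \<phi> a)) \<partial>lborel) =
      ennreal k * (\<integral>\<^sup>+a\<in>\<phi> ` S. ennreal (volume_density A g (U, \<phi>) (inv_into U \<phi> a)) \<partial>lborel)"
    if "((U, \<phi>), S) \<in> R" for U \<phi> S
  proof -
    have U: "(U, \<phi>) \<in> A" and S: "S \<in> sets borel" "S \<subseteq> U"
      using chart_partitionD[OF P that] closure_subset[of S] by auto
    let ?d = "\<lambda>a. volume_density A g (U, \<phi>) (inv_into U \<phi> a)"
    have "(\<integral>\<^sup>+a\<in>\<phi> ` S. ennreal (volume_density A h (U, \<phi>) (inv_into U \<phi> a)) \<partial>lborel) =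
        (\<integral>\<^sup>+a. ennreal k * (ennreal (?d a) * indicator (\<phi> ` S) a) \<partial>lborel)"
    proof (rule nn_integral_cong)
      fix a
      show "ennreal (volume_density A h (U, \<phi>) (inv_into U \<phi> a)) * indicator (\<phi> ` S) a =
          ennreal k * (ennreal (?d a) * indicator (\<phi> ` S) a)"
      proof (cases "a \<in> \<phi> ` S")
        case True
        then have "inv_into U \<phi> a \<in> U" using A U S(2) by auto
        from eq[OF U this] k show ?thesis by (simp add: True ennreal_mult' )
      qed simp
    qed
    also have "\<dots> = ennreal k * (\<integral>\<^sup>+a\<in>\<phi> ` S. ennreal (?d a) \<partial>lborel)"
      by (rule nn_integral_cmult[OF volume_integrand_measurable[OF A g U S]])
    finally show ?thesis .
  qed
  then show ?thesis
    unfolding riemannian_volume_def R_def[symmetric] sum_distrib_left by (intro sum.cong) auto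
qed

text \<open>Left translation to the identity turns the Gram matrices of two left-invariant metrics in a chart at
  \<open>p\<close> into Gram matrices at the identity, with the same change of basis for both metrics; so the
  quotient of the densities does not depend on \<open>p\<close>.\<close>

lemma volume_density_ratio:
  fixes G :: "'g::{t2_space,second_countable_topology} monoid"
    and A :: "('g, real^'n) chart set"
  assumes G: "lie_group G A" and U: "(U, \<phi>) \<in> A" "p \<in> U"
    and U1: "(U1, \<phi>1) \<in> A" "\<one>\<^bsub>G\<^esub> \<in> U1"
    and g: "riemannian_metric A g" "left_invariant G A g"
    and h: "riemannian_metric A h" "left_invariant G A h"
  defines "D \<equiv> \<lambda>g. det (\<chi> i j. g \<one>\<^bsub>G\<^esub> (coord_vec A (U1, \<phi>1) \<one>\<^bsub>G\<^esub> (axis i 1)) (coord_vec A (U1, \<phi>1) \<one>\<^bsub>G\<^esub> (axis j 1)))"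
  shows "volume_density A h (U, \<phi>) p = sqrt (D h / D g) * volume_density A g (U, \<phi>) p"
proof -
  interpret lie_grp G A by unfold_locales (rule G)
  let ?c = "coord_vec A (U1, \<phi>1) \<one>\<^bsub>G\<^esub>"
  let ?T = "\<lambda>i. push_forward (\<lambda>q. inv\<^bsub>G\<^esub> p \<otimes>\<^bsub>G\<^esub> q) (coord_vec A (U, \<phi>) p (axis i (1::real)))"
  have X: "coord_vec A (U, \<phi>) p v \<in> tangent_space A p" for v by (rule coord_vec_in_tangent_space[OF U])
  have "?T i \<in> lie_algebra G A" for i
    using push_forward_left[OF X, of "inv\<^bsub>G\<^esub> p"] by (simp add: lie_algebra_def)
  then have "\<exists>v. ?T i = ?c v" for i using coord_vec_one_cases[OF _ U1] by metis
  then obtain z where z: "\<And>i. ?T i = ?c (z i)" by metis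
  have dens: "volume_density A m (U, \<phi>) p = \<bar>det (\<chi> k i. z i $ k)\<bar> * sqrt (D m)"
    if m: "riemannian_metric A m" "left_invariant G A m" for m
  proof -
    have "m p (coord_vec A (U, \<phi>) p (axis i 1)) (coord_vec A (U, \<phi>) p (axis j 1)) =
        m \<one>\<^bsub>G\<^esub> (?c (z i)) (?c (z j))" for i j
    proof -
      have "m (inv\<^bsub>G\<^esub> p \<otimes>\<^bsub>G\<^esub> p) (?T i) (?T j) =
          m p (coord_vec A (U, \<phi>) p (axis i 1)) (coord_vec A (U, \<phi>) p (axis j 1))"
        using m(2) X unfolding left_invariant_def by blast
      then show ?thesis by (simp add: z)
    qed
    then have "volume_density A m (U, \<phi>) p = sqrt (det (\<chi> i j. m \<one>\<^bsub>G\<^esub> (?c (z i)) (?c (z j))))"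
      by (simp add: volume_density_def)
    also have "\<dots> = sqrt ((det (\<chi> k i. z i $ k))\<^sup>2 * D m)"
      unfolding D_def
      by (subst det_gram[OF metric_coord_form(1)[OF atlas m(1) U1], of z]) simp
    finally show ?thesis by (simp add: real_sqrt_mult)
  qed
  have "D m > 0" if "riemannian_metric A m" for m
    unfolding D_def by (rule det_gram_pos[OF metric_coord_form[OF atlas that U1]])
  from this[OF g(1)] show ?thesis by (simp add: dens[OF g] dens[OF h] real_sqrt_divide)
qed

text \<open>Left translations carry every tangent space onto the Lie algebra; outside the tangent spaces
  both metrics are zero by convention.\<close>

lemma left_invariant_metric_eqI:
  assumes G: "lie_group G A"
    and g: "riemannian_metric A g" "left_invariant G A g"
    and h: "riemannian_metric A h" "left_invariant G A h"
    and eq: "\<And>X Y. X \<in> lie_algebra G A \<Longrightarrow> Y \<in> lie_algebra G A \<Longrightarrow> g \<one>\<^bsub>G\<^esub> X Y = h \<one>\<^bsub>G\<^esub> X Y"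
  shows "g = h"
proof (intro ext)
  interpret lie_grp G A by unfold_locales (rule G)
  fix p X Y
  show "g p X Y = h p X Y"
  proof (cases "X \<in> tangent_space A p \<and> Y \<in> tangent_space A p")
    case False
    then show ?thesis
      using g(1)[unfolded riemannian_metric_def, THEN conjunct1]
        h(1)[unfolded riemannian_metric_def, THEN conjunct1] by metis
  next
    case True
    let ?T = "push_forward (\<lambda>q. inv\<^bsub>G\<^esub> p \<otimes>\<^bsub>G\<^esub> q)"
    have T: "?T X \<in> lie_algebra G A" "?T Y \<in> lie_algebra G A"
      using push_forward_left[of X p "inv\<^bsub>G\<^esub> p"] push_forward_left[of Y p "inv\<^bsub>G\<^esub> p"] True
      by (simp_all add: lie_algebra_def)
    have *: "m p X Y = m \<one>\<^bsub>G\<^esub> (?T X) (?T Y)" if "left_invariant G A m" for m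
    proof -
      have "m (inv\<^bsub>G\<^esub> p \<otimes>\<^bsub>G\<^esub> p) (?T X) (?T Y) = m p X Y"
        using that True unfolding left_invariant_def by blast
      then show ?thesis by simp
    qed
    show ?thesis using *[OF g(2)] *[OF h(2)] eq[OF T] by simp
  qed
qed

section \<open>Traces of Laplacians\<close>

theorem proposition3p1:
  fixes G :: "'g::{t2_space,second_countable_topology} monoid"
    and A :: "('g, real^'n) chart set"
    and g0 g :: "'g metric"
    and \<mu> :: "'g measure"
  assumes "simple_lie_group G A"
    and "compact (UNIV :: 'g set)"
    and "riemannian_metric A g0" and "bi_invariant G A g0"
    and "riemannian_metric A g" and "left_invariant G A g"
    and "g \<noteq> g0"
    and "riemannian_volume A g \<le> riemannian_volume A g0"
    and "haar_measure G \<mu>"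
  shows "\<exists>C::real. C > 1 \<and>
    (\<forall>V. L2_subspace \<mu> V \<and> L2_finite_dim \<mu> V \<and> rho_invariant G V \<and> acts_nontrivially G \<mu> V \<longrightarrow>
       laplacian_trace G A g V = of_real C * laplacian_trace G A g0 V)"
proof -
  have G: "lie_group G A" using assms(1) by (simp add: simple_lie_group_def)
  interpret lie_grp G A by unfold_locales (rule G)
  note g0 = assms(3,4) and g = assms(5,6)
  have g0_left: "left_invariant G A g0" using g0(2) by (simp add: bi_invariant_def)
  obtain U \<phi> where U: "(U, \<phi>) \<in> A" "\<one>\<^bsub>G\<^esub> \<in> U" by (rule chart_exists[OF atlas])
  let ?c = "coord_vec A (U, \<phi>) \<one>\<^bsub>G\<^esub>"
  let ?f = "\<lambda>m v w. m \<one>\<^bsub>G\<^esub> (?c v) (?c w)"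
  let ?D = "\<lambda>m. det (\<chi> i j. ?f m (axis i 1) (axis j 1))"
  have Dpos: "?D g > 0" "?D g0 > 0"
    using det_gram_pos[OF metric_coord_form[OF atlas g(1) U]] det_gram_pos[OF metric_coord_form[OF atlas g0(1) U]]
    by simp_all
  \<comment> \<open>The volumes have the same constant ratio as the densities, and the volume of \<open>g0\<close> is
    positive and finite.\<close>
  have det: "?D g \<le> ?D g0"
  proof (rule ccontr)
    assume "\<not> ?thesis"
    then have k: "sqrt (?D g / ?D g0) > 1" using Dpos by simp
    have "riemannian_volume A g = ennreal (sqrt (?D g / ?D g0)) * riemannian_volume A g0"
      using k volume_density_ratio[OF G _ _ U g0(1) g0_left g]
      by (intro riemannian_volume_scaled[OF atlas assms(2) g0(1)]) auto
    then have le: "ennreal (sqrt (?D g / ?D g0)) * riemannian_volume A g0 \<le> riemannian_volume A g0"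
      using assms(8) by simp
    obtain v where v: "riemannian_volume A g0 = ennreal v" "v > 0"
      using riemannian_volume_finite_pos[OF atlas assms(2) g0(1)]
      by (cases "riemannian_volume A g0") (auto simp: less_le)
    from le have "sqrt (?D g / ?D g0) * v \<le> v"
      unfolding v(1) using k v(2) by (simp add: ennreal_mult[symmetric])
    then show False using k v(2) by simp
  qed
  have ne: "?f g \<noteq> ?f g0"
  proof
    assume eq: "?f g = ?f g0"
    have "g = g0"
    proof (rule left_invariant_metric_eqI[OF G g g0(1) g0_left])
      fix X Y assume "X \<in> lie_algebra G A" "Y \<in> lie_algebra G A"
      then obtain v w where "X = ?c v" "Y = ?c w" using coord_vec_one_cases[OF _ U] by metis
      then show "g \<one>\<^bsub>G\<^esub> X Y = g0 \<one>\<^bsub>G\<^esub> X Y" using fun_cong[OF fun_cong[OF eq]] by simp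
    qed
    then show False using assms(7) by simp
  qed
  note trace_ge = relative_trace_ge[OF metric_coord_form[OF atlas g(1) U] metric_coord_form[OF atlas g0(1) U] det ne]
  obtain B where B: "finite B" "span B = UNIV"
    "\<And>b c. b \<in> B \<Longrightarrow> c \<in> B \<Longrightarrow> ?f g b c = (if b = c then 1 else 0)"
    "(\<Sum>b\<in>B. ?f g0 b b) > CARD('n)"
  proof (rule trace_ge)
    fix B assume "finite B" "span B = UNIV"
      "\<And>b c. b \<in> B \<Longrightarrow> c \<in> B \<Longrightarrow> ?f g b c = (if b = c then 1 else 0)"
      "(\<Sum>b\<in>B. ?f g0 b b) > CARD('n)"
    then show thesis by (rule that)
  qed
  note on = orthonormal_basis_coord_vec_image[OF U B(1,2), of g, OF B(3)]
  let ?t = "\<Sum>b\<in>B. ?f g0 b b"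
  \<comment> \<open>The mean of \<open>g0\<close> over a \<open>g\<close>-orthonormal basis, which does not involve
    \<open>V\<close>.\<close>
  define C where "C = ?t / CARD('n)"
  have "C > 1" using B(4) by (simp add: C_def)
  moreover have "laplacian_trace G A g V = of_real C * laplacian_trace G A g0 V"
    if V: "L2_subspace \<mu> V" "L2_finite_dim \<mu> V" "rho_invariant G V" for V
  proof -
    let ?W = "{f \<in> V. smooth_fun A f}"
    have W: "finite_dim ?W" by (rule finite_dim_smooth_part[OF assms(2,9) V(1,2)])
    have inv: "rho_invariant G ?W"
      using V(3) smooth_fun_right_regular by (simp add: rho_invariant_def)
    have sm: "\<And>f. f \<in> ?W \<Longrightarrow> smooth_fun A f" by simp
    obtain c where c: "\<And>X Y. X \<in> lie_algebra G A \<Longrightarrow> Y \<in> lie_algebra G A \<Longrightarrow>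
        trace_form ?W X Y = c * of_real (g0 \<one>\<^bsub>G\<^esub> X Y)"
      using trace_form_proportional[OF W sm inv assms(1) g0] by blast
    have tr: "\<exists>E. orthonormal_basis G A m E \<and>
        laplacian_trace G A m V = - (c * of_real (\<Sum>Y\<in>E. g0 \<one>\<^bsub>G\<^esub> Y Y))"
      if m: "riemannian_metric A m" for m
    proof -
      obtain E where E: "orthonormal_basis G A m E"
        "trace_on ?W (laplacian G A m) = - (\<Sum>Y\<in>E. trace_form ?W Y Y)"
        using trace_on_laplacian[OF W sm inv m] by blast
      have "(\<Sum>Y\<in>E. trace_form ?W Y Y) = (\<Sum>Y\<in>E. c * of_real (g0 \<one>\<^bsub>G\<^esub> Y Y))"
        by (rule sum.cong) (use E(1) c in \<open>auto simp: orthonormal_basis_def\<close>)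
      then show ?thesis using E by (auto simp: laplacian_trace_def sum_distrib_left)
    qed
    obtain E where E: "orthonormal_basis G A g E"
      "laplacian_trace G A g V = - (c * of_real (\<Sum>Y\<in>E. g0 \<one>\<^bsub>G\<^esub> Y Y))" using tr[OF g(1)] by blast
    obtain E0 where E0: "orthonormal_basis G A g0 E0"
      "laplacian_trace G A g0 V = - (c * of_real (\<Sum>Y\<in>E0. g0 \<one>\<^bsub>G\<^esub> Y Y))" using tr[OF g0(1)] by blast
    have "(\<Sum>Y\<in>E. g0 \<one>\<^bsub>G\<^esub> Y Y) = (\<Sum>Y\<in>?c ` B. g0 \<one>\<^bsub>G\<^esub> Y Y)"
      by (rule orthonormal_trace_unique[OF g(1) E(1) on(1) sym_form_metric[OF g0(1)]])
    also have "\<dots> = ?t" by (simp add: sum.reindex[OF on(2)])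
    finally have t: "(\<Sum>Y\<in>E. g0 \<one>\<^bsub>G\<^esub> Y Y) = C * CARD('n)" by (simp add: C_def)
    obtain D where D: "orthonormal_basis G A g0 D" "card D = DIM(real^'n)"
      by (rule orthonormal_basis_exists[OF g0(1)])
    have "(\<Sum>Y\<in>E0. g0 \<one>\<^bsub>G\<^esub> Y Y) = (\<Sum>Y\<in>D. g0 \<one>\<^bsub>G\<^esub> Y Y)"
      by (rule orthonormal_trace_unique[OF g0(1) E0(1) D(1) sym_form_metric[OF g0(1)]])
    also have "\<dots> = (\<Sum>Y\<in>D. 1)" by (rule sum.cong) (use D(1) in \<open>auto simp: orthonormal_basis_def\<close>)
    also have "\<dots> = CARD('n)" using D(2) by simp
    finally have "(\<Sum>Y\<in>E0. g0 \<one>\<^bsub>G\<^esub> Y Y) = CARD('n)" .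
    then show ?thesis by (simp add: E(2) E0(2) t mult_ac)
  qed
  ultimately show ?thesis by blast
qed

end
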